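(* The category $\mathsf{Alg}(\mathcal{K})$ of algebras for the endofunctor $\mathcal{K}:\mathsf{DL}\to\mathsf{DL}$, $L\mapsto L^{\Diamond\Box}$, is dually equivalent to the category $\mathsf{Coalg}(\mathcal{C})$ of coalgebras for the endofunctor $\mathcal{C}:\mathsf{PS}\to\mathsf{PS}$, $X\mapsto\mathcal{C}(X)$.
   Context: $\mathsf{DL}$ is the category of bounded distributive lattices and bounded lattice homomorphisms. A Priestley space is a compact space with a partial order $\le$ such that if $x\nleq y$ then there is a clopen upset containing $x$ and missing $y$; $\mathsf{PS}$ is the category of Priestley spaces and continuous order-preserving maps. For $L\in\mathsf{DL}$, $\mathcal{K}(L)=L^{\Diamond\Box}$ is the bounded distributive lattice freely generated by the set of symbols $\Diamond_a,\Box_a$ for $a\in L$ modulo the relations (for all $a,b\in L$): $\Diamond_0=0$, $\Diamond_a\vee\Diamond_b=\Diamond_{a\vee b}$, $\Box_1=1$, $\Box_a\wedge\Box_b=\Box_{a\wedge b}$, $\Box_{a\vee b}\le\Box_a\vee\Diamond_b$, and $\Box_a\wedge\Diamond_b\le\Diamond_{a\wedge b}$. For a homomorphism $f:L\to M$, $\mathcal{K}(f)$ is the homomorphism with $\mathcal{K}(f)(\Box_a)=\Box_{f(a)}$ and $\mathcal{K}(f)(\Diamond_a)=\Diamond_{f(a)}$. For $X\in\mathsf{PS}$, $\mathcal{C}(X)$ is the set of closed subsets $C$ of $X$ (including $\varnothing$) that are convex ($x,y\in C$ and $x\le z\le y$ imply $z\in C$), partially ordered by the Egli-Milner order ($A\sqsubseteq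 B$ iff $A\subseteq{\downarrow}B$ and $B\subseteq{\uparrow}A$), with the topology generated by the sets $\{C\mid C\cap S\neq\varnothing\}$ and $\{C\mid C\cap S=\varnothing\}$, where $S$ ranges over the clopen upsets and the clopen downsets of $X$; this is a Priestley space. For $f:X\to Y$ in $\mathsf{PS}$, $\mathcal{C}(f)(C)={\uparrow}f(C)\cap{\downarrow}f(C)$. For an endofunctor $\mathcal{T}$ on a category $\mathsf{C}$, an algebra is a pair $(A,f)$ with $f:\mathcal{T}(A)\to A$; a morphism $(A_1,f_1)\to(A_2,f_2)$ is a $\mathsf{C}$-morphism $\alpha:A_1\to A_2$ with $\alpha\circ f_1=f_2\circ\mathcal{T}(\alpha)$. Dually, a coalgebra is a pair $(A,f)$ with $f:A\to\mathcal{T}(A)$; a morphism is $\alpha:A_1\to A_2$ with $\mathcal{T}(\alpha)\circ f_1=f_2\circ\alpha$. $\mathsf{Alg}(\mathcal{T})$ and $\mathsf{Coalg}(\mathcal{T})$ are the resulting categories. *)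

theory Defs
  imports "HOL-Analysis.Analysis" "HOL-Algebra.Lattice"
begin

section \<open>Bounded distributive lattices\<close>

definition DL :: "'a gorder \<Rightarrow> bool" where
  "DL L \<longleftrightarrow> bounded_lattice L \<and>
     (\<forall>x\<in>carrier L. \<forall>y\<in>carrier L. \<forall>z\<in>carrier L.
        x \<sqinter>\<^bsub>L\<^esub> (y \<squnion>\<^bsub>L\<^esub> z) = (x \<sqinter>\<^bsub>L\<^esub> y) \<squnion>\<^bsub>L\<^esub> (x \<sqinter>\<^bsub>L\<^esub> z))"

text \<open>Here and below a morphism is an extensional function (\<open>undefined\<close> off its domain), so that
  equality of morphisms is equality in the logic.\<close>

definition DL_hom :: "'a gorder \<Rightarrow> 'b gorder \<Rightarrow> ('a \<Rightarrow> 'b) set" where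
  "DL_hom L M = {f \<in> carrier L \<rightarrow>\<^sub>E carrier M.
     f \<bottom>\<^bsub>L\<^esub> = \<bottom>\<^bsub>M\<^esub> \<and> f \<top>\<^bsub>L\<^esub> = \<top>\<^bsub>M\<^esub> \<and>
     (\<forall>x\<in>carrier L. \<forall>y\<in>carrier L.
        f (x \<squnion>\<^bsub>L\<^esub> y) = f x \<squnion>\<^bsub>M\<^esub> f y \<and> f (x \<sqinter>\<^bsub>L\<^esub> y) = f x \<sqinter>\<^bsub>M\<^esub> f y)}"


section \<open>Priestley spaces\<close>

record 'a pospace =
  Topo :: "'a topology"
  Ord :: "'a rel"

abbreviation points :: "'a pospace \<Rightarrow> 'a set" where
  "points X \<equiv> topspace (Topo X)"

definition up :: "'a pospace \<Rightarrow> 'a set \<Rightarrow> 'a set" where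
  "up X A = Ord X `` A"

definition down :: "'a pospace \<Rightarrow> 'a set \<Rightarrow> 'a set" where
  "down X A = (Ord X)\<inverse> `` A"

definition clopen_upsets :: "'a pospace \<Rightarrow> 'a set set" where
  "clopen_upsets X = {U. openin (Topo X) U \<and> closedin (Topo X) U \<and> up X U \<subseteq> U}"

definition clopen_downsets :: "'a pospace \<Rightarrow> 'a set set" where
  "clopen_downsets X = {U. openin (Topo X) U \<and> closedin (Topo X) U \<and> down X U \<subseteq> U}"

definition PS :: "'a pospace \<Rightarrow> bool" where
  "PS X \<longleftrightarrow> compact_space (Topo X) \<and> partial_order_on (points X) (Ord X) \<and>
     (\<forall>x\<in>points X. \<forall>y\<in>points X. (x, y) \<notin> Ord X \<longrightarrow> (\<exists>U\<in>clopen_upsets X. x \<in> U \<and> y \<notin> U))"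

definition PS_hom :: "'a pospace \<Rightarrow> 'b pospace \<Rightarrow> ('a \<Rightarrow> 'b) set" where
  "PS_hom X Y = {f \<in> points X \<rightarrow>\<^sub>E points Y.
     continuous_map (Topo X) (Topo Y) f \<and> (\<forall>(x, y)\<in>Ord X. (f x, f y) \<in> Ord Y)}"


section \<open>The functor \<open>\<K>\<close>\<close>

text \<open>Lattice terms over the symbols \<open>\<diamond>\<^sub>a\<close>, \<open>\<box>\<^sub>a\<close>.\<close>

datatype 'a kterm =
    Dia 'a | Box 'a
  | KBot | KTop | KMeet "'a kterm" "'a kterm" | KJoin "'a kterm" "'a kterm"

definition kterms :: "'a gorder \<Rightarrow> 'a kterm set" where
  "kterms L = {t. set_kterm t \<subseteq> carrier L}"

text \<open>The least preorder on terms that makes them a bounded distributive lattice and satisfies the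
  given relations (an equation being two inequalities).  Its quotient is therefore the bounded
  distributive lattice freely generated by the symbols modulo the relations.\<close>

inductive kle :: "'a gorder \<Rightarrow> 'a kterm \<Rightarrow> 'a kterm \<Rightarrow> bool" for L where
  kle_refl: "t \<in> kterms L \<Longrightarrow> kle L t t"
| kle_trans: "kle L r s \<Longrightarrow> kle L s t \<Longrightarrow> kle L r t"
| kle_bot: "t \<in> kterms L \<Longrightarrow> kle L KBot t"
| kle_top: "t \<in> kterms L \<Longrightarrow> kle L t KTop"
| kle_meet1: "s \<in> kterms L \<Longrightarrow> t \<in> kterms L \<Longrightarrow> kle L (KMeet s t) s"
| kle_meet2: "s \<in> kterms L \<Longrightarrow> t \<in> kterms L \<Longrightarrow> kle L (KMeet s t) t"
| kle_meet: "kle L r s \<Longrightarrow> kle L r t \<Longrightarrow> kle L r (KMeet s t)"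
| kle_join1: "s \<in> kterms L \<Longrightarrow> t \<in> kterms L \<Longrightarrow> kle L s (KJoin s t)"
| kle_join2: "s \<in> kterms L \<Longrightarrow> t \<in> kterms L \<Longrightarrow> kle L t (KJoin s t)"
| kle_join: "kle L s r \<Longrightarrow> kle L t r \<Longrightarrow> kle L (KJoin s t) r"
| kle_distrib: "r \<in> kterms L \<Longrightarrow> s \<in> kterms L \<Longrightarrow> t \<in> kterms L \<Longrightarrow>
    kle L (KMeet r (KJoin s t)) (KJoin (KMeet r s) (KMeet r t))"
| dia_bot: "kle L (Dia \<bottom>\<^bsub>L\<^esub>) KBot" if "\<bottom>\<^bsub>L\<^esub> \<in> carrier L"
| dia_join1: "a \<in> carrier L \<Longrightarrow> b \<in> carrier L \<Longrightarrow> a \<squnion>\<^bsub>L\<^esub> b \<in> carrier L \<Longrightarrow>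
    kle L (KJoin (Dia a) (Dia b)) (Dia (a \<squnion>\<^bsub>L\<^esub> b))"
| dia_join2: "a \<in> carrier L \<Longrightarrow> b \<in> carrier L \<Longrightarrow> a \<squnion>\<^bsub>L\<^esub> b \<in> carrier L \<Longrightarrow>
    kle L (Dia (a \<squnion>\<^bsub>L\<^esub> b)) (KJoin (Dia a) (Dia b))"
| box_top: "kle L KTop (Box \<top>\<^bsub>L\<^esub>)" if "\<top>\<^bsub>L\<^esub> \<in> carrier L"
| box_meet1: "a \<in> carrier L \<Longrightarrow> b \<in> carrier L \<Longrightarrow> a \<sqinter>\<^bsub>L\<^esub> b \<in> carrier L \<Longrightarrow>
    kle L (KMeet (Box a) (Box b)) (Box (a \<sqinter>\<^bsub>L\<^esub> b))"
| box_meet2: "a \<in> carrier L \<Longrightarrow> b \<in> carrier L \<Longrightarrow> a \<sqinter>\<^bsub>L\<^esub> b \<in> carrier L \<Longrightarrow>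
    kle L (Box (a \<sqinter>\<^bsub>L\<^esub> b)) (KMeet (Box a) (Box b))"
| box_join: "a \<in> carrier L \<Longrightarrow> b \<in> carrier L \<Longrightarrow> a \<squnion>\<^bsub>L\<^esub> b \<in> carrier L \<Longrightarrow>
    kle L (Box (a \<squnion>\<^bsub>L\<^esub> b)) (KJoin (Box a) (Dia b))"
| box_dia: "a \<in> carrier L \<Longrightarrow> b \<in> carrier L \<Longrightarrow> a \<sqinter>\<^bsub>L\<^esub> b \<in> carrier L \<Longrightarrow>
    kle L (KMeet (Box a) (Dia b)) (Dia (a \<sqinter>\<^bsub>L\<^esub> b))"

definition keq :: "'a gorder \<Rightarrow> 'a kterm rel" where
  "keq L = {(s, t). kle L s t \<and> kle L t s}"

definition K :: "'a gorder \<Rightarrow> 'a kterm set gorder" where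
  "K L = \<lparr>carrier = kterms L // keq L, eq = (=), le = (\<lambda>c d. \<exists>s\<in>c. \<exists>t\<in>d. kle L s t)\<rparr>"

definition dia :: "'a gorder \<Rightarrow> 'a \<Rightarrow> 'a kterm set" where
  "dia L a = keq L `` {Dia a}"

definition box :: "'a gorder \<Rightarrow> 'a \<Rightarrow> 'a kterm set" where
  "box L a = keq L `` {Box a}"

text \<open>The class of a term goes to the class of the term with every symbol \<open>\<diamond>\<^sub>a\<close>, \<open>\<box>\<^sub>a\<close> renamed to
  \<open>\<diamond>\<^sub>f\<^sub>a\<close>, \<open>\<box>\<^sub>f\<^sub>a\<close>.\<close>

definition Kmap :: "'a gorder \<Rightarrow> 'b gorder \<Rightarrow> ('a \<Rightarrow> 'b) \<Rightarrow> 'a kterm set \<Rightarrow> 'b kterm set" where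
  "Kmap L M f = (\<lambda>c\<in>carrier (K L). keq M `` (map_kterm f ` c))"


section \<open>The functor \<open>\<C>\<close>\<close>

definition convex_closed :: "'a pospace \<Rightarrow> 'a set set" where
  "convex_closed X = {C. closedin (Topo X) C \<and>
     (\<forall>x\<in>C. \<forall>y\<in>C. \<forall>z. (x, z) \<in> Ord X \<and> (z, y) \<in> Ord X \<longrightarrow> z \<in> C)}"

definition C :: "'a pospace \<Rightarrow> 'a set pospace" where
  "C X = \<lparr>
     Topo = topology_generated_by
       ({{A \<in> convex_closed X. A \<inter> S \<noteq> {}} | S. S \<in> clopen_upsets X \<union> clopen_downsets X} \<union>
        {{A \<in> convex_closed X. A \<inter> S = {}} | S. S \<in> clopen_upsets X \<union> clopen_downsets X}),
     Ord = {(A, B). A \<in> convex_closed X \<and> B \<in> convex_closed X \<and> A \<subseteq> down X B \<and> B \<subseteq> up X A}\<rparr>"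

definition Cmap :: "'a pospace \<Rightarrow> 'b pospace \<Rightarrow> ('a \<Rightarrow> 'b) \<Rightarrow> 'a set \<Rightarrow> 'b set" where
  "Cmap X Y f = (\<lambda>A\<in>points (C X). up Y (f ` A) \<inter> down Y (f ` A))"


section \<open>Algebras for \<open>\<K>\<close> and coalgebras for \<open>\<C>\<close>\<close>

text \<open>\<^const>\<open>K\<close> and \<^const>\<open>C\<close> change the carrier type, so a (co)algebra structure map is a map
  between different types.\<close>

type_synonym 'a kalg = "'a gorder \<times> ('a kterm set \<Rightarrow> 'a)"
type_synonym 'a ccoalg = "'a pospace \<times> ('a \<Rightarrow> 'a set)"

definition kalg :: "'a kalg \<Rightarrow> bool" where
  "kalg A \<longleftrightarrow> DL (fst A) \<and> snd A \<in> DL_hom (K (fst A)) (fst A)"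

definition kalg_hom :: "'a kalg \<Rightarrow> 'b kalg \<Rightarrow> ('a \<Rightarrow> 'b) set" where
  "kalg_hom A B = {h \<in> DL_hom (fst A) (fst B).
     compose (carrier (K (fst A))) h (snd A) =
     compose (carrier (K (fst A))) (snd B) (Kmap (fst A) (fst B) h)}"

definition kalg_id :: "'a kalg \<Rightarrow> 'a \<Rightarrow> 'a" where
  "kalg_id A = (\<lambda>x\<in>carrier (fst A). x)"

definition kalg_comp :: "'a kalg \<Rightarrow> ('b \<Rightarrow> 'c) \<Rightarrow> ('a \<Rightarrow> 'b) \<Rightarrow> 'a \<Rightarrow> 'c" where
  "kalg_comp A k h = compose (carrier (fst A)) k h"

definition kalg_iso :: "'a kalg \<Rightarrow> 'b kalg \<Rightarrow> ('a \<Rightarrow> 'b) set" where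
  "kalg_iso A B = {h \<in> kalg_hom A B. \<exists>k\<in>kalg_hom B A.
     kalg_comp A k h = kalg_id A \<and> kalg_comp B h k = kalg_id B}"

definition ccoalg :: "'a ccoalg \<Rightarrow> bool" where
  "ccoalg X \<longleftrightarrow> PS (fst X) \<and> snd X \<in> PS_hom (fst X) (C (fst X))"

definition ccoalg_hom :: "'a ccoalg \<Rightarrow> 'b ccoalg \<Rightarrow> ('a \<Rightarrow> 'b) set" where
  "ccoalg_hom X Y = {h \<in> PS_hom (fst X) (fst Y).
     compose (points (fst X)) (Cmap (fst X) (fst Y) h) (snd X) =
     compose (points (fst X)) (snd Y) h}"

definition ccoalg_id :: "'a ccoalg \<Rightarrow> 'a \<Rightarrow> 'a" where
  "ccoalg_id X = (\<lambda>x\<in>points (fst X). x)"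

definition ccoalg_comp :: "'a ccoalg \<Rightarrow> ('b \<Rightarrow> 'c) \<Rightarrow> ('a \<Rightarrow> 'b) \<Rightarrow> 'a \<Rightarrow> 'c" where
  "ccoalg_comp X k h = compose (points (fst X)) k h"

definition ccoalg_iso :: "'a ccoalg \<Rightarrow> 'b ccoalg \<Rightarrow> ('a \<Rightarrow> 'b) set" where
  "ccoalg_iso X Y = {h \<in> ccoalg_hom X Y. \<exists>k\<in>ccoalg_hom Y X.
     ccoalg_comp X k h = ccoalg_id X \<and> ccoalg_comp Y h k = ccoalg_id Y}"


section \<open>Categories and dual equivalence\<close>

text \<open>Only the values of the last three components on objects (and on arrows in the relevant
  hom-sets) are meaningful; \<open>Comp c x y z g f\<close> is \<open>g \<circ> f\<close> for \<open>f : x \<rightarrow> y\<close> and \<open>g : y \<rightarrow> z\<close>.\<close>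

record ('o, 'm) cat =
  Obj :: "'o set"
  Hom :: "'o \<Rightarrow> 'o \<Rightarrow> 'm set"
  Ident :: "'o \<Rightarrow> 'm"
  Comp :: "'o \<Rightarrow> 'o \<Rightarrow> 'o \<Rightarrow> 'm \<Rightarrow> 'm \<Rightarrow> 'm"

definition is_category :: "('o, 'm) cat \<Rightarrow> bool" where
  "is_category c \<longleftrightarrow>
     (\<forall>x\<in>Obj c. Ident c x \<in> Hom c x x) \<and>
     (\<forall>x\<in>Obj c. \<forall>y\<in>Obj c. \<forall>z\<in>Obj c. \<forall>f\<in>Hom c x y. \<forall>g\<in>Hom c y z.
        Comp c x y z g f \<in> Hom c x z) \<and>
     (\<forall>x\<in>Obj c. \<forall>y\<in>Obj c. \<forall>f\<in>Hom c x y.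
        Comp c x x y f (Ident c x) = f \<and> Comp c x y y (Ident c y) f = f) \<and>
     (\<forall>w\<in>Obj c. \<forall>x\<in>Obj c. \<forall>y\<in>Obj c. \<forall>z\<in>Obj c.
        \<forall>f\<in>Hom c w x. \<forall>g\<in>Hom c x y. \<forall>h\<in>Hom c y z.
        Comp c w y z h (Comp c w x y g f) = Comp c w x z (Comp c x y z h g) f)"

definition op_cat :: "('o, 'm) cat \<Rightarrow> ('o, 'm) cat" where
  "op_cat c = \<lparr>Obj = Obj c, Hom = (\<lambda>x y. Hom c y x), Ident = Ident c,
     Comp = (\<lambda>x y z g f. Comp c z y x f g)\<rparr>"

definition iso_arrow :: "('o, 'm) cat \<Rightarrow> 'o \<Rightarrow> 'o \<Rightarrow> 'm \<Rightarrow> bool" where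
  "iso_arrow c x y f \<longleftrightarrow> f \<in> Hom c x y \<and>
     (\<exists>g\<in>Hom c y x. Comp c x y x g f = Ident c x \<and> Comp c y x y f g = Ident c y)"

type_synonym ('o, 'm, 'p, 'n) functor_data = "('o \<Rightarrow> 'p) \<times> ('o \<Rightarrow> 'o \<Rightarrow> 'm \<Rightarrow> 'n)"

definition is_functor :: "('o, 'm) cat \<Rightarrow> ('p, 'n) cat \<Rightarrow> ('o, 'm, 'p, 'n) functor_data \<Rightarrow> bool" where
  "is_functor c d F \<longleftrightarrow>
     (\<forall>x\<in>Obj c. fst F x \<in> Obj d) \<and>
     (\<forall>x\<in>Obj c. \<forall>y\<in>Obj c. \<forall>f\<in>Hom c x y. snd F x y f \<in> Hom d (fst F x) (fst F y)) \<and>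
     (\<forall>x\<in>Obj c. snd F x x (Ident c x) = Ident d (fst F x)) \<and>
     (\<forall>x\<in>Obj c. \<forall>y\<in>Obj c. \<forall>z\<in>Obj c. \<forall>f\<in>Hom c x y. \<forall>g\<in>Hom c y z.
        snd F x z (Comp c x y z g f) =
        Comp d (fst F x) (fst F y) (fst F z) (snd F y z g) (snd F x y f))"

definition id_functor :: "('o, 'm, 'o, 'm) functor_data" where
  "id_functor = (\<lambda>x. x, \<lambda>x y f. f)"

definition comp_functor ::
  "('p, 'n, 'q, 'l) functor_data \<Rightarrow> ('o, 'm, 'p, 'n) functor_data \<Rightarrow> ('o, 'm, 'q, 'l) functor_data"
where
  "comp_functor G F =
     (\<lambda>x. fst G (fst F x), \<lambda>x y f. snd G (fst F x) (fst F y) (snd F x y f))"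

definition natural_iso :: "('o, 'm) cat \<Rightarrow> ('p, 'n) cat \<Rightarrow>
    ('o, 'm, 'p, 'n) functor_data \<Rightarrow> ('o, 'm, 'p, 'n) functor_data \<Rightarrow> ('o \<Rightarrow> 'n) \<Rightarrow> bool" where
  "natural_iso c d F G \<eta> \<longleftrightarrow>
     (\<forall>x\<in>Obj c. iso_arrow d (fst F x) (fst G x) (\<eta> x)) \<and>
     (\<forall>x\<in>Obj c. \<forall>y\<in>Obj c. \<forall>f\<in>Hom c x y.
        Comp d (fst F x) (fst F y) (fst G y) (\<eta> y) (snd F x y f) =
        Comp d (fst F x) (fst G x) (fst G y) (snd G x y f) (\<eta> x))"

definition equivalent_categories :: "('o, 'm) cat \<Rightarrow> ('p, 'n) cat \<Rightarrow> bool" where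
  "equivalent_categories c d \<longleftrightarrow> is_category c \<and> is_category d \<and>
     (\<exists>F G \<eta> \<epsilon>. is_functor c d F \<and> is_functor d c G \<and>
        natural_iso c c id_functor (comp_functor G F) \<eta> \<and>
        natural_iso d d (comp_functor F G) id_functor \<epsilon>)"

definition dually_equivalent :: "('o, 'm) cat \<Rightarrow> ('p, 'n) cat \<Rightarrow> bool" where
  "dually_equivalent c d \<longleftrightarrow> equivalent_categories (op_cat c) d"

text \<open>Since no type contains all lattices, the categories are formed relative to a universe:
  a notion of small set, on a type that is large enough to contain a copy of the power set of each
  of its small subsets.\<close>

definition universe :: "('u set \<Rightarrow> bool) \<Rightarrow> bool" where
  "universe small \<longleftrightarrow>
     (\<forall>A B. small A \<longrightarrow> B \<lesssim> A \<longrightarrow> small B) \<and>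
     (\<forall>A. small A \<longrightarrow> (\<exists>B. small B \<and> Pow A \<lesssim> B))"

definition Alg_K :: "('u set \<Rightarrow> bool) \<Rightarrow> ('u kalg, 'u \<Rightarrow> 'u) cat" where
  "Alg_K small = \<lparr>Obj = {A. kalg A \<and> small (carrier (fst A))}, Hom = kalg_hom,
     Ident = kalg_id, Comp = (\<lambda>A B D. kalg_comp A)\<rparr>"

definition Coalg_C :: "('u set \<Rightarrow> bool) \<Rightarrow> ('u ccoalg, 'u \<Rightarrow> 'u) cat" where
  "Coalg_C small = \<lparr>Obj = {X. ccoalg X \<and> small (points (fst X))}, Hom = ccoalg_hom,
     Ident = ccoalg_id, Comp = (\<lambda>X Y Z. ccoalg_comp X)\<rparr>"


section \<open>The dual functors on algebras and coalgebras over arbitrary types\<close>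

text \<open>For algebras and coalgebras over arbitrary types, without a universe, the functors of the duality
  are type-polymorphic and so cannot be existentially quantified; they are given explicitly.\<close>

definition prime_filters :: "'a gorder \<Rightarrow> 'a set set" where
  "prime_filters L = {p. p \<subseteq> carrier L \<and> \<top>\<^bsub>L\<^esub> \<in> p \<and> \<bottom>\<^bsub>L\<^esub> \<notin> p \<and>
     (\<forall>a\<in>p. \<forall>b\<in>carrier L. a \<sqsubseteq>\<^bsub>L\<^esub> b \<longrightarrow> b \<in> p) \<and>
     (\<forall>a\<in>p. \<forall>b\<in>p. a \<sqinter>\<^bsub>L\<^esub> b \<in> p) \<and>
     (\<forall>a\<in>carrier L. \<forall>b\<in>carrier L. a \<squnion>\<^bsub>L\<^esub> b \<in> p \<longrightarrow> a \<in> p \<or> b \<in> p)}"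

definition dual_space :: "'a gorder \<Rightarrow> 'a set pospace" where
  "dual_space L = \<lparr>
     Topo = topology_generated_by
       ({{p \<in> prime_filters L. a \<in> p} | a. a \<in> carrier L} \<union>
        {{p \<in> prime_filters L. a \<notin> p} | a. a \<in> carrier L}),
     Ord = {(p, q). p \<in> prime_filters L \<and> q \<in> prime_filters L \<and> p \<subseteq> q}\<rparr>"

definition dual_lattice :: "'a pospace \<Rightarrow> 'a set gorder" where
  "dual_lattice X = \<lparr>carrier = clopen_upsets X, eq = (=), le = (\<subseteq>)\<rparr>"

text \<open>The Priestley dual \<open>p \<mapsto> f\<inverse>(p)\<close> of the structure map \<open>f : \<K>(L) \<rightarrow> L\<close>, with a prime filter \<open>q\<close>
  of \<open>\<K>(L)\<close> read as the closed convex set of those prime filters \<open>p'\<close> of \<open>L\<close> for which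
  \<open>\<box>\<^sub>a \<in> q\<close> implies \<open>a \<in> p'\<close> and \<open>a \<in> p'\<close> implies \<open>\<diamond>\<^sub>a \<in> q\<close>.\<close>

definition kalg_dual :: "'a kalg \<Rightarrow> 'a set ccoalg" where
  "kalg_dual A = (dual_space (fst A),
     \<lambda>p\<in>prime_filters (fst A). {p' \<in> prime_filters (fst A). \<forall>a\<in>carrier (fst A).
        (snd A (box (fst A) a) \<in> p \<longrightarrow> a \<in> p') \<and> (a \<in> p' \<longrightarrow> snd A (dia (fst A) a) \<in> p)})"

definition kalg_dual_map :: "'a kalg \<Rightarrow> 'b kalg \<Rightarrow> ('a \<Rightarrow> 'b) \<Rightarrow> 'b set \<Rightarrow> 'a set" where
  "kalg_dual_map A B h = (\<lambda>p\<in>prime_filters (fst B). {a \<in> carrier (fst A). h a \<in> p})"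

primrec kinterp :: "'a pospace \<Rightarrow> ('a \<Rightarrow> 'a set) \<Rightarrow> 'a set kterm \<Rightarrow> 'a set" where
  "kinterp X g (Dia U) = {x \<in> points X. g x \<inter> U \<noteq> {}}"
| "kinterp X g (Box U) = {x \<in> points X. g x \<subseteq> U}"
| "kinterp X g KBot = {}"
| "kinterp X g KTop = points X"
| "kinterp X g (KMeet s t) = kinterp X g s \<inter> kinterp X g t"
| "kinterp X g (KJoin s t) = kinterp X g s \<union> kinterp X g t"

definition ccoalg_dual :: "'a ccoalg \<Rightarrow> 'a set kalg" where
  "ccoalg_dual X = (dual_lattice (fst X),
     \<lambda>c\<in>carrier (K (dual_lattice (fst X))). the_elem (kinterp (fst X) (snd X) ` c))"

definition ccoalg_dual_map :: "'a ccoalg \<Rightarrow> 'b ccoalg \<Rightarrow> ('a \<Rightarrow> 'b) \<Rightarrow> 'b set \<Rightarrow> 'a set" where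
  "ccoalg_dual_map X Y h = (\<lambda>U\<in>clopen_upsets (fst Y). {x \<in> points (fst X). h x \<in> U})"

definition kalg_unit :: "'a kalg \<Rightarrow> 'a \<Rightarrow> 'a set set" where
  "kalg_unit A = (\<lambda>a\<in>carrier (fst A). {p \<in> prime_filters (fst A). a \<in> p})"

definition ccoalg_unit :: "'a ccoalg \<Rightarrow> 'a \<Rightarrow> 'a set set" where
  "ccoalg_unit X = (\<lambda>x\<in>points (fst X). {U \<in> clopen_upsets (fst X). x \<in> U})"

end

theory Submission
  imports Defs
begin

text \<open>A structure map \<open>\<K>(L) \<rightarrow> L\<close> amounts to two operators \<open>\<diamond>, \<box>\<close> on \<open>L\<close> satisfying the defining
  relations of \<open>\<K>\<close>. On the other side, a closed convex subset of a Priestley space is determined by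
  the clopen upsets that meet it and by those that contain it, so a map into \<open>\<C>(X)\<close> amounts to the two
  operators \<open>U \<mapsto> {x. g x \<inter> U \<noteq> {}}\<close> and \<open>U \<mapsto> {x. g x \<subseteq> U}\<close> on clopen upsets, and morphisms on both
  sides are the maps compatible with these operators. Under Priestley duality the two descriptions
  correspond, because for a prime filter \<open>p\<close> of \<open>L\<close> the set \<open>S\<close> of prime filters \<open>q\<close> with
  \<open>\<box>\<inverse>(p) \<subseteq> q \<subseteq> \<diamond>\<inverse>(p)\<close> meets \<open>{q. a \<in> q}\<close> iff \<open>\<diamond>a \<in> p\<close> and is contained in it iff \<open>\<box>a \<in> p\<close>:
  the mixed relations between \<open>\<box>\<close> and \<open>\<diamond>\<close> are exactly what the prime filter theorem needs here.\<close>

section \<open>Bounded distributive lattices\<close>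

text \<open>Dualizing raises the carrier type: prime filters and clopen upsets of objects over
  \<open>'a\<close> live over \<open>'a set\<close>, so the duality relates objects over different
  types, and double duals live over \<open>'a set set\<close>. A universe on one type
  \<open>'u\<close> offers only injections of power sets into small sets. Hence the functors of the
  categorical statement are the polymorphic duals conjugated by isomorphisms onto relabelled copies,
  and the naturality squares are checked in the uncopied double duals, where applying the injective
  units removes the choices made. Freeness of \<K> enters in two elementary forms: a homomorphism
  out of \<K>(L) is fixed by its values on the symbols, and a recursion on terms that is monotone
  for \<open>kle\<close> passes to classes. Compactness does the main topological work: it separates
  compact sets by clopen upsets, and it finds the point that belongs to a given prime filter of
  clopen upsets.\<close>

locale dl_structure =
  fixes L :: "'a gorder" (structure) and j m :: "'a \<Rightarrow> 'a \<Rightarrow> 'a" and b t :: 'a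
  assumes eq_is_eq: "eq L = (=)"
    and refl: "x \<in> carrier L \<Longrightarrow> x \<sqsubseteq> x"
    and antisym: "\<lbrakk>x \<in> carrier L; y \<in> carrier L; x \<sqsubseteq> y; y \<sqsubseteq> x\<rbrakk> \<Longrightarrow> x = y"
    and trans: "\<lbrakk>x \<in> carrier L; y \<in> carrier L; z \<in> carrier L; x \<sqsubseteq> y; y \<sqsubseteq> z\<rbrakk> \<Longrightarrow> x \<sqsubseteq> z"
    and j_closed: "\<lbrakk>x \<in> carrier L; y \<in> carrier L\<rbrakk> \<Longrightarrow> j x y \<in> carrier L"
    and j_left: "\<lbrakk>x \<in> carrier L; y \<in> carrier L\<rbrakk> \<Longrightarrow> x \<sqsubseteq> j x y"
    and j_right: "\<lbrakk>x \<in> carrier L; y \<in> carrier L\<rbrakk> \<Longrightarrow> y \<sqsubseteq> j x y"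
    and j_least: "\<lbrakk>x \<in> carrier L; y \<in> carrier L; z \<in> carrier L; x \<sqsubseteq> z; y \<sqsubseteq> z\<rbrakk> \<Longrightarrow> j x y \<sqsubseteq> z"
    and m_closed: "\<lbrakk>x \<in> carrier L; y \<in> carrier L\<rbrakk> \<Longrightarrow> m x y \<in> carrier L"
    and m_left: "\<lbrakk>x \<in> carrier L; y \<in> carrier L\<rbrakk> \<Longrightarrow> m x y \<sqsubseteq> x"
    and m_right: "\<lbrakk>x \<in> carrier L; y \<in> carrier L\<rbrakk> \<Longrightarrow> m x y \<sqsubseteq> y"
    and m_greatest: "\<lbrakk>x \<in> carrier L; y \<in> carrier L; z \<in> carrier L; z \<sqsubseteq> x; z \<sqsubseteq> y\<rbrakk> \<Longrightarrow> z \<sqsubseteq> m x y"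
    and b_closed: "b \<in> carrier L" and b_least: "x \<in> carrier L \<Longrightarrow> b \<sqsubseteq> x"
    and t_closed: "t \<in> carrier L" and t_greatest: "x \<in> carrier L \<Longrightarrow> x \<sqsubseteq> t"
    and distrib: "\<lbrakk>x \<in> carrier L; y \<in> carrier L; z \<in> carrier L\<rbrakk> \<Longrightarrow> m x (j y z) \<sqsubseteq> j (m x y) (m x z)"
begin

text \<open>The library asks for the existence of bounds and picks the operations by description;
  the data \<open>j\<close>, \<open>m\<close>, \<open>b\<close>, \<open>t\<close> serve as witnesses
  and afterwards as the computed operations. The term lattice, the lattice of clopen upsets and
  relabelled copies of lattices are all built this way.\<close>

lemma bounded_lattice: "bounded_lattice L"
proof -
  interpret partial_order L
    by unfold_locales (auto simp: eq_is_eq intro: refl antisym dest: trans)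
  show ?thesis
  proof unfold_locales
    fix x y assume xy: "x \<in> carrier L" "y \<in> carrier L"
    show "\<exists>s. least L s (Upper L {x, y})"
      by (rule exI [of _ "j x y"])
        (use xy in \<open>auto simp: least_def Upper_def intro: j_closed j_left j_right j_least\<close>)
    show "\<exists>s. greatest L s (Lower L {x, y})"
      by (rule exI [of _ "m x y"])
        (use xy in \<open>auto simp: greatest_def Lower_def intro: m_closed m_left m_right m_greatest\<close>)
  next
    show "\<exists>x. least L x (carrier L)"
      using b_closed b_least by (auto simp: least_def)
    show "\<exists>x. greatest L x (carrier L)"
      using t_closed t_greatest by (auto simp: greatest_def)
  qed
qed

lemma join_eq: "x \<squnion> y = j x y" if "x \<in> carrier L" "y \<in> carrier L"
proof -
  interpret bounded_lattice L by (rule bounded_lattice)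
  show ?thesis
    using that by (intro antisym) (auto intro: j_closed j_least j_left j_right join_le join_left join_right)
qed

lemma meet_eq: "x \<sqinter> y = m x y" if "x \<in> carrier L" "y \<in> carrier L"
proof -
  interpret bounded_lattice L by (rule bounded_lattice)
  show ?thesis
    using that by (intro antisym) (auto intro: m_closed m_greatest m_left m_right meet_le meet_left meet_right)
qed

lemma bottom_eq: "\<bottom> = b"
proof -
  interpret bounded_lattice L by (rule bounded_lattice)
  show ?thesis by (rule antisym) (auto intro: b_closed b_least)
qed

lemma top_eq: "\<top> = t"
proof -
  interpret bounded_lattice L by (rule bounded_lattice)
  show ?thesis by (rule antisym) (auto intro: t_closed t_greatest)
qed

lemma DL: "DL L"
  unfolding DL_def
proof (intro conjI ballI bounded_lattice)
  fix x y z assume xyz: "x \<in> carrier L" "y \<in> carrier L" "z \<in> carrier L"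
  \<comment> \<open>The locale assumes one half of distributivity; this other half holds in every
    lattice.\<close>
  have "m x y \<sqsubseteq> m x (j y z)" "m x z \<sqsubseteq> m x (j y z)"
    using xyz by (meson m_greatest m_closed m_left m_right j_closed j_left j_right trans)+
  then have "m x (j y z) = j (m x y) (m x z)"
    using xyz by (intro antisym) (auto intro: distrib j_least m_closed j_closed)
  then show "x \<sqinter> (y \<squnion> z) = x \<sqinter> y \<squnion> x \<sqinter> z"
    using xyz by (simp add: join_eq meet_eq j_closed m_closed)
qed

end

section \<open>Filters, ideals and the prime filter theorem\<close>

definition is_filter :: "'a gorder \<Rightarrow> 'a set \<Rightarrow> bool" where
  "is_filter L F \<longleftrightarrow> F \<subseteq> carrier L \<and> \<top>\<^bsub>L\<^esub> \<in> F \<and>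
     (\<forall>a\<in>F. \<forall>b\<in>carrier L. a \<sqsubseteq>\<^bsub>L\<^esub> b \<longrightarrow> b \<in> F) \<and> (\<forall>a\<in>F. \<forall>b\<in>F. a \<sqinter>\<^bsub>L\<^esub> b \<in> F)"

definition is_ideal :: "'a gorder \<Rightarrow> 'a set \<Rightarrow> bool" where
  "is_ideal L I \<longleftrightarrow> I \<subseteq> carrier L \<and> \<bottom>\<^bsub>L\<^esub> \<in> I \<and>
     (\<forall>a\<in>I. \<forall>b\<in>carrier L. b \<sqsubseteq>\<^bsub>L\<^esub> a \<longrightarrow> b \<in> I) \<and> (\<forall>a\<in>I. \<forall>b\<in>I. a \<squnion>\<^bsub>L\<^esub> b \<in> I)"

lemma prime_filters_iff:
  "p \<in> prime_filters L \<longleftrightarrow> is_filter L p \<and> \<bottom>\<^bsub>L\<^esub> \<notin> p \<and>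
     (\<forall>a\<in>carrier L. \<forall>b\<in>carrier L. a \<squnion>\<^bsub>L\<^esub> b \<in> p \<longrightarrow> a \<in> p \<or> b \<in> p)"
  by (auto simp: prime_filters_def is_filter_def)

locale dl =
  fixes L :: "'a gorder" (structure)
  assumes DL: "DL L"

context dl
begin

lemma bounded_lattice: "bounded_lattice L"
  using DL by (simp add: DL_def)

lemma distrib: "\<lbrakk>x \<in> carrier L; y \<in> carrier L; z \<in> carrier L\<rbrakk> \<Longrightarrow> x \<sqinter> (y \<squnion> z) = x \<sqinter> y \<squnion> x \<sqinter> z"
  using DL by (simp add: DL_def)

end

context dl
begin

(* Only these facts are lifted from the library locale: its introduction rules
   le_cong_l and le_cong_r make auto and blast loop. *)
interpretation bl: bounded_lattice L
  by (rule bounded_lattice)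

lemmas le_refl [simp] = bl.le_refl
  and antisymm = bl.le_antisym
  and le_trans = bl.le_trans
  and join_closed [simp] = bl.join_closed
  and join_left = bl.join_left
  and join_right = bl.join_right
  and join_le = bl.join_le
  and meet_closed [simp] = bl.meet_closed
  and meet_left = bl.meet_left
  and meet_right = bl.meet_right
  and meet_le = bl.meet_le
  and bottom_closed [simp] = bl.bottom_closed
  and bottom_lower [simp] = bl.bottom_lower
  and top_closed [simp] = bl.top_closed
  and top_higher [simp] = bl.top_higher

end

context dl
begin

lemma meet_mono:
  "\<lbrakk>a \<sqsubseteq> c; b \<sqsubseteq> d; a \<in> carrier L; b \<in> carrier L; c \<in> carrier L; d \<in> carrier L\<rbrakk> \<Longrightarrow> a \<sqinter> b \<sqsubseteq> c \<sqinter> d"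
  by (rule meet_le) (auto intro: le_trans [OF meet_left] le_trans [OF meet_right])

lemma join_mono:
  "\<lbrakk>a \<sqsubseteq> c; b \<sqsubseteq> d; a \<in> carrier L; b \<in> carrier L; c \<in> carrier L; d \<in> carrier L\<rbrakk> \<Longrightarrow> a \<squnion> b \<sqsubseteq> c \<squnion> d"
  by (rule join_le) (auto intro: le_trans [OF _ join_left] le_trans [OF _ join_right])

lemma join_bottom [simp]: "x \<in> carrier L \<Longrightarrow> x \<squnion> \<bottom> = x"
  by (intro antisymm) (auto intro: join_le join_left)

lemma meet_top [simp]: "x \<in> carrier L \<Longrightarrow> x \<sqinter> \<top> = x"
  by (intro antisymm) (auto intro: meet_le meet_left)

lemma join_absorb: "\<lbrakk>x \<sqsubseteq> y; x \<in> carrier L; y \<in> carrier L\<rbrakk> \<Longrightarrow> x \<squnion> y = y"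
  by (intro antisymm) (auto intro: join_le join_right)

lemma meet_absorb: "\<lbrakk>x \<sqsubseteq> y; x \<in> carrier L; y \<in> carrier L\<rbrakk> \<Longrightarrow> x \<sqinter> y = x"
  by (intro antisymm) (auto intro: meet_le meet_left)

lemma filter_principal: "a \<in> carrier L \<Longrightarrow> is_filter L {c \<in> carrier L. a \<sqsubseteq> c}"
  unfolding is_filter_def by (auto intro: meet_le) (meson le_trans)

lemma ideal_principal: "a \<in> carrier L \<Longrightarrow> is_ideal L {c \<in> carrier L. c \<sqsubseteq> a}"
  unfolding is_ideal_def by (auto intro: join_le) (meson le_trans)

text \<open>This is the join of \<open>F\<close> and \<open>G\<close> among filters. Closure under
  meets holds because \<open>(a \<sqinter> a') \<sqinter> (b \<sqinter> b')\<close> lies below both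
  \<open>a \<sqinter> b\<close> and \<open>a' \<sqinter> b'\<close>, so one pair from
  \<open>F\<close> and \<open>G\<close> again suffices.\<close>

lemma filter_sup:
  assumes F: "is_filter L F" and G: "is_filter L G"
  shows "is_filter L {c \<in> carrier L. \<exists>a\<in>F. \<exists>b\<in>G. a \<sqinter> b \<sqsubseteq> c}" (is "is_filter L ?H")
    and "F \<subseteq> {c \<in> carrier L. \<exists>a\<in>F. \<exists>b\<in>G. a \<sqinter> b \<sqsubseteq> c}"
    and "G \<subseteq> {c \<in> carrier L. \<exists>a\<in>F. \<exists>b\<in>G. a \<sqinter> b \<sqsubseteq> c}"
proof -
  have FG: "a \<in> F \<Longrightarrow> a \<in> carrier L" "a \<in> G \<Longrightarrow> a \<in> carrier L" "\<top> \<in> F" "\<top> \<in> G" for a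
    using F G by (auto simp: is_filter_def)
  have "c \<sqinter> c' \<in> ?H" if cc: "c \<in> ?H" "c' \<in> ?H" for c c'
  proof -
    obtain a b a' b' where *: "a \<in> F" "b \<in> G" "a \<sqinter> b \<sqsubseteq> c" "a' \<in> F" "b' \<in> G" "a' \<sqinter> b' \<sqsubseteq> c'"
      using cc by blast
    then have mem: "a \<sqinter> a' \<in> F" "b \<sqinter> b' \<in> G"
      using F G by (auto simp: is_filter_def)
    have "(a \<sqinter> a') \<sqinter> (b \<sqinter> b') \<sqsubseteq> a \<sqinter> b" "(a \<sqinter> a') \<sqinter> (b \<sqinter> b') \<sqsubseteq> a' \<sqinter> b'"
      using * FG by (auto intro!: meet_mono meet_left meet_right)
    then have "(a \<sqinter> a') \<sqinter> (b \<sqinter> b') \<sqsubseteq> c" "(a \<sqinter> a') \<sqinter> (b \<sqinter> b') \<sqsubseteq> c'"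
      using * FG cc by (auto intro: le_trans)
    then have "(a \<sqinter> a') \<sqinter> (b \<sqinter> b') \<sqsubseteq> c \<sqinter> c'"
      using * FG cc by (auto intro: meet_le)
    with mem cc show ?thesis
      by auto
  qed
  moreover have "d \<in> ?H" if "c \<in> ?H" "d \<in> carrier L" "c \<sqsubseteq> d" for c d
    using that FG by simp (meson le_trans meet_closed)
  moreover have "\<top> \<in> ?H"
    using FG by auto
  ultimately show "is_filter L ?H"
    unfolding is_filter_def by blast
  show "F \<subseteq> ?H" "G \<subseteq> ?H"
    using FG meet_left meet_right by blast+
qed

text \<open>The order dual of \<open>filter_sup\<close>:
  \<open>(a \<squnion> a') \<squnion> (b \<squnion> b')\<close> bounds both given joins.\<close>

lemma ideal_sup:
  assumes I: "is_ideal L I" and J: "is_ideal L J"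
  shows "is_ideal L {c \<in> carrier L. \<exists>a\<in>I. \<exists>b\<in>J. c \<sqsubseteq> a \<squnion> b}" (is "is_ideal L ?H")
    and "I \<subseteq> {c \<in> carrier L. \<exists>a\<in>I. \<exists>b\<in>J. c \<sqsubseteq> a \<squnion> b}"
    and "J \<subseteq> {c \<in> carrier L. \<exists>a\<in>I. \<exists>b\<in>J. c \<sqsubseteq> a \<squnion> b}"
proof -
  have IJ: "a \<in> I \<Longrightarrow> a \<in> carrier L" "a \<in> J \<Longrightarrow> a \<in> carrier L" "\<bottom> \<in> I" "\<bottom> \<in> J" for a
    using I J by (auto simp: is_ideal_def)
  have "c \<squnion> c' \<in> ?H" if cc: "c \<in> ?H" "c' \<in> ?H" for c c'
  proof -
    obtain a b a' b' where *: "a \<in> I" "b \<in> J" "c \<sqsubseteq> a \<squnion> b" "a' \<in> I" "b' \<in> J" "c' \<sqsubseteq> a' \<squnion> b'"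
      using cc by blast
    then have mem: "a \<squnion> a' \<in> I" "b \<squnion> b' \<in> J"
      using I J by (auto simp: is_ideal_def)
    have "a \<squnion> b \<sqsubseteq> (a \<squnion> a') \<squnion> (b \<squnion> b')" "a' \<squnion> b' \<sqsubseteq> (a \<squnion> a') \<squnion> (b \<squnion> b')"
      using * IJ by (auto intro!: join_mono join_left join_right)
    then have "c \<sqsubseteq> (a \<squnion> a') \<squnion> (b \<squnion> b')" "c' \<sqsubseteq> (a \<squnion> a') \<squnion> (b \<squnion> b')"
      using * IJ cc by (auto intro: le_trans)
    then have "c \<squnion> c' \<sqsubseteq> (a \<squnion> a') \<squnion> (b \<squnion> b')"
      using * IJ cc by (auto intro: join_le)
    with mem cc show ?thesis
      by auto
  qed
  moreover have "d \<in> ?H" if "c \<in> ?H" "d \<in> carrier L" "d \<sqsubseteq> c" for c d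
    using that IJ by simp (meson le_trans join_closed)
  moreover have "\<bottom> \<in> ?H"
    using IJ by auto
  ultimately show "is_ideal L ?H"
    unfolding is_ideal_def by blast
  show "I \<subseteq> ?H" "J \<subseteq> ?H"
    using IJ join_left join_right by blast+
qed

text \<open>Zorn's lemma gives a filter maximal among those that contain \<open>F\<close> and avoid
  \<open>I\<close>. Distributivity makes it prime: two elements that each force a collision with
  \<open>I\<close> force one through their join.\<close>

lemma prime_filter_theorem:
  assumes F: "is_filter L F" and I: "is_ideal L I" and disj: "F \<inter> I = {}"
  obtains p where "p \<in> prime_filters L" "F \<subseteq> p" "p \<inter> I = {}"
proof -
  let ?A = "{G. is_filter L G \<and> F \<subseteq> G \<and> G \<inter> I = {}}"
  have "\<exists>M\<in>?A. \<forall>G\<in>?A. M \<subseteq> G \<longrightarrow> G = M"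
  proof (rule subset_Zorn_nonempty)
    show "?A \<noteq> {}"
      using F disj by blast
    fix \<C> assume ne: "\<C> \<noteq> {}" and ch: "subset.chain ?A \<C>"
    have mem: "is_filter L G" "F \<subseteq> G" "G \<inter> I = {}" if "G \<in> \<C>" for G
      using ch that by (auto simp: subset_chain_def)
    have lin: "G \<subseteq> H \<or> H \<subseteq> G" if "G \<in> \<C>" "H \<in> \<C>" for G H
      using ch that by (simp add: subset_chain_def)
    have "a \<sqinter> b \<in> \<Union>\<C>" if ab: "a \<in> G" "G \<in> \<C>" "b \<in> H" "H \<in> \<C>" for a b G H
    proof -
      obtain E where "a \<in> E" "b \<in> E" "E \<in> \<C>"
        using lin [of G H] ab by blast
      moreover from this have "a \<sqinter> b \<in> E"
        using mem(1) [of E] by (simp add: is_filter_def)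
      ultimately show ?thesis
        by blast
    qed
    moreover have "\<top> \<in> G" "G \<subseteq> carrier L" if "G \<in> \<C>" for G
      using mem(1) [OF that] by (simp_all add: is_filter_def)
    then have "\<top> \<in> \<Union>\<C>" "\<Union>\<C> \<subseteq> carrier L"
      using ne by blast+
    moreover have "b \<in> \<Union>\<C>" if "a \<in> G" "G \<in> \<C>" "b \<in> carrier L" "a \<sqsubseteq> b" for a b G
      using mem(1) [OF that(2)] that unfolding is_filter_def by blast
    ultimately have "is_filter L (\<Union>\<C>)"
      unfolding is_filter_def by blast
    with ne mem(2,3) show "\<Union>\<C> \<in> ?A"
      by blast
  qed
  then obtain M where M: "is_filter L M" "F \<subseteq> M" "M \<inter> I = {}"
    and max: "\<And>G. is_filter L G \<Longrightarrow> M \<subseteq> G \<Longrightarrow> G \<inter> I = {} \<Longrightarrow> G = M"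
    by (auto intro: order_trans)
  have Mc: "M \<subseteq> carrier L" and Ic: "I \<subseteq> carrier L"
    using M I by (auto simp: is_filter_def is_ideal_def)
  \<comment> \<open>Adding \<open>a\<close> to \<open>M\<close> gives a strictly larger filter,
    which by maximality meets \<open>I\<close>; an element above \<open>a\<close> is then traded for
    \<open>a\<close> itself.\<close>
  have extend: "\<exists>m\<in>M. \<exists>i\<in>I. m \<sqinter> a \<sqsubseteq> i" if a: "a \<in> carrier L" "a \<notin> M" for a
  proof -
    let ?P = "{c \<in> carrier L. a \<sqsubseteq> c}"
    let ?G = "{c \<in> carrier L. \<exists>m\<in>M. \<exists>b\<in>?P. m \<sqinter> b \<sqsubseteq> c}"
    have "is_filter L ?G" "M \<subseteq> ?G" "?P \<subseteq> ?G"
      by (rule filter_sup [OF M(1) filter_principal [OF a(1)]])+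
    moreover have "a \<in> ?P"
      using a by simp
    ultimately have "?G \<noteq> M"
      using a(2) by (metis subsetD)
    then have "?G \<inter> I \<noteq> {}"
      using max [of ?G] \<open>is_filter L ?G\<close> \<open>M \<subseteq> ?G\<close> by metis
    then obtain m b i where *: "m \<in> M" "b \<in> carrier L" "a \<sqsubseteq> b" "m \<sqinter> b \<sqsubseteq> i" "i \<in> I"
      by blast
    then have c: "m \<in> carrier L" "i \<in> carrier L"
      using Mc Ic by auto
    have "m \<sqinter> a \<sqsubseteq> m \<sqinter> b"
      using * a c by (intro meet_mono) auto
    with * a c have "m \<sqinter> a \<sqsubseteq> i"
      using le_trans [of "m \<sqinter> a" "m \<sqinter> b" i] by simp
    with * show ?thesis
      by blast
  qed
  have "a \<in> M \<or> b \<in> M" if ab: "a \<in> carrier L" "b \<in> carrier L" "a \<squnion> b \<in> M" for a b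
  proof (rule ccontr)
    assume "\<not> (a \<in> M \<or> b \<in> M)"
    then obtain m m' i i' where *: "m \<in> M" "i \<in> I" "m \<sqinter> a \<sqsubseteq> i" "m' \<in> M" "i' \<in> I" "m' \<sqinter> b \<sqsubseteq> i'"
      using extend ab by meson
    \<comment> \<open>A single element of \<open>M\<close> that serves both \<open>a\<close> and
      \<open>b\<close>, so that distributivity can bring in \<open>a \<squnion> b\<close>.\<close>
    let ?m = "m \<sqinter> m'"
    have c: "m \<in> carrier L" "m' \<in> carrier L" "i \<in> carrier L" "i' \<in> carrier L"
      using * Mc Ic by auto
    have "?m \<sqinter> a \<sqsubseteq> m \<sqinter> a" "?m \<sqinter> b \<sqsubseteq> m' \<sqinter> b"
      using c ab by (auto intro!: meet_mono meet_left meet_right)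
    then have "?m \<sqinter> a \<sqsubseteq> i" "?m \<sqinter> b \<sqsubseteq> i'"
      using * c ab le_trans [of "?m \<sqinter> a" "m \<sqinter> a" i] le_trans [of "?m \<sqinter> b" "m' \<sqinter> b" i'] by simp_all
    then have "?m \<sqinter> (a \<squnion> b) \<sqsubseteq> i \<squnion> i'"
      using c ab by (simp add: distrib join_mono)
    moreover have "?m \<sqinter> (a \<squnion> b) \<in> M"
      using M(1) * ab by (simp add: is_filter_def)
    moreover have "i \<squnion> i' \<in> I"
      using I * by (simp add: is_ideal_def)
    ultimately have "?m \<sqinter> (a \<squnion> b) \<in> I"
      using I ab c by (auto simp: is_ideal_def)
    then show False
      using M(3) \<open>?m \<sqinter> (a \<squnion> b) \<in> M\<close> by blast
  qed
  moreover have "\<bottom> \<notin> M"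
    using I M(3) by (auto simp: is_ideal_def)
  ultimately have "M \<in> prime_filters L"
    using M(1) by (auto simp: prime_filters_iff)
  with M that show ?thesis
    by blast
qed

text \<open>The form used for successors of a prime filter: two filters and two ideals are joined
  first, and \<open>sep\<close> speaks only of single elements, so that it can be verified with one
  modal inequality.\<close>

lemma prime_filter_between:
  assumes F: "is_filter L F" and G: "is_filter L G" and I: "is_ideal L I" and J: "is_ideal L J"
    and sep: "\<And>a b c d. \<lbrakk>a \<in> F; b \<in> G; c \<in> I; d \<in> J; a \<sqinter> b \<sqsubseteq> c \<squnion> d\<rbrakk> \<Longrightarrow> False"
  obtains p where "p \<in> prime_filters L" "F \<subseteq> p" "G \<subseteq> p" "p \<inter> I = {}" "p \<inter> J = {}"
proof -
  let ?F = "{c \<in> carrier L. \<exists>a\<in>F. \<exists>b\<in>G. a \<sqinter> b \<sqsubseteq> c}"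
  let ?I = "{c \<in> carrier L. \<exists>a\<in>I. \<exists>b\<in>J. c \<sqsubseteq> a \<squnion> b}"
  have car: "F \<subseteq> carrier L" "G \<subseteq> carrier L" "I \<subseteq> carrier L" "J \<subseteq> carrier L"
    using F G I J by (auto simp: is_filter_def is_ideal_def)
  have "?F \<inter> ?I = {}"
  proof (rule ccontr)
    assume "?F \<inter> ?I \<noteq> {}"
    then obtain a b c d e where *: "a \<in> F" "b \<in> G" "c \<in> I" "d \<in> J" "e \<in> carrier L"
      and "a \<sqinter> b \<sqsubseteq> e" "e \<sqsubseteq> c \<squnion> d"
      by blast
    then have "a \<sqinter> b \<sqsubseteq> c \<squnion> d"
      using car by (meson le_trans meet_closed join_closed subsetD)
    with * sep show False
      by blast
  qed
  then obtain p where "p \<in> prime_filters L" "?F \<subseteq> p" "p \<inter> ?I = {}"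
    using prime_filter_theorem [OF filter_sup(1) [OF F G] ideal_sup(1) [OF I J]] by blast
  moreover have "F \<subseteq> ?F" "G \<subseteq> ?F" "I \<subseteq> ?I" "J \<subseteq> ?I"
    using filter_sup(2,3) [OF F G] ideal_sup(2,3) [OF I J] by blast+
  ultimately show thesis
    by (intro that) blast+
qed

lemma prime_filter_separates:
  assumes "a \<in> carrier L" "b \<in> carrier L" "\<not> a \<sqsubseteq> b"
  obtains p where "p \<in> prime_filters L" "a \<in> p" "b \<notin> p"
proof -
  have "{c \<in> carrier L. a \<sqsubseteq> c} \<inter> {c \<in> carrier L. c \<sqsubseteq> b} = {}"
    using assms le_trans by blast
  then obtain p where "p \<in> prime_filters L" "{c \<in> carrier L. a \<sqsubseteq> c} \<subseteq> p"
      "p \<inter> {c \<in> carrier L. c \<sqsubseteq> b} = {}"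
    by (rule prime_filter_theorem [OF filter_principal [OF assms(1)] ideal_principal [OF assms(2)]])
  then show thesis
    using assms by (intro that [of p]) auto
qed

end

section \<open>Homomorphisms of bounded distributive lattices\<close>

lemma DL_homD:
  assumes "f \<in> DL_hom L M"
  shows "f \<in> carrier L \<rightarrow>\<^sub>E carrier M" "x \<in> carrier L \<Longrightarrow> f x \<in> carrier M"
    "f \<bottom>\<^bsub>L\<^esub> = \<bottom>\<^bsub>M\<^esub>" "f \<top>\<^bsub>L\<^esub> = \<top>\<^bsub>M\<^esub>"
    "\<lbrakk>x \<in> carrier L; y \<in> carrier L\<rbrakk> \<Longrightarrow> f (x \<squnion>\<^bsub>L\<^esub> y) = f x \<squnion>\<^bsub>M\<^esub> f y"
    "\<lbrakk>x \<in> carrier L; y \<in> carrier L\<rbrakk> \<Longrightarrow> f (x \<sqinter>\<^bsub>L\<^esub> y) = f x \<sqinter>\<^bsub>M\<^esub> f y"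
  using assms by (auto simp: DL_hom_def)

lemma DL_hom_le:
  assumes "f \<in> DL_hom L M" "DL L" "DL M" "x \<in> carrier L" "y \<in> carrier L" "x \<sqsubseteq>\<^bsub>L\<^esub> y"
  shows "f x \<sqsubseteq>\<^bsub>M\<^esub> f y"
proof -
  interpret L: dl L by standard fact
  interpret M: dl M by standard fact
  have "x \<squnion>\<^bsub>L\<^esub> y = y"
    using assms by (intro L.join_absorb)
  then have "f x \<squnion>\<^bsub>M\<^esub> f y = f y"
    using DL_homD(5) [OF assms(1,4,5)] by simp
  then show ?thesis
    using M.join_left [of "f x" "f y"] DL_homD(2) [OF assms(1)] assms(4,5) by simp
qed

lemma DL_hom_compose:
  assumes "DL L" "f \<in> DL_hom L M" "g \<in> DL_hom M N"
  shows "compose (carrier L) g f \<in> DL_hom L N"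
proof -
  interpret L: dl L by standard fact
  have "compose (carrier L) g f \<in> carrier L \<rightarrow>\<^sub>E carrier N"
    using DL_homD(2) [OF assms(2)] DL_homD(2) [OF assms(3)] by (auto simp: compose_def)
  then show ?thesis
    using DL_homD [OF assms(2)] DL_homD [OF assms(3)] by (simp add: DL_hom_def compose_eq)
qed

lemma DL_hom_id: "DL L \<Longrightarrow> (\<lambda>x\<in>carrier L. x) \<in> DL_hom L L"
proof -
  assume "DL L"
  then interpret L: dl L by unfold_locales
  show ?thesis by (simp add: DL_hom_def)
qed

text \<open>The structure is equational, so each law for the inverse is the law for \<open>h\<close>
  at preimages, cancelled by injectivity.\<close>

lemma DL_hom_inverse:
  assumes "DL L" "DL M" and h: "h \<in> DL_hom L M" and bij: "bij_betw h (carrier L) (carrier M)"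
  shows "(\<lambda>y\<in>carrier M. the_inv_into (carrier L) h y) \<in> DL_hom M L"
proof -
  interpret L: dl L by standard fact
  interpret M: dl M by standard fact
  let ?k = "the_inv_into (carrier L) h"
  have inj: "inj_on h (carrier L)" and im: "h ` carrier L = carrier M"
    using bij by (auto simp: bij_betw_def)
  have kh: "?k (h x) = x" if "x \<in> carrier L" for x
    using inj that by (rule the_inv_into_f_f)
  have k: "?k y \<in> carrier L" "h (?k y) = y" if "y \<in> carrier M" for y
    using that inj im by (auto simp: the_inv_into_into f_the_inv_into_f)
  have "?k \<bottom>\<^bsub>M\<^esub> = \<bottom>\<^bsub>L\<^esub>" "?k \<top>\<^bsub>M\<^esub> = \<top>\<^bsub>L\<^esub>"
    using kh [of "\<bottom>\<^bsub>L\<^esub>"] kh [of "\<top>\<^bsub>L\<^esub>"] DL_homD(3,4) [OF h] by auto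
  moreover have "?k (x \<squnion>\<^bsub>M\<^esub> y) = ?k x \<squnion>\<^bsub>L\<^esub> ?k y" "?k (x \<sqinter>\<^bsub>M\<^esub> y) = ?k x \<sqinter>\<^bsub>L\<^esub> ?k y"
    if "x \<in> carrier M" "y \<in> carrier M" for x y
    using that k kh [of "?k x \<squnion>\<^bsub>L\<^esub> ?k y"] kh [of "?k x \<sqinter>\<^bsub>L\<^esub> ?k y"] DL_homD(5,6) [OF h, of "?k x" "?k y"]
    by auto
  ultimately show ?thesis
    using k by (simp add: DL_hom_def)
qed


section \<open>The lattice of lattice terms\<close>

lemma kterms_simps [simp]:
  "Dia a \<in> kterms L \<longleftrightarrow> a \<in> carrier L" "Box a \<in> kterms L \<longleftrightarrow> a \<in> carrier L"
  "KBot \<in> kterms L" "KTop \<in> kterms L"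
  "KMeet s t \<in> kterms L \<longleftrightarrow> s \<in> kterms L \<and> t \<in> kterms L"
  "KJoin s t \<in> kterms L \<longleftrightarrow> s \<in> kterms L \<and> t \<in> kterms L"
  by (auto simp: kterms_def)

lemma kle_kterms: "kle L s t \<Longrightarrow> s \<in> kterms L \<and> t \<in> kterms L"
  by (induction rule: kle.induct) auto

lemma kterm_induct [consumes 1, case_names Dia Box KBot KTop KMeet KJoin]:
  assumes "t \<in> kterms L"
    and "\<And>a. a \<in> carrier L \<Longrightarrow> P (Dia a)" "\<And>a. a \<in> carrier L \<Longrightarrow> P (Box a)" "P KBot" "P KTop"
    and "\<And>s t. \<lbrakk>s \<in> kterms L; t \<in> kterms L; P s; P t\<rbrakk> \<Longrightarrow> P (KMeet s t)"
    and "\<And>s t. \<lbrakk>s \<in> kterms L; t \<in> kterms L; P s; P t\<rbrakk> \<Longrightarrow> P (KJoin s t)"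
  shows "P t"
  using assms(1) by (induction t) (auto intro: assms)

lemma equiv_keq: "equiv (kterms L) (keq L)"
proof (rule equivI)
  show "keq L \<subseteq> kterms L \<times> kterms L"
    by (auto simp: keq_def dest: kle_kterms)
  show "refl_on (kterms L) (keq L)"
    by (auto simp: refl_on_def keq_def intro: kle_refl)
  show "sym (keq L)"
    by (auto simp: sym_def keq_def)
  show "trans (keq L)"
    by (auto simp: trans_def keq_def intro: kle_trans)
qed

definition kclass :: "'a gorder \<Rightarrow> 'a kterm \<Rightarrow> 'a kterm set" where
  "kclass L t = keq L `` {t}"

lemma dia_eq_kclass: "dia L a = kclass L (Dia a)"
  and box_eq_kclass: "box L a = kclass L (Box a)"
  by (simp_all add: dia_def box_def kclass_def)

lemma kclass_iff: "s \<in> kclass L t \<longleftrightarrow> kle L t s \<and> kle L s t"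
  by (simp add: kclass_def keq_def)

lemma kclass_self: "t \<in> kterms L \<Longrightarrow> t \<in> kclass L t"
  by (simp add: kclass_iff kle_refl)

lemma kclass_eqI: "kle L s t \<Longrightarrow> kle L t s \<Longrightarrow> kclass L s = kclass L t"
  unfolding kclass_def using equiv_class_eq [OF equiv_keq] by (fastforce simp: keq_def)

lemma kclass_closed: "t \<in> kterms L \<Longrightarrow> kclass L t \<in> carrier (K L)"
  by (auto simp: K_def kclass_def intro: quotientI)

lemma carrier_K_cases:
  assumes "c \<in> carrier (K L)"
  obtains t where "t \<in> kterms L" "c = kclass L t"
  using assms by (auto simp: K_def kclass_def elim: quotientE)

lemma le_K_iff:
  assumes "s \<in> kterms L" "t \<in> kterms L"
  shows "kclass L s \<sqsubseteq>\<^bsub>K L\<^esub> kclass L t \<longleftrightarrow> kle L s t"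
proof
  assume "kclass L s \<sqsubseteq>\<^bsub>K L\<^esub> kclass L t"
  then obtain s' t' where "kle L s s'" "kle L s' t'" "kle L t' t"
    by (auto simp: K_def kclass_iff)
  then show "kle L s t"
    by (blast intro: kle_trans)
next
  assume "kle L s t"
  then show "kclass L s \<sqsubseteq>\<^bsub>K L\<^esub> kclass L t"
    using kclass_self [OF assms(1)] kclass_self [OF assms(2)] by (auto simp: K_def)
qed

text \<open>Lattice operations on classes go through chosen representatives. As \<open>kle\<close>
  is transitive, the order does not see which representative was chosen; this is made precise in
  \<open>kle_krep_kclass\<close>.\<close>

definition krep :: "'a kterm set \<Rightarrow> 'a kterm" where
  "krep c = (SOME t. t \<in> c)"

lemma krep:
  assumes "t \<in> kterms L"
  shows "krep (kclass L t) \<in> kterms L" "kle L t (krep (kclass L t))" "kle L (krep (kclass L t)) t"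
proof -
  have "krep (kclass L t) \<in> kclass L t"
    unfolding krep_def using kclass_self [OF assms] by (rule someI)
  then show "kle L t (krep (kclass L t))" "kle L (krep (kclass L t)) t"
    by (simp_all add: kclass_iff)
  then show "krep (kclass L t) \<in> kterms L"
    using kle_kterms by blast
qed

lemma kclass_krep: "t \<in> kterms L \<Longrightarrow> kclass L (krep (kclass L t)) = kclass L t"
  by (intro kclass_eqI krep)

lemma krep_closed: "c \<in> carrier (K L) \<Longrightarrow> krep c \<in> kterms L"
  and kclass_krep': "c \<in> carrier (K L) \<Longrightarrow> kclass L (krep c) = c"
  by (auto elim!: carrier_K_cases simp: krep kclass_krep)

lemma le_K_krep:
  "\<lbrakk>c \<in> carrier (K L); d \<in> carrier (K L)\<rbrakk> \<Longrightarrow> c \<sqsubseteq>\<^bsub>K L\<^esub> d \<longleftrightarrow> kle L (krep c) (krep d)"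
  using le_K_iff [of "krep c" L "krep d"] by (simp add: krep_closed kclass_krep')

lemma kle_krep_kclass:
  assumes "t \<in> kterms L"
  shows "kle L s (krep (kclass L t)) \<longleftrightarrow> kle L s t" "kle L (krep (kclass L t)) s \<longleftrightarrow> kle L t s"
  using krep [OF assms] by (blast intro: kle_trans)+

lemma kle_meet_mono: "kle L r s \<Longrightarrow> kle L r' s' \<Longrightarrow> kle L (KMeet r r') (KMeet s s')"
  by (meson kle_kterms kle_meet kle_meet1 kle_meet2 kle_trans)

lemma kle_join_mono: "kle L r s \<Longrightarrow> kle L r' s' \<Longrightarrow> kle L (KJoin r r') (KJoin s s')"
  by (meson kle_kterms kle_join kle_join1 kle_join2 kle_trans)

text \<open>On representatives most lattice axioms become rules of \<open>kle\<close>.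
  Distributivity takes more work, since there the operations nest and representatives of compound
  classes occur inside other terms.\<close>

lemma dl_structure_K:
  "dl_structure (K L) (\<lambda>c d. kclass L (KJoin (krep c) (krep d)))
    (\<lambda>c d. kclass L (KMeet (krep c) (krep d))) (kclass L KBot) (kclass L KTop)"
proof unfold_locales
  show "eq (K L) = (=)"
    by (simp add: K_def)
next
  fix c d assume "c \<in> carrier (K L)" "d \<in> carrier (K L)" "c \<sqsubseteq>\<^bsub>K L\<^esub> d" "d \<sqsubseteq>\<^bsub>K L\<^esub> c"
  moreover from this have "kclass L (krep c) = kclass L (krep d)"
    by (intro kclass_eqI) (simp_all add: le_K_krep)
  ultimately show "c = d"
    by (simp add: kclass_krep')
next
  fix c d e assume "c \<in> carrier (K L)" "d \<in> carrier (K L)" "e \<in> carrier (K L)"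
    "c \<sqsubseteq>\<^bsub>K L\<^esub> d" "d \<sqsubseteq>\<^bsub>K L\<^esub> e"
  then show "c \<sqsubseteq>\<^bsub>K L\<^esub> e"
    using kle_trans [of L "krep c" "krep d" "krep e"] by (simp add: le_K_krep)
next
  fix c d e assume "c \<in> carrier (K L)" "d \<in> carrier (K L)" "e \<in> carrier (K L)"
  then have *: "krep c \<in> kterms L" "krep d \<in> kterms L" "krep e \<in> kterms L"
    by (simp_all add: krep_closed)
  \<comment> \<open>Monotonicity of \<open>KMeet\<close> and \<open>KJoin\<close> replaces inner
    representatives by the terms they represent, on either side of
    \<open>kle_distrib\<close>.\<close>
  have "kle L (KMeet (krep c) (krep (kclass L (KJoin (krep d) (krep e)))))
      (KMeet (krep c) (KJoin (krep d) (krep e)))"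
    using * by (intro kle_meet_mono krep kle_refl) simp_all
  moreover have "kle L (KJoin (KMeet (krep c) (krep d)) (KMeet (krep c) (krep e)))
     (KJoin (krep (kclass L (KMeet (krep c) (krep d)))) (krep (kclass L (KMeet (krep c) (krep e)))))"
    using * by (intro kle_join_mono krep kle_refl) simp_all
  ultimately have "kle L (KMeet (krep c) (krep (kclass L (KJoin (krep d) (krep e)))))
     (KJoin (krep (kclass L (KMeet (krep c) (krep d)))) (krep (kclass L (KMeet (krep c) (krep e)))))"
    using kle_distrib [OF *] by (blast intro: kle_trans)
  then show "kclass L (KMeet (krep c) (krep (kclass L (KJoin (krep d) (krep e))))) \<sqsubseteq>\<^bsub>K L\<^esub>
     kclass L (KJoin (krep (kclass L (KMeet (krep c) (krep d)))) (krep (kclass L (KMeet (krep c) (krep e)))))"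
    using * by (simp add: le_K_iff krep)
qed (simp_all only: le_K_krep kclass_closed krep_closed kle_krep_kclass kterms_simps simp_thms
  kle_refl kle_bot kle_top kle_meet1 kle_meet2 kle_meet kle_join1 kle_join2 kle_join)

lemma DL_K: "DL (K L)"
  by (rule dl_structure.DL [OF dl_structure_K])

lemma K_bottom: "\<bottom>\<^bsub>K L\<^esub> = kclass L KBot" and K_top: "\<top>\<^bsub>K L\<^esub> = kclass L KTop"
  by (rule dl_structure.bottom_eq [OF dl_structure_K] dl_structure.top_eq [OF dl_structure_K])+

lemma K_join:
  assumes "s \<in> kterms L" "t \<in> kterms L"
  shows "kclass L s \<squnion>\<^bsub>K L\<^esub> kclass L t = kclass L (KJoin s t)"
proof -
  have "kclass L s \<squnion>\<^bsub>K L\<^esub> kclass L t = kclass L (KJoin (krep (kclass L s)) (krep (kclass L t)))"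
    using assms by (intro dl_structure.join_eq [OF dl_structure_K] kclass_closed)
  also have "\<dots> = kclass L (KJoin s t)"
    using assms by (intro kclass_eqI kle_join_mono krep)
  finally show ?thesis .
qed

lemma K_meet:
  assumes "s \<in> kterms L" "t \<in> kterms L"
  shows "kclass L s \<sqinter>\<^bsub>K L\<^esub> kclass L t = kclass L (KMeet s t)"
proof -
  have "kclass L s \<sqinter>\<^bsub>K L\<^esub> kclass L t = kclass L (KMeet (krep (kclass L s)) (krep (kclass L t)))"
    using assms by (intro dl_structure.meet_eq [OF dl_structure_K] kclass_closed)
  also have "\<dots> = kclass L (KMeet s t)"
    using assms by (intro kclass_eqI kle_meet_mono krep)
  finally show ?thesis .
qed

lemma dia_closed: "a \<in> carrier L \<Longrightarrow> dia L a \<in> carrier (K L)"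
  and box_closed: "a \<in> carrier L \<Longrightarrow> box L a \<in> carrier (K L)"
  by (simp_all add: dia_eq_kclass box_eq_kclass kclass_closed)

text \<open>The uniqueness half of freeness: every class is the class of a term, so induction on
  terms reduces equality to the symbols.\<close>

lemma K_hom_ext:
  assumes f: "f \<in> DL_hom (K L) M" and g: "g \<in> DL_hom (K L) M"
    and dia: "\<And>a. a \<in> carrier L \<Longrightarrow> f (dia L a) = g (dia L a)"
    and box: "\<And>a. a \<in> carrier L \<Longrightarrow> f (box L a) = g (box L a)"
  shows "f = g"
proof (rule PiE_ext [OF DL_homD(1) [OF f] DL_homD(1) [OF g]])
  fix c assume "c \<in> carrier (K L)"
  then obtain t where t: "t \<in> kterms L" "c = kclass L t"
    by (rule carrier_K_cases)
  from t(1) have "f (kclass L t) = g (kclass L t)"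
  proof (induction rule: kterm_induct)
    case (Dia a)
    then show ?case using dia by (simp add: dia_eq_kclass)
  next
    case (Box a)
    then show ?case using box by (simp add: box_eq_kclass)
  next
    case KBot
    show ?case using DL_homD(3) [OF f] DL_homD(3) [OF g] by (simp add: K_bottom)
  next
    case KTop
    show ?case using DL_homD(4) [OF f] DL_homD(4) [OF g] by (simp add: K_top)
  next
    case (KMeet s t)
    then show ?case
      using DL_homD(6) [OF f, of "kclass L s" "kclass L t"] DL_homD(6) [OF g, of "kclass L s" "kclass L t"]
      by (simp add: K_meet kclass_closed)
  next
    case (KJoin s t)
    then show ?case
      using DL_homD(5) [OF f, of "kclass L s" "kclass L t"] DL_homD(5) [OF g, of "kclass L s" "kclass L t"]
      by (simp add: K_join kclass_closed)
  qed
  with t(2) show "f c = g c"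
    by simp
qed

text \<open>The existence half of freeness, for an evaluation \<open>e\<close> of terms.
  Independence of the representative is contained in \<open>val\<close>, because \<open>f\<close> is
  a function on classes.\<close>

lemma K_homI:
  assumes ext: "f \<in> extensional (carrier (K L))"
    and val: "\<And>t. t \<in> kterms L \<Longrightarrow> f (kclass L t) = e t"
    and closed: "\<And>t. t \<in> kterms L \<Longrightarrow> e t \<in> carrier M"
    and "e KBot = \<bottom>\<^bsub>M\<^esub>" "e KTop = \<top>\<^bsub>M\<^esub>"
    and "\<And>s t. \<lbrakk>s \<in> kterms L; t \<in> kterms L\<rbrakk> \<Longrightarrow> e (KJoin s t) = e s \<squnion>\<^bsub>M\<^esub> e t"
    and "\<And>s t. \<lbrakk>s \<in> kterms L; t \<in> kterms L\<rbrakk> \<Longrightarrow> e (KMeet s t) = e s \<sqinter>\<^bsub>M\<^esub> e t"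
  shows "f \<in> DL_hom (K L) M"
  using assms by (auto simp: DL_hom_def PiE_def K_bottom K_top K_join K_meet elim!: carrier_K_cases)

lemma map_kterm_closed: "h \<in> DL_hom L M \<Longrightarrow> t \<in> kterms L \<Longrightarrow> map_kterm h t \<in> kterms M"
  by (auto simp: kterms_def kterm.set_map dest: DL_homD(2))

text \<open>A homomorphism carries each relation between symbols to the same relation between the
  renamed symbols, so a derivation of \<open>kle L s t\<close> can be renamed rule by rule.\<close>

lemma kle_map:
  assumes h: "h \<in> DL_hom L M" and L: "DL L" and M: "DL M" and "kle L s t"
  shows "kle M (map_kterm h s) (map_kterm h t)"
proof -
  interpret L: dl L by standard fact
  interpret M: dl M by standard fact
  show ?thesis
    using assms(4)
  proof (induction rule: kle.induct)
    case (kle_trans r s t)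
    then show ?case by (blast intro: kle.kle_trans)
  qed (simp_all add: map_kterm_closed [OF h] kle.intros DL_homD [OF h])
qed

text \<open>\<open>Kmap\<close> collects the classes of all renamed members of a class; by
  \<open>kle_map\<close> the renamed members are equivalent, so this union is a single
  class.\<close>

lemma Kmap_kclass:
  assumes h: "h \<in> DL_hom L M" and L: "DL L" and M: "DL M" and t: "t \<in> kterms L"
  shows "Kmap L M h (kclass L t) = kclass M (map_kterm h t)"
proof -
  have "keq M `` (map_kterm h ` kclass L t) = (\<Union>s\<in>kclass L t. kclass M (map_kterm h s))"
    by (auto simp: kclass_def)
  also have "\<dots> = kclass M (map_kterm h t)"
  proof -
    have "kclass M (map_kterm h s) = kclass M (map_kterm h t)" if "s \<in> kclass L t" for s
      using that kle_map [OF h L M] by (intro kclass_eqI) (auto simp: kclass_iff)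
    then show ?thesis
      using kclass_self [OF t] by blast
  qed
  finally show ?thesis
    using t by (simp add: Kmap_def kclass_closed)
qed

lemma Kmap_hom:
  assumes h: "h \<in> DL_hom L M" and L: "DL L" and M: "DL M"
  shows "Kmap L M h \<in> DL_hom (K L) (K M)"
proof (rule K_homI [where e = "\<lambda>t. kclass M (map_kterm h t)"])
  show "Kmap L M h \<in> extensional (carrier (K L))"
    by (simp add: Kmap_def)
  show "Kmap L M h (kclass L t) = kclass M (map_kterm h t)" if "t \<in> kterms L" for t
    by (rule Kmap_kclass [OF h L M that])
  show "kclass M (map_kterm h t) \<in> carrier (K M)" if "t \<in> kterms L" for t
    using map_kterm_closed [OF h that] by (rule kclass_closed)
qed (simp_all add: K_bottom K_top K_join K_meet map_kterm_closed [OF h])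

lemma Kmap_dia:
  "\<lbrakk>h \<in> DL_hom L M; DL L; DL M; a \<in> carrier L\<rbrakk> \<Longrightarrow> Kmap L M h (dia L a) = dia M (h a)"
  and Kmap_box:
  "\<lbrakk>h \<in> DL_hom L M; DL L; DL M; a \<in> carrier L\<rbrakk> \<Longrightarrow> Kmap L M h (box L a) = box M (h a)"
  by (simp_all add: dia_eq_kclass box_eq_kclass Kmap_kclass)


section \<open>Algebras as lattices with two operators\<close>

text \<open>Both sides of the square are homomorphisms out of \<K>, so by \<open>K_hom_ext\<close>
  the square commutes as soon as it does on the symbols. Morphisms of algebras thereby become
  lattice homomorphisms preserving two operators.\<close>

lemma kalg_hom_iff:
  assumes A: "kalg A" and B: "kalg B"
  shows "h \<in> kalg_hom A B \<longleftrightarrow> h \<in> DL_hom (fst A) (fst B) \<and>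
     (\<forall>a\<in>carrier (fst A). h (snd A (dia (fst A) a)) = snd B (dia (fst B) (h a)) \<and>
        h (snd A (box (fst A) a)) = snd B (box (fst B) (h a)))"
proof (cases "h \<in> DL_hom (fst A) (fst B)")
  case h: True
  have DL: "DL (fst A)" "DL (fst B)" and f: "snd A \<in> DL_hom (K (fst A)) (fst A)"
    and g: "snd B \<in> DL_hom (K (fst B)) (fst B)"
    using A B by (auto simp: kalg_def)
  let ?l = "compose (carrier (K (fst A))) h (snd A)"
  let ?r = "compose (carrier (K (fst A))) (snd B) (Kmap (fst A) (fst B) h)"
  have l: "?l \<in> DL_hom (K (fst A)) (fst B)"
    by (rule DL_hom_compose [OF DL_K f h])
  have r: "?r \<in> DL_hom (K (fst A)) (fst B)"
    by (rule DL_hom_compose [OF DL_K Kmap_hom [OF h DL] g])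
  have eq: "?l = ?r \<longleftrightarrow> (\<forall>a\<in>carrier (fst A).
      ?l (dia (fst A) a) = ?r (dia (fst A) a) \<and> ?l (box (fst A) a) = ?r (box (fst A) a))"
    using K_hom_ext [OF l r] by auto
  show ?thesis
    unfolding kalg_hom_def using h
    by (simp add: eq compose_eq dia_closed box_closed Kmap_dia [OF h DL] Kmap_box [OF h DL])
qed (simp add: kalg_hom_def)

lemma kalg_id_hom:
  assumes A: "kalg A"
  shows "kalg_id A \<in> kalg_hom A A"
proof -
  have "snd A \<in> DL_hom (K (fst A)) (fst A)" "DL (fst A)"
    using A by (auto simp: kalg_def)
  then show ?thesis
    by (simp add: kalg_hom_iff [OF A A] kalg_id_def DL_hom_id DL_homD(2) dia_closed box_closed)
qed

lemma kalg_comp_hom: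
  assumes "kalg A" "kalg B" "kalg D" "h \<in> kalg_hom A B" "k \<in> kalg_hom B D"
  shows "kalg_comp A k h \<in> kalg_hom A D"
proof -
  have f: "snd A \<in> DL_hom (K (fst A)) (fst A)" "DL (fst A)"
    using assms by (auto simp: kalg_def)
  have *: "h \<in> DL_hom (fst A) (fst B)" "k \<in> DL_hom (fst B) (fst D)"
    using assms by (auto simp: kalg_hom_def)
  show ?thesis
    using assms DL_homD(2) [OF *(1)] DL_homD(2) [OF f(1)]
    by (simp add: kalg_hom_iff kalg_comp_def DL_hom_compose [OF f(2) *] compose_eq dia_closed box_closed)
qed

text \<open>The inverse of a bijective homomorphism inherits compatibility with the operators: write
  an element of \<open>B\<close> as \<open>h\<close> of its preimage and move \<open>h\<close>
  outside.\<close>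

lemma kalg_isoI:
  assumes A: "kalg A" and B: "kalg B" and h: "h \<in> kalg_hom A B"
    and bij: "bij_betw h (carrier (fst A)) (carrier (fst B))"
  shows "h \<in> kalg_iso A B"
proof -
  let ?k = "\<lambda>y\<in>carrier (fst B). the_inv_into (carrier (fst A)) h y"
  have DL: "DL (fst A)" "DL (fst B)" and f: "snd A \<in> DL_hom (K (fst A)) (fst A)"
    and g: "snd B \<in> DL_hom (K (fst B)) (fst B)"
    using A B by (auto simp: kalg_def)
  have h': "h \<in> DL_hom (fst A) (fst B)"
    using h by (simp add: kalg_hom_def)
  have k': "?k \<in> DL_hom (fst B) (fst A)"
    by (rule DL_hom_inverse [OF DL h' bij])
  have kh: "?k (h x) = x" if "x \<in> carrier (fst A)" for x
    using that bij DL_homD(2) [OF h'] by (simp add: bij_betw_def the_inv_into_f_f)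
  have hk: "h (?k y) = y" if "y \<in> carrier (fst B)" for y
    using that bij by (simp add: bij_betw_def f_the_inv_into_f)
  have "?k (snd B (dia (fst B) b)) = snd A (dia (fst A) (?k b))"
       "?k (snd B (box (fst B) b)) = snd A (box (fst A) (?k b))" if b: "b \<in> carrier (fst B)" for b
  proof -
    have c: "?k b \<in> carrier (fst A)"
      using DL_homD(2) [OF k'] b by blast
    have "snd B (dia (fst B) b) = h (snd A (dia (fst A) (?k b)))"
         "snd B (box (fst B) b) = h (snd A (box (fst A) (?k b)))"
      using h c hk [OF b] by (auto simp: kalg_hom_iff [OF A B] simp del: restrict_apply)
    then show "?k (snd B (dia (fst B) b)) = snd A (dia (fst A) (?k b))"
       "?k (snd B (box (fst B) b)) = snd A (box (fst A) (?k b))"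
      using kh DL_homD(2) [OF f] c by (simp_all add: dia_closed box_closed del: restrict_apply)
  qed
  then have "?k \<in> kalg_hom B A"
    using k' by (simp add: kalg_hom_iff [OF B A] del: restrict_apply)
  moreover have "kalg_comp A ?k h = kalg_id A" "kalg_comp B h ?k = kalg_id B"
    using kh hk by (auto simp: kalg_comp_def kalg_id_def compose_def fun_eq_iff simp del: restrict_apply
        simp add: restrict_def)
  ultimately show ?thesis
    using h unfolding kalg_iso_def by blast
qed

locale kalgebra =
  fixes A :: "'a kalg"
  assumes kalg: "kalg A"
begin

abbreviation L where "L \<equiv> fst A"
definition d where "d a = snd A (dia L a)"
definition b where "b a = snd A (box L a)"

sublocale dl "fst A"
  using kalg by unfold_locales (simp add: kalg_def)

lemma str_hom: "snd A \<in> DL_hom (K L) L"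
  using kalg by (simp add: kalg_def)

lemma str_closed: "t \<in> kterms L \<Longrightarrow> snd A (kclass L t) \<in> carrier L"
  using DL_homD(2) [OF str_hom] kclass_closed by blast

lemma d_closed [simp]: "a \<in> carrier L \<Longrightarrow> d a \<in> carrier L"
  and b_closed [simp]: "a \<in> carrier L \<Longrightarrow> b a \<in> carrier L"
  by (simp_all add: d_def b_def dia_eq_kclass box_eq_kclass str_closed)

lemma str_join:
  "\<lbrakk>s \<in> kterms L; t \<in> kterms L\<rbrakk> \<Longrightarrow>
     snd A (kclass L (KJoin s t)) = snd A (kclass L s) \<squnion>\<^bsub>L\<^esub> snd A (kclass L t)"
  using DL_homD(5) [OF str_hom kclass_closed kclass_closed] by (simp add: K_join)

lemma str_meet:
  "\<lbrakk>s \<in> kterms L; t \<in> kterms L\<rbrakk> \<Longrightarrow>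
     snd A (kclass L (KMeet s t)) = snd A (kclass L s) \<sqinter>\<^bsub>L\<^esub> snd A (kclass L t)"
  using DL_homD(6) [OF str_hom kclass_closed kclass_closed] by (simp add: K_meet)

lemma str_mono: "kle L s t \<Longrightarrow> snd A (kclass L s) \<sqsubseteq>\<^bsub>L\<^esub> snd A (kclass L t)"
  using DL_hom_le [OF str_hom DL_K DL, of "kclass L s" "kclass L t"] kle_kterms [of L s t]
  by (simp add: le_K_iff kclass_closed)

lemma str_eq: "kle L s t \<Longrightarrow> kle L t s \<Longrightarrow> snd A (kclass L s) = snd A (kclass L t)"
  using kclass_eqI [of L s t] by simp

lemma d_bottom: "d \<bottom>\<^bsub>L\<^esub> = \<bottom>\<^bsub>L\<^esub>"
  using str_eq [OF dia_bot kle_bot] DL_homD(3) [OF str_hom]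
  by (simp add: d_def dia_eq_kclass K_bottom)

lemma b_top: "b \<top>\<^bsub>L\<^esub> = \<top>\<^bsub>L\<^esub>"
  using str_eq [OF box_top kle_top] DL_homD(4) [OF str_hom]
  by (simp add: b_def box_eq_kclass K_top)

lemma d_join: "\<lbrakk>x \<in> carrier L; y \<in> carrier L\<rbrakk> \<Longrightarrow> d (x \<squnion>\<^bsub>L\<^esub> y) = d x \<squnion>\<^bsub>L\<^esub> d y"
  using str_eq [OF dia_join2 dia_join1, of x y] by (simp add: d_def dia_eq_kclass str_join)

lemma b_meet: "\<lbrakk>x \<in> carrier L; y \<in> carrier L\<rbrakk> \<Longrightarrow> b (x \<sqinter>\<^bsub>L\<^esub> y) = b x \<sqinter>\<^bsub>L\<^esub> b y"
  using str_eq [OF box_meet2 box_meet1, of x y] by (simp add: b_def box_eq_kclass str_meet)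

lemma b_join_le: "\<lbrakk>x \<in> carrier L; y \<in> carrier L\<rbrakk> \<Longrightarrow> b (x \<squnion>\<^bsub>L\<^esub> y) \<sqsubseteq>\<^bsub>L\<^esub> b x \<squnion>\<^bsub>L\<^esub> d y"
  using str_mono [OF box_join, of x y]
  by (simp add: b_def d_def dia_eq_kclass box_eq_kclass str_join)

lemma b_d_le: "\<lbrakk>x \<in> carrier L; y \<in> carrier L\<rbrakk> \<Longrightarrow> b x \<sqinter>\<^bsub>L\<^esub> d y \<sqsubseteq>\<^bsub>L\<^esub> d (x \<sqinter>\<^bsub>L\<^esub> y)"
  using str_mono [OF box_dia, of x y]
  by (simp add: b_def d_def dia_eq_kclass box_eq_kclass str_meet)

lemma d_mono: "\<lbrakk>x \<sqsubseteq>\<^bsub>L\<^esub> y; x \<in> carrier L; y \<in> carrier L\<rbrakk> \<Longrightarrow> d x \<sqsubseteq>\<^bsub>L\<^esub> d y"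
  using d_join [of x y] join_left [of "d x" "d y"] by (simp add: join_absorb)

lemma b_mono: "\<lbrakk>x \<sqsubseteq>\<^bsub>L\<^esub> y; x \<in> carrier L; y \<in> carrier L\<rbrakk> \<Longrightarrow> b x \<sqsubseteq>\<^bsub>L\<^esub> b y"
  using b_meet [of x y] meet_right [of "b x" "b y"] by (simp add: meet_absorb)

end


section \<open>Priestley spaces\<close>

lemma PSD:
  assumes "PS X"
  shows "compact_space (Topo X)" "Ord X \<subseteq> points X \<times> points X"
    "x \<in> points X \<Longrightarrow> (x, x) \<in> Ord X"
    "(x, y) \<in> Ord X \<Longrightarrow> (y, z) \<in> Ord X \<Longrightarrow> (x, z) \<in> Ord X"
    "(x, y) \<in> Ord X \<Longrightarrow> (y, x) \<in> Ord X \<Longrightarrow> x = y"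
    "\<lbrakk>x \<in> points X; y \<in> points X; (x, y) \<notin> Ord X\<rbrakk> \<Longrightarrow> \<exists>U\<in>clopen_upsets X. x \<in> U \<and> y \<notin> U"
  using assms unfolding PS_def partial_order_on_def preorder_on_def refl_on_def trans_def antisym_def
  by blast+

lemma clopen_upsetsD:
  assumes "U \<in> clopen_upsets X"
  shows "openin (Topo X) U" "closedin (Topo X) U" "U \<subseteq> points X"
    "x \<in> U \<Longrightarrow> (x, y) \<in> Ord X \<Longrightarrow> y \<in> U"
  using assms closedin_subset by (auto simp: clopen_upsets_def up_def)

lemma clopen_upsets_Int: "\<lbrakk>U \<in> clopen_upsets X; V \<in> clopen_upsets X\<rbrakk> \<Longrightarrow> U \<inter> V \<in> clopen_upsets X"
  and clopen_upsets_Un: "\<lbrakk>U \<in> clopen_upsets X; V \<in> clopen_upsets X\<rbrakk> \<Longrightarrow> U \<union> V \<in> clopen_upsets X"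
  by (auto simp: clopen_upsets_def up_def)

lemma clopen_upsets_empty [simp]: "{} \<in> clopen_upsets X"
  by (simp add: clopen_upsets_def up_def)

lemma clopen_upsets_points: "Ord X \<subseteq> points X \<times> points X \<Longrightarrow> points X \<in> clopen_upsets X"
  by (auto simp: clopen_upsets_def up_def)

text \<open>Complementation exchanges clopen upsets and clopen downsets, so the topology of \<C>(X),
  which is generated from both, can be tested with upsets alone.\<close>

lemma clopen_downsets_iff:
  assumes "Ord X \<subseteq> points X \<times> points X"
  shows "S \<in> clopen_downsets X \<longleftrightarrow> S \<subseteq> points X \<and> points X - S \<in> clopen_upsets X"
proof (cases "S \<subseteq> points X")
  case True
  then have "openin (Topo X) (points X - S) \<longleftrightarrow> closedin (Topo X) S"
    "closedin (Topo X) (points X - S) \<longleftrightarrow> openin (Topo X) S"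
    by (simp_all add: closedin_def double_diff)
  moreover have "up X (points X - S) \<subseteq> points X - S \<longleftrightarrow> down X S \<subseteq> S"
    using assms True by (auto simp: up_def down_def)
  ultimately show ?thesis
    using True by (auto simp: clopen_downsets_def clopen_upsets_def)
next
  case False
  then show ?thesis
    by (auto simp: clopen_downsets_def dest: openin_subset)
qed

text \<open>Compactness turns pointwise separation of the order by \<open>\<B>\<close> into separation of compact sets.\<close>

lemma compact_separation:
  assumes B: "\<B> \<subseteq> clopen_upsets X" "{} \<in> \<B>" "points X \<in> \<B>"
    and Int: "\<And>U V. U \<in> \<B> \<Longrightarrow> V \<in> \<B> \<Longrightarrow> U \<inter> V \<in> \<B>"
    and Un: "\<And>U V. U \<in> \<B> \<Longrightarrow> V \<in> \<B> \<Longrightarrow> U \<union> V \<in> \<B>"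
    and sep: "\<And>x y. \<lbrakk>x \<in> points X; y \<in> points X; (x, y) \<notin> Ord X\<rbrakk> \<Longrightarrow> \<exists>U\<in>\<B>. x \<in> U \<and> y \<notin> U"
    and M: "compactin (Topo X) M" and N: "compactin (Topo X) N"
    and MN: "\<And>x y. x \<in> M \<Longrightarrow> y \<in> N \<Longrightarrow> (x, y) \<notin> Ord X"
  shows "\<exists>U\<in>\<B>. M \<subseteq> U \<and> U \<inter> N = {}"
proof -
  have pts: "M \<subseteq> points X" "N \<subseteq> points X"
    using M N by (auto simp: compactin_subset_topspace)
  \<comment> \<open>For a fixed \<open>x\<close> the complements of the members of
    \<open>\<B>\<close> around \<open>x\<close> cover \<open>N\<close>; intersecting finitely many
    of these members gives one that contains \<open>x\<close> and misses \<open>N\<close>.\<close>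
  have one: "\<exists>U\<in>\<B>. x \<in> U \<and> U \<inter> N = {}" if x: "x \<in> M" for x
  proof -
    let ?\<U> = "{points X - U |U. U \<in> \<B> \<and> x \<in> U}"
    have "\<And>V. V \<in> ?\<U> \<Longrightarrow> openin (Topo X) V"
      using B(1) by (auto dest: clopen_upsetsD(2))
    moreover have "N \<subseteq> \<Union>?\<U>"
    proof
      fix y assume "y \<in> N"
      then obtain U where "U \<in> \<B>" "x \<in> U" "y \<notin> U"
        using sep [of x y] MN [of x y] x pts by blast
      then show "y \<in> \<Union>?\<U>"
        using \<open>y \<in> N\<close> pts by blast
    qed
    ultimately have "\<exists>\<F>. finite \<F> \<and> \<F> \<subseteq> ?\<U> \<and> N \<subseteq> \<Union>\<F>"
      by (rule compactinD [OF N])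
    then obtain \<F> where F: "finite \<F>" "\<F> \<subseteq> ?\<U>" "N \<subseteq> \<Union>\<F>"
      by (elim exE conjE)
    from F(1,2) have "\<exists>U\<in>\<B>. x \<in> U \<and> U \<inter> \<Union>\<F> = {}"
    proof (induction rule: finite_induct)
      case empty
      then show ?case using B(3) x pts by blast
    next
      case (insert V \<F>)
      then obtain U W where "U \<in> \<B>" "x \<in> U" "U \<inter> \<Union>\<F> = {}" "W \<in> \<B>" "x \<in> W" "V = points X - W"
        by auto
      then show ?case
        using Int [of U W] by (intro bexI [of _ "U \<inter> W"]) auto
    qed
    with F(3) show ?thesis
      by blast
  qed
  \<comment> \<open>The sets just found cover \<open>M\<close>, and a finite union of them still
    misses \<open>N\<close>.\<close>
  let ?\<U> = "{U \<in> \<B>. U \<inter> N = {}}"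
  have "\<And>V. V \<in> ?\<U> \<Longrightarrow> openin (Topo X) V"
    using B(1) by (auto dest: clopen_upsetsD(1))
  moreover have "M \<subseteq> \<Union>?\<U>"
    using one by blast
  ultimately have "\<exists>\<F>. finite \<F> \<and> \<F> \<subseteq> ?\<U> \<and> M \<subseteq> \<Union>\<F>"
    by (rule compactinD [OF M])
  then obtain \<F> where F: "finite \<F>" "\<F> \<subseteq> ?\<U>" "M \<subseteq> \<Union>\<F>"
    by (elim exE conjE)
  from F(1,2) have "\<Union>\<F> \<in> \<B> \<and> \<Union>\<F> \<inter> N = {}"
    by (induction rule: finite_induct) (auto intro: B(2) Un)
  with F(3) show ?thesis
    by (intro bexI [of _ "\<Union>\<F>"]) simp_all
qed

lemma PS_separation:
  assumes X: "PS X" and "compactin (Topo X) M" "compactin (Topo X) N"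
    and "\<And>x y. x \<in> M \<Longrightarrow> y \<in> N \<Longrightarrow> (x, y) \<notin> Ord X"
  obtains U where "U \<in> clopen_upsets X" "M \<subseteq> U" "U \<inter> N = {}"
proof -
  have "\<exists>U\<in>clopen_upsets X. M \<subseteq> U \<and> U \<inter> N = {}"
    by (rule compact_separation [OF order_refl clopen_upsets_empty clopen_upsets_points
        clopen_upsets_Int clopen_upsets_Un PSD(6) [OF X] assms(2,3,4)]) (use PSD(2) [OF X] in auto)
  then show thesis
    using that by blast
qed

lemma PS_sep_up:
  assumes X: "PS X" and "compactin (Topo X) M" "x \<in> points X" "x \<notin> up X M"
  obtains U where "U \<in> clopen_upsets X" "M \<subseteq> U" "x \<notin> U"
  using PS_separation [OF X assms(2), of "{x}"] assms(3,4) by (auto simp: up_def)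

lemma PS_sep_down:
  assumes X: "PS X" and "compactin (Topo X) M" "x \<in> points X" "x \<notin> down X M"
  obtains U where "U \<in> clopen_upsets X" "x \<in> U" "U \<inter> M = {}"
  using PS_separation [OF X _ assms(2), of "{x}"] assms(3,4) by (auto simp: down_def)

text \<open>By antisymmetry one of two distinct points is not below the other, so a clopen upset and
  its complement separate them. The Hausdorff property is wanted for inverting continuous
  bijections.\<close>

lemma PS_Hausdorff:
  assumes X: "PS X"
  shows "Hausdorff_space (Topo X)"
proof -
  have *: "\<exists>U V. openin (Topo X) U \<and> openin (Topo X) V \<and> x \<in> U \<and> y \<in> V \<and> disjnt U V"
    if xy: "x \<in> points X" "y \<in> points X" "(x, y) \<notin> Ord X" for x y
  proof -
    obtain U where "U \<in> clopen_upsets X" "x \<in> U" "y \<notin> U"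
      using PSD(6) [OF X xy] by blast
    then show ?thesis
      using xy(2) by (intro exI [of _ U] exI [of _ "points X - U"]) (auto simp: disjnt_def dest: clopen_upsetsD)
  qed
  show ?thesis
    unfolding Hausdorff_space_def
  proof clarify
    fix x y assume xy: "x \<in> points X" "y \<in> points X" "x \<noteq> y"
    then have "(x, y) \<notin> Ord X \<or> (y, x) \<notin> Ord X"
      using PSD(5) [OF X] by blast
    then show "\<exists>U V. openin (Topo X) U \<and> openin (Topo X) V \<and> x \<in> U \<and> y \<in> V \<and> disjnt U V"
      using * [OF xy(1,2)] * [OF xy(2,1)] by (metis disjnt_sym)
  qed
qed

lemma closedin_if_separated:
  assumes "S \<subseteq> topspace T" "\<And>x. x \<in> topspace T \<Longrightarrow> x \<notin> S \<Longrightarrow> \<exists>V. openin T V \<and> x \<in> V \<and> V \<inter> S = {}"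
  shows "closedin T S"
proof -
  have "\<exists>V. openin T V \<and> x \<in> V \<and> V \<subseteq> topspace T - S" if "x \<in> topspace T - S" for x
    using assms(2) [of x] that openin_subset by blast
  then have "openin T (topspace T - S)"
    by (subst openin_subopen) blast
  with assms(1) show ?thesis
    by (simp add: closedin_def)
qed

text \<open>A point outside is cut off from the compact set by a clopen upset, which contains the
  whole upward closure; the complement of that upset is the required neighbourhood.\<close>

lemma up_closed:
  assumes X: "PS X" and M: "compactin (Topo X) M"
  shows "closedin (Topo X) (up X M)"
proof (rule closedin_if_separated)
  show "up X M \<subseteq> points X"
    using PSD(2) [OF X] by (auto simp: up_def)
  fix x assume x: "x \<in> points X" "x \<notin> up X M"
  obtain U where U: "U \<in> clopen_upsets X" "M \<subseteq> U" "x \<notin> U"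
    by (rule PS_sep_up [OF X M x])
  then have "up X M \<subseteq> U"
    by (auto simp: up_def dest: clopen_upsetsD(4))
  with U x show "\<exists>V. openin (Topo X) V \<and> x \<in> V \<and> V \<inter> up X M = {}"
    by (intro exI [of _ "points X - U"]) (auto dest: clopen_upsetsD)
qed

lemma down_closed:
  assumes X: "PS X" and M: "compactin (Topo X) M"
  shows "closedin (Topo X) (down X M)"
proof (rule closedin_if_separated)
  show "down X M \<subseteq> points X"
    using PSD(2) [OF X] by (auto simp: down_def)
  fix x assume x: "x \<in> points X" "x \<notin> down X M"
  obtain U where U: "U \<in> clopen_upsets X" "x \<in> U" "U \<inter> M = {}"
    by (rule PS_sep_down [OF X M x])
  then have "U \<inter> down X M = {}"
    by (auto simp: down_def dest: clopen_upsetsD(4))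
  with U show "\<exists>V. openin (Topo X) V \<and> x \<in> V \<and> V \<inter> down X M = {}"
    by (intro exI [of _ U]) (auto dest: clopen_upsetsD(1))
qed

section \<open>Morphisms of Priestley spaces\<close>

lemma PS_homD:
  assumes "f \<in> PS_hom X Y"
  shows "f \<in> points X \<rightarrow>\<^sub>E points Y" "x \<in> points X \<Longrightarrow> f x \<in> points Y"
    "continuous_map (Topo X) (Topo Y) f" "(x, y) \<in> Ord X \<Longrightarrow> (f x, f y) \<in> Ord Y"
  using assms by (auto simp: PS_hom_def)

lemma PS_hom_id: "(\<lambda>x\<in>points X. x) \<in> PS_hom X X" if "Ord X \<subseteq> points X \<times> points X"
proof -
  have "continuous_map (Topo X) (Topo X) (\<lambda>x\<in>points X. x)"
    by (rule continuous_map_eq [where f = "\<lambda>x. x"]) auto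
  then show ?thesis
    using that by (auto simp: PS_hom_def)
qed

lemma PS_hom_compose:
  assumes f: "f \<in> PS_hom X Y" and g: "g \<in> PS_hom Y Z" and "Ord X \<subseteq> points X \<times> points X"
  shows "compose (points X) g f \<in> PS_hom X Z"
proof -
  have "continuous_map (Topo X) (Topo Z) (compose (points X) g f)"
    by (rule continuous_map_eq [OF continuous_map_compose [OF PS_homD(3) [OF f] PS_homD(3) [OF g]]])
      (simp add: compose_eq)
  moreover have "compose (points X) g f \<in> points X \<rightarrow>\<^sub>E points Z"
    using PS_homD(2) [OF f] PS_homD(2) [OF g] by (auto simp: compose_def)
  moreover have "(compose (points X) g f x, compose (points X) g f y) \<in> Ord Z" if "(x, y) \<in> Ord X" for x y
    using PS_homD(4) [OF g PS_homD(4) [OF f that]] assms(3) that by (auto simp: compose_eq)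
  ultimately show ?thesis
    by (auto simp: PS_hom_def)
qed

text \<open>A continuous bijection from a compact space to a Hausdorff space is a homeomorphism.
  Order reflection is a separate assumption because a monotone bijection may fail to have a monotone
  inverse.\<close>

lemma PS_hom_inverse:
  assumes X: "PS X" and Y: "PS Y" and h: "h \<in> PS_hom X Y" and bij: "bij_betw h (points X) (points Y)"
    and reflect: "\<And>x y. \<lbrakk>x \<in> points X; y \<in> points X; (h x, h y) \<in> Ord Y\<rbrakk> \<Longrightarrow> (x, y) \<in> Ord X"
  shows "(\<lambda>y\<in>points Y. the_inv_into (points X) h y) \<in> PS_hom Y X"
proof -
  let ?k = "the_inv_into (points X) h"
  have inj: "inj_on h (points X)" and im: "h ` points X = points Y"
    using bij by (auto simp: bij_betw_def)
  have k: "?k y \<in> points X" "h (?k y) = y" if "y \<in> points Y" for y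
    using that inj im by (auto simp: the_inv_into_into f_the_inv_into_f)
  have "homeomorphic_map (Topo X) (Topo Y) h"
    by (rule continuous_imp_homeomorphic_map [OF PS_homD(3) [OF h] PSD(1) [OF X] PS_Hausdorff [OF Y] im inj])
  then obtain g where g: "homeomorphic_maps (Topo X) (Topo Y) h g"
    by (auto simp: homeomorphic_map_maps)
  have "continuous_map (Topo Y) (Topo X) (\<lambda>y\<in>points Y. ?k y)"
  proof (rule continuous_map_eq [of _ _ g])
    show "continuous_map (Topo Y) (Topo X) g"
      using g by (simp add: homeomorphic_maps_def)
    fix y assume y: "y \<in> points Y"
    then have "h (g y) = y" "g y \<in> points X"
      using g by (auto simp: homeomorphic_maps_def continuous_map_def Pi_iff)
    then show "g y = (\<lambda>y\<in>points Y. ?k y) y"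
      using inj y by (metis restrict_apply' the_inv_into_f_f)
  qed
  moreover have "(?k x, ?k y) \<in> Ord X" if "(x, y) \<in> Ord Y" for x y
    using that PSD(2) [OF Y] k by (intro reflect) auto
  ultimately show ?thesis
    using k PSD(2) [OF Y] by (auto simp: PS_hom_def)
qed

lemma clopen_upsets_preimage:
  assumes h: "h \<in> PS_hom X Y" and U: "U \<in> clopen_upsets Y" and X: "Ord X \<subseteq> points X \<times> points X"
  shows "{x \<in> points X. h x \<in> U} \<in> clopen_upsets X"
  using openin_continuous_map_preimage [OF PS_homD(3) [OF h] clopen_upsetsD(1) [OF U]]
    closedin_continuous_map_preimage [OF PS_homD(3) [OF h] clopen_upsetsD(2) [OF U]]
    clopen_upsetsD(4) [OF U] PS_homD(4) [OF h] X
  by (auto simp: clopen_upsets_def up_def)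


section \<open>Closed convex sets\<close>

lemma convex_closedD:
  assumes "M \<in> convex_closed X"
  shows "closedin (Topo X) M" "M \<subseteq> points X"
  using assms by (auto simp: convex_closed_def dest: closedin_subset)

lemma convex_closed_compact: "PS X \<Longrightarrow> M \<in> convex_closed X \<Longrightarrow> compactin (Topo X) M"
  using closedin_compact_space [OF PSD(1) convex_closedD(1)] .

text \<open>Convexity says that whatever lies between two members is a member, which is the
  inclusion from right to left. The equation is what makes the Egli-Milner order
  antisymmetric.\<close>

lemma convex_closed_eq:
  assumes "PS X" "M \<in> convex_closed X"
  shows "M = up X M \<inter> down X M"
proof
  show "M \<subseteq> up X M \<inter> down X M"
    using assms convex_closedD(2) [OF assms(2)] PSD(3) [OF assms(1)] by (auto simp: up_def down_def)
  show "up X M \<inter> down X M \<subseteq> M"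
    using assms(2) by (auto simp: up_def down_def convex_closed_def)
qed

text \<open>Both closures of a compact set are closed, and their intersection is its convex hull;
  hence \<open>Cmap\<close> takes values in closed convex sets.\<close>

lemma up_down_convex_closed:
  assumes X: "PS X" and M: "compactin (Topo X) M"
  shows "up X M \<inter> down X M \<in> convex_closed X"
proof -
  have "z \<in> up X M \<inter> down X M"
    if "x \<in> up X M \<inter> down X M" "y \<in> up X M \<inter> down X M" "(x, z) \<in> Ord X" "(z, y) \<in> Ord X" for x y z
    using that PSD(4) [OF X] by (auto simp: up_def down_def)
  moreover have "closedin (Topo X) (up X M \<inter> down X M)"
    using up_closed [OF X M] down_closed [OF X M] by (rule closedin_Int)
  ultimately show ?thesis
    unfolding convex_closed_def by blast
qed

lemma Ord_C: "Ord (C X) = {(M, N). M \<in> convex_closed X \<and> N \<in> convex_closed X \<and> M \<subseteq> down X N \<and> N \<subseteq> up X M}"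
  by (simp add: C_def)

lemma points_C [simp]: "points (C X) = convex_closed X"
proof
  show "points (C X) \<subseteq> convex_closed X"
    by (auto simp: C_def)
  \<comment> \<open>The underlying set of a generated topology is the union of the generators; the
    empty set is a clopen upset, and every closed convex set misses it.\<close>
  have "{M \<in> convex_closed X. M \<inter> {} = {}} \<subseteq> points (C X)"
    unfolding C_def by (simp del: Int_empty_right) (use clopen_upsets_empty in blast)
  then show "convex_closed X \<subseteq> points (C X)"
    by simp
qed

lemma Ord_C_sub: "Ord (C X) \<subseteq> points (C X) \<times> points (C X)"
  by (auto simp: Ord_C)

text \<open>The clause about meeting \<open>U\<close> matches \<open>M \<subseteq> down X N\<close>,
  the clause about containment matches \<open>N \<subseteq> up X M\<close>. One direction uses that
  \<open>U\<close> is upward closed; the other separates a point of \<open>M\<close> from the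
  compact set \<open>N\<close>, or the compact set \<open>M\<close> from a point of
  \<open>N\<close>.\<close>

lemma Ord_C_iff:
  assumes X: "PS X" and M: "M \<in> convex_closed X" and N: "N \<in> convex_closed X"
  shows "(M, N) \<in> Ord (C X) \<longleftrightarrow> (\<forall>U\<in>clopen_upsets X. (M \<inter> U \<noteq> {} \<longrightarrow> N \<inter> U \<noteq> {}) \<and> (M \<subseteq> U \<longrightarrow> N \<subseteq> U))"
    (is "_ \<longleftrightarrow> ?r")
proof
  assume MN: "(M, N) \<in> Ord (C X)"
  show ?r
  proof (intro ballI conjI impI)
    fix U assume U: "U \<in> clopen_upsets X"
    {
      assume "M \<inter> U \<noteq> {}"
      then obtain x where "x \<in> M" "x \<in> U"
        by blast
      moreover from this MN obtain y where "y \<in> N" "(x, y) \<in> Ord X"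
        by (auto simp: Ord_C down_def)
      ultimately show "N \<inter> U \<noteq> {}"
        using clopen_upsetsD(4) [OF U] by blast
    }
    assume "M \<subseteq> U"
    moreover have "N \<subseteq> up X M"
      using MN by (simp add: Ord_C)
    ultimately show "N \<subseteq> U"
      using clopen_upsetsD(4) [OF U] unfolding up_def by blast
  qed
next
  assume r: ?r
  have "x \<in> down X N" if x: "x \<in> M" for x
  proof (rule ccontr)
    assume "x \<notin> down X N"
    then obtain U where "U \<in> clopen_upsets X" "x \<in> U" "U \<inter> N = {}"
      using PS_sep_down [OF X convex_closed_compact [OF X N], of x] x convex_closedD(2) [OF M] by blast
    with r x show False
      by blast
  qed
  moreover have "y \<in> up X M" if y: "y \<in> N" for y
  proof (rule ccontr)
    assume "y \<notin> up X M"
    then obtain U where "U \<in> clopen_upsets X" "M \<subseteq> U" "y \<notin> U"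
      using PS_sep_up [OF X convex_closed_compact [OF X M], of y] y convex_closedD(2) [OF N] by blast
    with r y show False
      by blast
  qed
  ultimately show "(M, N) \<in> Ord (C X)"
    using M N by (auto simp: Ord_C)
qed

text \<open>The Egli-Milner order holds in both directions, and convexity turns this into
  equality.\<close>

lemma convex_closed_eqI:
  assumes X: "PS X" and M: "M \<in> convex_closed X" and N: "N \<in> convex_closed X"
    and "\<And>U. U \<in> clopen_upsets X \<Longrightarrow> M \<inter> U \<noteq> {} \<longleftrightarrow> N \<inter> U \<noteq> {}"
    and "\<And>U. U \<in> clopen_upsets X \<Longrightarrow> M \<subseteq> U \<longleftrightarrow> N \<subseteq> U"
  shows "M = N"
proof -
  have *: "(M, N) \<in> Ord (C X)" "(N, M) \<in> Ord (C X)"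
    using assms by (auto simp: Ord_C_iff)
  have "M' \<subseteq> N'" if "(M', N') \<in> Ord (C X)" "(N', M') \<in> Ord (C X)" for M' N'
    using convex_closed_eq [OF X, of N'] that by (auto simp: Ord_C)
  with * show ?thesis
    by blast
qed

lemma clopen_C:
  assumes X: "PS X" and U: "U \<in> clopen_upsets X"
  shows "{M \<in> convex_closed X. M \<inter> U \<noteq> {}} \<in> clopen_upsets (C X)"
    and "{M \<in> convex_closed X. M \<subseteq> U} \<in> clopen_upsets (C X)"
proof -
  have Tb: "openin (Topo (C X)) {M \<in> convex_closed X. M \<inter> S \<noteq> {}}"
     "openin (Topo (C X)) {M \<in> convex_closed X. M \<inter> S = {}}"
    if "S \<in> clopen_upsets X \<union> clopen_downsets X" for S
    unfolding C_def using that by (auto intro!: topology_generated_by_Basis)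
  have "points (C X) - {M \<in> convex_closed X. M \<inter> S \<noteq> {}} = {M \<in> convex_closed X. M \<inter> S = {}}"
    "points (C X) - {M \<in> convex_closed X. M \<inter> S = {}} = {M \<in> convex_closed X. M \<inter> S \<noteq> {}}" for S
    by auto
  with Tb have cl: "closedin (Topo (C X)) {M \<in> convex_closed X. M \<inter> S \<noteq> {}}"
      "closedin (Topo (C X)) {M \<in> convex_closed X. M \<inter> S = {}}"
    if "S \<in> clopen_upsets X \<union> clopen_downsets X" for S
    using that by (auto simp: closedin_def)
  have D: "points X - U \<in> clopen_downsets X"
    using U PSD(2) [OF X] clopen_upsetsD(3) [OF U] by (simp add: clopen_downsets_iff double_diff)
  \<comment> \<open>Being contained in \<open>U\<close> means missing its complement, a clopen
    downset, so this set is itself a generator of the topology.\<close>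
  have eq: "{M \<in> convex_closed X. M \<subseteq> U} = {M \<in> convex_closed X. M \<inter> (points X - U) = {}}"
    using convex_closedD(2) by blast
  have mono: "M' \<in> convex_closed X \<and> (M \<inter> U \<noteq> {} \<longrightarrow> M' \<inter> U \<noteq> {}) \<and> (M \<subseteq> U \<longrightarrow> M' \<subseteq> U)"
    if MM': "(M, M') \<in> Ord (C X)" for M M'
  proof -
    have M: "M \<in> convex_closed X" "M' \<in> convex_closed X"
      using MM' by (auto simp: Ord_C)
    show ?thesis
      using MM' M U by (simp add: Ord_C_iff [OF X M])
  qed
  show "{M \<in> convex_closed X. M \<inter> U \<noteq> {}} \<in> clopen_upsets (C X)"
    unfolding clopen_upsets_def up_def using Tb(1) [of U] cl(1) [of U] U mono by blast
  show "{M \<in> convex_closed X. M \<subseteq> U} \<in> clopen_upsets (C X)"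
    unfolding clopen_upsets_def up_def
    using Tb(2) [of "points X - U"] cl(2) [of "points X - U"] D mono unfolding eq [symmetric] by blast
qed

text \<open>The two families of preimages determine everything: the generators for downsets are
  reached by complementation, and the order of \<C>(X) is tested by clopen upsets. This is how
  structure maps of coalgebras are recognized.\<close>

lemma PS_hom_C_iff:
  assumes X: "PS X" and Z: "Ord Z \<subseteq> points Z \<times> points Z"
  shows "g \<in> PS_hom Z (C X) \<longleftrightarrow> g \<in> points Z \<rightarrow>\<^sub>E convex_closed X \<and>
    (\<forall>U\<in>clopen_upsets X. {z \<in> points Z. g z \<inter> U \<noteq> {}} \<in> clopen_upsets Z \<and>
       {z \<in> points Z. g z \<subseteq> U} \<in> clopen_upsets Z)"
proof (intro iffI conjI)
  assume g: "g \<in> PS_hom Z (C X)"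
  then show ran: "g \<in> points Z \<rightarrow>\<^sub>E convex_closed X"
    using PS_homD(1) by fastforce
  show "\<forall>U\<in>clopen_upsets X. {z \<in> points Z. g z \<inter> U \<noteq> {}} \<in> clopen_upsets Z \<and>
       {z \<in> points Z. g z \<subseteq> U} \<in> clopen_upsets Z"
  proof
    fix U assume U: "U \<in> clopen_upsets X"
    have "{z \<in> points Z. g z \<inter> U \<noteq> {}} = {z \<in> points Z. g z \<in> {M \<in> convex_closed X. M \<inter> U \<noteq> {}}}"
      "{z \<in> points Z. g z \<subseteq> U} = {z \<in> points Z. g z \<in> {M \<in> convex_closed X. M \<subseteq> U}}"
      using ran by auto
    then show "{z \<in> points Z. g z \<inter> U \<noteq> {}} \<in> clopen_upsets Z \<and> {z \<in> points Z. g z \<subseteq> U} \<in> clopen_upsets Z"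
      using clopen_upsets_preimage [OF g clopen_C(1) [OF X U] Z]
        clopen_upsets_preimage [OF g clopen_C(2) [OF X U] Z] by simp
  qed
next
  assume "g \<in> points Z \<rightarrow>\<^sub>E convex_closed X \<and>
    (\<forall>U\<in>clopen_upsets X. {z \<in> points Z. g z \<inter> U \<noteq> {}} \<in> clopen_upsets Z \<and>
       {z \<in> points Z. g z \<subseteq> U} \<in> clopen_upsets Z)"
  then have ran: "g \<in> points Z \<rightarrow>\<^sub>E convex_closed X"
    and 1: "\<And>U. U \<in> clopen_upsets X \<Longrightarrow> {z \<in> points Z. g z \<inter> U \<noteq> {}} \<in> clopen_upsets Z"
    and 2: "\<And>U. U \<in> clopen_upsets X \<Longrightarrow> {z \<in> points Z. g z \<subseteq> U} \<in> clopen_upsets Z"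
    by auto
  have gz: "g z \<in> convex_closed X" "g z \<subseteq> points X" if "z \<in> points Z" for z
    using ran that convex_closedD(2) by (auto simp: PiE_iff)
  have op: "openin (Topo Z) {z \<in> points Z. g z \<inter> S \<noteq> {}} \<and> openin (Topo Z) {z \<in> points Z. g z \<inter> S = {}}"
    if S: "S \<in> clopen_upsets X \<union> clopen_downsets X" for S
  proof -
    have neg: "{z \<in> points Z. g z \<inter> S = {}} = points Z - {z \<in> points Z. g z \<inter> S \<noteq> {}}"
      "{z \<in> points Z. g z \<inter> S \<noteq> {}} = points Z - {z \<in> points Z. g z \<inter> S = {}}"
      by auto
    show ?thesis
    proof (cases "S \<in> clopen_upsets X")
      case True
      then show ?thesis
        using clopen_upsetsD(1,2) [OF 1 [OF True]] unfolding neg(1) by blast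
    next
      case False
      then have "S \<in> clopen_downsets X"
        using S by blast
      then have U: "points X - S \<in> clopen_upsets X"
        using clopen_downsets_iff [OF PSD(2) [OF X]] by blast
      \<comment> \<open>Missing the clopen downset \<open>S\<close> is being contained in the clopen
        upset \<open>points X - S\<close>, so the family of containments settles this case.\<close>
      have "{z \<in> points Z. g z \<inter> S = {}} = {z \<in> points Z. g z \<subseteq> points X - S}"
        using gz(2) by blast
      then show ?thesis
        using clopen_upsetsD(1,2) [OF 2 [OF U]] by (subst neg(2)) auto
    qed
  qed
  have "continuous_map (Topo Z) (Topo (C X)) g"
  proof -
    let ?S = "{{M \<in> convex_closed X. M \<inter> S \<noteq> {}} |S. S \<in> clopen_upsets X \<union> clopen_downsets X} \<union>
        {{M \<in> convex_closed X. M \<inter> S = {}} |S. S \<in> clopen_upsets X \<union> clopen_downsets X}"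
    have Top: "Topo (C X) = topology_generated_by ?S"
      by (simp add: C_def)
    have "\<Union>?S = points (C X)"
      unfolding Top by simp
    then have "g ` points Z \<subseteq> \<Union>?S"
      using gz(1) by auto
    moreover have "openin (Topo Z) (g -` U \<inter> points Z)" if US: "U \<in> ?S" for U
    proof -
      obtain S where S: "S \<in> clopen_upsets X \<union> clopen_downsets X"
        "U = {M \<in> convex_closed X. M \<inter> S \<noteq> {}} \<or> U = {M \<in> convex_closed X. M \<inter> S = {}}"
        using US by blast
      have "g -` {M \<in> convex_closed X. M \<inter> S \<noteq> {}} \<inter> points Z = {z \<in> points Z. g z \<inter> S \<noteq> {}}"
        "g -` {M \<in> convex_closed X. M \<inter> S = {}} \<inter> points Z = {z \<in> points Z. g z \<inter> S = {}}"
        using gz(1) by auto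
      with op [OF S(1)] S(2) show ?thesis
        by auto
    qed
    ultimately show ?thesis
      unfolding Top continuous_on_generated_topo_iff by blast
  qed
  moreover have "(g x, g y) \<in> Ord (C X)" if xy: "(x, y) \<in> Ord Z" for x y
  proof -
    have p: "x \<in> points Z" "y \<in> points Z"
      using xy Z by auto
    have "g y \<inter> U \<noteq> {}" if "U \<in> clopen_upsets X" "g x \<inter> U \<noteq> {}" for U
      using clopen_upsetsD(4) [OF 1 [OF that(1)] _ xy] that p by blast
    moreover have "g y \<subseteq> U" if "U \<in> clopen_upsets X" "g x \<subseteq> U" for U
      using clopen_upsetsD(4) [OF 2 [OF that(1)] _ xy] that p by blast
    ultimately show ?thesis
      using gz(1) p by (subst Ord_C_iff [OF X]) auto
  qed
  ultimately show "g \<in> PS_hom Z (C X)"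
    using ran by (auto simp: PS_hom_def)
qed

lemma Cmap_props:
  assumes X: "PS X" and Y: "PS Y" and h: "h \<in> PS_hom X Y" and M: "M \<in> convex_closed X"
  shows "Cmap X Y h M \<in> convex_closed Y"
    and "U \<in> clopen_upsets Y \<Longrightarrow> Cmap X Y h M \<inter> U \<noteq> {} \<longleftrightarrow> M \<inter> {x \<in> points X. h x \<in> U} \<noteq> {}"
    and "U \<in> clopen_upsets Y \<Longrightarrow> Cmap X Y h M \<subseteq> U \<longleftrightarrow> M \<subseteq> {x \<in> points X. h x \<in> U}"
proof -
  have eq: "Cmap X Y h M = up Y (h ` M) \<inter> down Y (h ` M)"
    using M by (simp add: Cmap_def)
  show "Cmap X Y h M \<in> convex_closed Y"
    unfolding eq using image_compactin [OF convex_closed_compact [OF X M] PS_homD(3) [OF h]]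
    by (rule up_down_convex_closed [OF Y])
  have hM: "h x \<in> Cmap X Y h M" "x \<in> points X" if "x \<in> M" for x
  proof -
    show "x \<in> points X"
      using that convex_closedD(2) [OF M] by blast
    then have "(h x, h x) \<in> Ord Y"
      using PSD(3) [OF Y] PS_homD(2) [OF h] by blast
    then show "h x \<in> Cmap X Y h M"
      unfolding eq up_def down_def using that by blast
  qed
  assume U: "U \<in> clopen_upsets Y"
  show "Cmap X Y h M \<inter> U \<noteq> {} \<longleftrightarrow> M \<inter> {x \<in> points X. h x \<in> U} \<noteq> {}"
  proof
    assume "Cmap X Y h M \<inter> U \<noteq> {}"
    then obtain y x where "y \<in> U" "x \<in> M" "(y, h x) \<in> Ord Y"
      unfolding eq by (auto simp: down_def)
    then show "M \<inter> {x \<in> points X. h x \<in> U} \<noteq> {}"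
      using hM clopen_upsetsD(4) [OF U] by blast
  qed (use hM in blast)
  show "Cmap X Y h M \<subseteq> U \<longleftrightarrow> M \<subseteq> {x \<in> points X. h x \<in> U}"
  proof
    assume "M \<subseteq> {x \<in> points X. h x \<in> U}"
    then show "Cmap X Y h M \<subseteq> U"
      unfolding eq up_def using clopen_upsetsD(4) [OF U] by blast
  qed (use hM in blast)
qed

text \<open>By \<open>Cmap_props\<close> the preimages of the test sets for \<open>U\<close> are the
  test sets for the preimage of \<open>U\<close>. The lemma serves to move a structure map to a copy
  of its space.\<close>

lemma Cmap_hom:
  assumes X: "PS X" and Y: "PS Y" and h: "h \<in> PS_hom X Y"
  shows "Cmap X Y h \<in> PS_hom (C X) (C Y)"
  unfolding PS_hom_C_iff [OF Y Ord_C_sub]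
proof (intro conjI ballI)
  show "Cmap X Y h \<in> points (C X) \<rightarrow>\<^sub>E convex_closed Y"
    using Cmap_props(1) [OF X Y h] by (auto simp: PiE_iff Cmap_def extensional_def)
  fix U assume U: "U \<in> clopen_upsets Y"
  have V: "{x \<in> points X. h x \<in> U} \<in> clopen_upsets X"
    by (rule clopen_upsets_preimage [OF h U PSD(2) [OF X]])
  have "{M \<in> points (C X). Cmap X Y h M \<inter> U \<noteq> {}} = {M \<in> convex_closed X. M \<inter> {x \<in> points X. h x \<in> U} \<noteq> {}}"
    using Cmap_props(2) [OF X Y h _ U] by auto
  then show "{M \<in> points (C X). Cmap X Y h M \<inter> U \<noteq> {}} \<in> clopen_upsets (C X)"
    using clopen_C(1) [OF X V] by simp
  have "{M \<in> points (C X). Cmap X Y h M \<subseteq> U} = {M \<in> convex_closed X. M \<subseteq> {x \<in> points X. h x \<in> U}}"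
    using Cmap_props(3) [OF X Y h _ U] by auto
  then show "{M \<in> points (C X). Cmap X Y h M \<subseteq> U} \<in> clopen_upsets (C X)"
    using clopen_C(2) [OF X V] by simp
qed


section \<open>Coalgebras through their clopen upsets\<close>

lemma ccoalgD:
  assumes "ccoalg X"
  shows "PS (fst X)" "snd X \<in> PS_hom (fst X) (C (fst X))"
    "x \<in> points (fst X) \<Longrightarrow> snd X x \<in> convex_closed (fst X)"
    "U \<in> clopen_upsets (fst X) \<Longrightarrow> {x \<in> points (fst X). snd X x \<inter> U \<noteq> {}} \<in> clopen_upsets (fst X)"
    "U \<in> clopen_upsets (fst X) \<Longrightarrow> {x \<in> points (fst X). snd X x \<subseteq> U} \<in> clopen_upsets (fst X)"
  using assms PS_hom_C_iff [OF _ PSD(2), of "fst X" "fst X" "snd X"] by (auto simp: ccoalg_def)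

text \<open>At each point both sides of the square are closed convex sets, and these are determined
  by the clopen upsets they meet and those that contain them. The convex hull in \<open>Cmap\<close>
  thus disappears from the condition.\<close>

lemma ccoalg_hom_iff:
  assumes X: "ccoalg X" and Y: "ccoalg Y"
  shows "h \<in> ccoalg_hom X Y \<longleftrightarrow> h \<in> PS_hom (fst X) (fst Y) \<and>
    (\<forall>x\<in>points (fst X). \<forall>U\<in>clopen_upsets (fst Y).
      (snd X x \<inter> {x \<in> points (fst X). h x \<in> U} \<noteq> {} \<longleftrightarrow> snd Y (h x) \<inter> U \<noteq> {}) \<and>
      (snd X x \<subseteq> {x \<in> points (fst X). h x \<in> U} \<longleftrightarrow> snd Y (h x) \<subseteq> U))"
    (is "_ \<longleftrightarrow> _ \<and> (\<forall>x\<in>_. \<forall>U\<in>_. ?r x U)")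
proof (cases "h \<in> PS_hom (fst X) (fst Y)")
  case h: True
  note XP = ccoalgD(1) [OF X] and YP = ccoalgD(1) [OF Y]
  have eqx: "Cmap (fst X) (fst Y) h (snd X x) = snd Y (h x) \<longleftrightarrow> (\<forall>U\<in>clopen_upsets (fst Y). ?r x U)" (is "?l \<longleftrightarrow> _")
    if x: "x \<in> points (fst X)" for x
  proof
    note C = Cmap_props [OF XP YP h ccoalgD(3) [OF X x]]
    show "?l \<Longrightarrow> \<forall>U\<in>clopen_upsets (fst Y). ?r x U"
      using C(2,3) by (metis (no_types, lifting))
    assume "\<forall>U\<in>clopen_upsets (fst Y). ?r x U"
    then show ?l
      using C ccoalgD(3) [OF Y PS_homD(2) [OF h x]] by (intro convex_closed_eqI [OF YP]) auto
  qed
  have "compose (points (fst X)) (Cmap (fst X) (fst Y) h) (snd X) = compose (points (fst X)) (snd Y) h \<longleftrightarrow>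
      (\<forall>x\<in>points (fst X). Cmap (fst X) (fst Y) h (snd X x) = snd Y (h x))"
    by (auto simp: fun_eq_iff compose_def)
  also have "\<dots> \<longleftrightarrow> (\<forall>x\<in>points (fst X). \<forall>U\<in>clopen_upsets (fst Y). ?r x U)"
    by (intro ball_cong refl eqx)
  finally show ?thesis
    using h by (simp add: ccoalg_hom_def)
qed (simp add: ccoalg_hom_def)

lemma ccoalg_homD:
  assumes X: "ccoalg X" and Y: "ccoalg Y" and h: "h \<in> ccoalg_hom X Y"
    and x: "x \<in> points (fst X)" and U: "U \<in> clopen_upsets (fst Y)"
  shows "snd X x \<inter> {x \<in> points (fst X). h x \<in> U} \<noteq> {} \<longleftrightarrow> snd Y (h x) \<inter> U \<noteq> {}" (is ?d)
    and "snd X x \<subseteq> {x \<in> points (fst X). h x \<in> U} \<longleftrightarrow> snd Y (h x) \<subseteq> U" (is ?b)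
proof -
  note * = bspec [OF bspec [OF conjunct2 [OF iffD1 [OF ccoalg_hom_iff [OF X Y] h]] x] U]
  show ?d using * by (rule conjunct1)
  show ?b using * by (rule conjunct2)
qed

lemma ccoalg_id_hom:
  assumes X: "ccoalg X"
  shows "ccoalg_id X \<in> ccoalg_hom X X"
proof -
  have "{x \<in> points (fst X). ccoalg_id X x \<in> U} = U" if "U \<in> clopen_upsets (fst X)" for U
    using clopen_upsetsD(3) [OF that] by (auto simp: ccoalg_id_def)
  then show ?thesis
    using PS_hom_id [OF PSD(2) [OF ccoalgD(1) [OF X]]] by (simp add: ccoalg_hom_iff [OF X X] ccoalg_id_def)
qed

lemma ccoalg_comp_hom:
  assumes X: "ccoalg X" and Y: "ccoalg Y" and Z: "ccoalg Z"
    and h: "h \<in> ccoalg_hom X Y" and k: "k \<in> ccoalg_hom Y Z"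
  shows "ccoalg_comp X k h \<in> ccoalg_hom X Z"
proof -
  have h': "h \<in> PS_hom (fst X) (fst Y)" and k': "k \<in> PS_hom (fst Y) (fst Z)"
    using h k by (auto simp: ccoalg_hom_def)
  have pre: "{x \<in> points (fst X). ccoalg_comp X k h x \<in> U} =
      {x \<in> points (fst X). h x \<in> {y \<in> points (fst Y). k y \<in> U}}" for U
    using PS_homD(2) [OF h'] by (auto simp: ccoalg_comp_def compose_eq)
  have cl: "{y \<in> points (fst Y). k y \<in> U} \<in> clopen_upsets (fst Y)" if "U \<in> clopen_upsets (fst Z)" for U
    by (rule clopen_upsets_preimage [OF k' that PSD(2) [OF ccoalgD(1) [OF Y]]])
  have "compose (points (fst X)) k h \<in> PS_hom (fst X) (fst Z)"
    by (rule PS_hom_compose [OF h' k' PSD(2) [OF ccoalgD(1) [OF X]]])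
  moreover have "(snd X x \<inter> {x \<in> points (fst X). ccoalg_comp X k h x \<in> U} \<noteq> {} \<longleftrightarrow>
        snd Z (ccoalg_comp X k h x) \<inter> U \<noteq> {}) \<and>
      (snd X x \<subseteq> {x \<in> points (fst X). ccoalg_comp X k h x \<in> U} \<longleftrightarrow> snd Z (ccoalg_comp X k h x) \<subseteq> U)"
    if x: "x \<in> points (fst X)" and U: "U \<in> clopen_upsets (fst Z)" for x U
  proof -
    have hx: "ccoalg_comp X k h x = k (h x)" "h x \<in> points (fst Y)"
      using x PS_homD(2) [OF h'] by (auto simp: ccoalg_comp_def compose_eq)
    show ?thesis
      unfolding pre hx(1) ccoalg_homD [OF X Y h x cl [OF U]] ccoalg_homD [OF Y Z k hx(2) U] by simp
  qed
  ultimately show ?thesis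
    by (simp add: ccoalg_hom_iff [OF X Z] ccoalg_comp_def)
qed

lemma ccoalg_isoI:
  assumes X: "ccoalg X" and Y: "ccoalg Y" and h: "h \<in> ccoalg_hom X Y"
    and bij: "bij_betw h (points (fst X)) (points (fst Y))"
    and reflect: "\<And>x y. \<lbrakk>x \<in> points (fst X); y \<in> points (fst X); (h x, h y) \<in> Ord (fst Y)\<rbrakk> \<Longrightarrow> (x, y) \<in> Ord (fst X)"
  shows "h \<in> ccoalg_iso X Y"
proof -
  note XP = ccoalgD(1) [OF X] and YP = ccoalgD(1) [OF Y]
  let ?k = "\<lambda>y\<in>points (fst Y). the_inv_into (points (fst X)) h y"
  have h': "h \<in> PS_hom (fst X) (fst Y)"
    using h by (auto simp: ccoalg_hom_def)
  have k': "?k \<in> PS_hom (fst Y) (fst X)"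
    by (rule PS_hom_inverse [OF XP YP h' bij reflect])
  define k where "k = ?k"
  have k'': "k \<in> PS_hom (fst Y) (fst X)"
    using k' by (simp add: k_def)
  have kh: "k (h x) = x" if "x \<in> points (fst X)" for x
    using that bij PS_homD(2) [OF h'] by (simp add: k_def bij_betw_def the_inv_into_f_f)
  have hk: "h (k y) = y" "k y \<in> points (fst X)" if "y \<in> points (fst Y)" for y
    using that bij PS_homD(2) [OF k''] by (simp_all add: k_def bij_betw_def f_the_inv_into_f)
  have "(snd Y y \<inter> {y \<in> points (fst Y). k y \<in> U} \<noteq> {} \<longleftrightarrow> snd X (k y) \<inter> U \<noteq> {}) \<and>
      (snd Y y \<subseteq> {y \<in> points (fst Y). k y \<in> U} \<longleftrightarrow> snd X (k y) \<subseteq> U)"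
    if y: "y \<in> points (fst Y)" and U: "U \<in> clopen_upsets (fst X)" for y U
  proof -
    let ?V = "{y \<in> points (fst Y). k y \<in> U}"
    have V: "?V \<in> clopen_upsets (fst Y)"
      by (rule clopen_upsets_preimage [OF k'' U PSD(2) [OF YP]])
    \<comment> \<open>The set \<open>?V\<close> is the preimage of \<open>U\<close> under
      \<open>k\<close>, and pulling it back along \<open>h\<close> returns \<open>U\<close>; so the
      condition on \<open>h\<close> at the point \<open>k y\<close> is the condition on
      \<open>k\<close> at \<open>y\<close>.\<close>
    have "{x \<in> points (fst X). h x \<in> ?V} = U"
      using clopen_upsetsD(3) [OF U] PS_homD(2) [OF h'] kh by auto
    moreover note ccoalg_homD [OF X Y h hk(2) [OF y] V]
    ultimately show ?thesis
      using hk(1) [OF y] by simp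
  qed
  then have "k \<in> ccoalg_hom Y X"
    using k'' by (simp add: ccoalg_hom_iff [OF Y X])
  moreover have "ccoalg_comp X k h = ccoalg_id X" "ccoalg_comp Y h k = ccoalg_id Y"
    using kh hk by (auto simp: ccoalg_comp_def ccoalg_id_def compose_def fun_eq_iff)
  ultimately show ?thesis
    using h unfolding ccoalg_iso_def by blast
qed


section \<open>Priestley duality on objects\<close>

text \<open>Alexander's subbase theorem speaks of unions of finite intersections of generators,
  relative to their union. That topology is identified with
  \<open>topology_generated_by \<B>\<close>, since each of the two is the coarsest one in which the
  generators are open.\<close>

lemma compact_generated:
  assumes fin: "\<And>\<C>. \<C> \<subseteq> \<B> \<Longrightarrow> \<Union>\<C> = \<Union>\<B> \<Longrightarrow> \<exists>\<F>. finite \<F> \<and> \<F> \<subseteq> \<C> \<and> \<Union>\<F> = \<Union>\<B>"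
  shows "compact_space (topology_generated_by \<B>)"
proof (rule Alexander_subbase [where \<B> = \<B>])
  let ?T = "topology (arbitrary union_of (finite intersection_of (\<lambda>x. x \<in> \<B>) relative_to \<Union>\<B>))"
  have "openin (topology_generated_by \<B>) S" if "openin ?T S" for S
  proof (rule minimal_topology_subbase [OF _ _ that])
    show "openin (topology_generated_by \<B>) S" if "S \<in> \<B>" for S
      using that by (rule topology_generated_by_Basis)
    show "openin (topology_generated_by \<B>) (\<Union>\<B>)"
      by (metis openin_topspace topology_generated_by_topspace)
  qed
  moreover have "openin ?T S" if "openin (topology_generated_by \<B>) S" for S
  proof (rule generate_topology_on_coarsest [OF _ _ openin_topology_generated_by [OF that]])
    show "istopology (openin ?T)"
      by (rule istopology_openin)
    show "openin ?T S" if "S \<in> \<B>" for S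
    proof -
      have "(finite intersection_of (\<lambda>x. x \<in> \<B>) relative_to \<Union>\<B>) (\<Union>\<B> \<inter> S)"
        using that by (intro relative_to_inc finite_intersection_of_inc)
      moreover have "\<Union>\<B> \<inter> S = S"
        using that by blast
      ultimately show ?thesis
        unfolding openin_subbase by (intro arbitrary_union_of_inc) simp
    qed
  qed
  ultimately show "?T = topology_generated_by \<B>"
    by (auto simp: topology_eq)
  show "\<exists>\<F>. finite \<F> \<and> \<F> \<subseteq> \<C> \<and> \<Union>\<F> = topspace (topology_generated_by \<B>)"
    if "\<C> \<subseteq> \<B>" "\<Union>\<C> = topspace (topology_generated_by \<B>)" for \<C>
    using fin [OF that(1)] that(2) by simp
qed

lemma dl_structure_dual_lattice:
  assumes "Ord X \<subseteq> points X \<times> points X"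
  shows "dl_structure (dual_lattice X) (\<union>) (\<inter>) {} (points X)"
  using clopen_upsets_points [OF assms]
  by unfold_locales (auto simp: dual_lattice_def clopen_upsets_Un clopen_upsets_Int dest: clopen_upsetsD(3))

lemma carrier_dual_lattice [simp]: "carrier (dual_lattice X) = clopen_upsets X"
  and le_dual_lattice [simp]: "U \<sqsubseteq>\<^bsub>dual_lattice X\<^esub> V \<longleftrightarrow> U \<subseteq> V"
  by (simp_all add: dual_lattice_def)

lemma dual_lattice_ops:
  assumes "Ord X \<subseteq> points X \<times> points X"
  shows "DL (dual_lattice X)" "\<bottom>\<^bsub>dual_lattice X\<^esub> = {}" "\<top>\<^bsub>dual_lattice X\<^esub> = points X"
    "\<lbrakk>U \<in> clopen_upsets X; V \<in> clopen_upsets X\<rbrakk> \<Longrightarrow> U \<squnion>\<^bsub>dual_lattice X\<^esub> V = U \<union> V"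
    "\<lbrakk>U \<in> clopen_upsets X; V \<in> clopen_upsets X\<rbrakk> \<Longrightarrow> U \<sqinter>\<^bsub>dual_lattice X\<^esub> V = U \<inter> V"
proof -
  interpret dl_structure "dual_lattice X" "(\<union>)" "(\<inter>)" "{}" "points X"
    by (rule dl_structure_dual_lattice [OF assms])
  show "DL (dual_lattice X)" "\<bottom>\<^bsub>dual_lattice X\<^esub> = {}" "\<top>\<^bsub>dual_lattice X\<^esub> = points X"
    by (rule DL bottom_eq top_eq)+
  show "U \<squnion>\<^bsub>dual_lattice X\<^esub> V = U \<union> V" "U \<sqinter>\<^bsub>dual_lattice X\<^esub> V = U \<inter> V"
    if "U \<in> clopen_upsets X" "V \<in> clopen_upsets X"
    using that by (simp_all add: join_eq meet_eq)
qed

section \<open>The representation of a lattice by its prime filters\<close>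

definition hat :: "'a gorder \<Rightarrow> 'a \<Rightarrow> 'a set set" where
  "hat L a = {p \<in> prime_filters L. a \<in> p}"

lemma in_hat [simp]: "p \<in> hat L a \<longleftrightarrow> p \<in> prime_filters L \<and> a \<in> p"
  by (simp add: hat_def)

lemma Ord_dual_space: "Ord (dual_space L) = {(p, q). p \<in> prime_filters L \<and> q \<in> prime_filters L \<and> p \<subseteq> q}"
  by (simp add: dual_space_def)

context dl
begin

lemma prime_filterD:
  assumes "p \<in> prime_filters L"
  shows "a \<in> p \<Longrightarrow> a \<in> carrier L" "\<top> \<in> p" "\<bottom> \<notin> p"
    "\<lbrakk>a \<in> p; a \<sqsubseteq> b; b \<in> carrier L\<rbrakk> \<Longrightarrow> b \<in> p"
    "\<lbrakk>a \<in> carrier L; b \<in> carrier L\<rbrakk> \<Longrightarrow> a \<sqinter> b \<in> p \<longleftrightarrow> a \<in> p \<and> b \<in> p"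
    "\<lbrakk>a \<in> carrier L; b \<in> carrier L\<rbrakk> \<Longrightarrow> a \<squnion> b \<in> p \<longleftrightarrow> a \<in> p \<or> b \<in> p"
proof -
  show c: "a \<in> p \<Longrightarrow> a \<in> carrier L" and "\<top> \<in> p" "\<bottom> \<notin> p"
    and up: "\<lbrakk>a \<in> p; a \<sqsubseteq> b; b \<in> carrier L\<rbrakk> \<Longrightarrow> b \<in> p" for a b
    using assms by (auto simp: prime_filters_def)
  show "a \<sqinter> b \<in> p \<longleftrightarrow> a \<in> p \<and> b \<in> p" "a \<squnion> b \<in> p \<longleftrightarrow> a \<in> p \<or> b \<in> p"
    if ab: "a \<in> carrier L" "b \<in> carrier L"
  proof -
    have "a \<in> p \<Longrightarrow> b \<in> p \<Longrightarrow> a \<sqinter> b \<in> p" "a \<squnion> b \<in> p \<Longrightarrow> a \<in> p \<or> b \<in> p"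
      using assms ab by (simp_all add: prime_filters_def)
    moreover have "a \<sqinter> b \<in> p \<Longrightarrow> a \<in> p" "a \<sqinter> b \<in> p \<Longrightarrow> b \<in> p"
      using up [OF _ meet_left [OF ab] ab(1)] up [OF _ meet_right [OF ab] ab(2)] by blast+
    moreover have "a \<in> p \<Longrightarrow> a \<squnion> b \<in> p" "b \<in> p \<Longrightarrow> a \<squnion> b \<in> p"
      using up [OF _ join_left [OF ab]] up [OF _ join_right [OF ab]] join_closed [OF ab] by metis+
    ultimately show "a \<sqinter> b \<in> p \<longleftrightarrow> a \<in> p \<and> b \<in> p" "a \<squnion> b \<in> p \<longleftrightarrow> a \<in> p \<or> b \<in> p"
      by metis+
  qed
qed

lemma hat_simps:
  "hat L \<bottom> = {}" "hat L \<top> = prime_filters L"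
  "\<lbrakk>a \<in> carrier L; b \<in> carrier L\<rbrakk> \<Longrightarrow> hat L (a \<squnion> b) = hat L a \<union> hat L b"
  "\<lbrakk>a \<in> carrier L; b \<in> carrier L\<rbrakk> \<Longrightarrow> hat L (a \<sqinter> b) = hat L a \<inter> hat L b"
  by (auto simp: prime_filterD(2,3,5,6))

lemma points_dual_space [simp]: "points (dual_space L) = prime_filters L"
proof
  \<comment> \<open>Every prime filter contains the top, so a single generator is already the whole
    space.\<close>
  have "hat L \<top> \<subseteq> points (dual_space L)"
    unfolding dual_space_def hat_def by simp (use top_closed in blast)
  then show "prime_filters L \<subseteq> points (dual_space L)"
    by (simp only: hat_simps)
qed (auto simp: dual_space_def)

lemma Ord_dual_space_sub: "Ord (dual_space L) \<subseteq> points (dual_space L) \<times> points (dual_space L)"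
  by (auto simp: Ord_dual_space)

lemma openin_hat: "a \<in> carrier L \<Longrightarrow> openin (Topo (dual_space L)) (hat L a)"
  and openin_not_hat: "a \<in> carrier L \<Longrightarrow> openin (Topo (dual_space L)) {p \<in> prime_filters L. a \<notin> p}"
  unfolding dual_space_def hat_def by (auto intro!: topology_generated_by_Basis)

lemma hat_clopen_upset: "a \<in> carrier L \<Longrightarrow> hat L a \<in> clopen_upsets (dual_space L)"
proof -
  assume a: "a \<in> carrier L"
  have "prime_filters L - hat L a = {p \<in> prime_filters L. a \<notin> p}"
    by auto
  moreover have "hat L a \<subseteq> prime_filters L"
    by auto
  ultimately have "closedin (Topo (dual_space L)) (hat L a)"
    using openin_not_hat [OF a] openin_hat [OF a] by (simp add: closedin_def openin_subset)
  moreover have "up (dual_space L) (hat L a) \<subseteq> hat L a"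
    unfolding up_def Ord_dual_space by auto
  ultimately show ?thesis
    using openin_hat [OF a] by (simp add: clopen_upsets_def)
qed

text \<open>A cover by subbasic sets without finite subcover yields a disjoint filter and ideal (the
  elements whose complement, respectively whose image under \<^const>\<open>hat\<close>, is finitely covered), and a
  prime filter between them is not covered.\<close>

lemma compact_dual_space: "compact_space (Topo (dual_space L))"
proof -
  let ?B = "{hat L a |a. a \<in> carrier L} \<union> {{p \<in> prime_filters L. a \<notin> p} |a. a \<in> carrier L}"
  have T: "Topo (dual_space L) = topology_generated_by ?B"
    by (simp add: dual_space_def hat_def)
  have B: "\<Union>?B = prime_filters L"
    using points_dual_space unfolding T by (simp only: topology_generated_by_topspace)
  have "\<exists>\<F>. finite \<F> \<and> \<F> \<subseteq> \<C> \<and> \<Union>\<F> = prime_filters L"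
    if sub: "\<C> \<subseteq> ?B" and cov: "\<Union>\<C> = prime_filters L" for \<C>
  proof -
    define fc where "fc S \<longleftrightarrow> (\<exists>\<F>. finite \<F> \<and> \<F> \<subseteq> \<C> \<and> S \<subseteq> \<Union>\<F>)" for S
    have fc_mono: "fc T" if "fc S" "T \<subseteq> S" for S T
      using that unfolding fc_def by (meson order_trans)
    have fc_Un: "fc (S \<union> T)" if ST: "fc S" "fc T" for S T
    proof -
      obtain \<F> \<G> where "finite \<F>" "\<F> \<subseteq> \<C>" "S \<subseteq> \<Union>\<F>" "finite \<G>" "\<G> \<subseteq> \<C>" "T \<subseteq> \<Union>\<G>"
        using ST unfolding fc_def by blast
      then show ?thesis
        unfolding fc_def by (intro exI [of _ "\<F> \<union> \<G>"]) auto
    qed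
    have fc_empty: "fc {}"
      unfolding fc_def by (intro exI [of _ "{}"]) simp
    have fc_in: "fc S" if "S \<in> \<C>" for S
      unfolding fc_def by (intro exI [of _ "{S}"]) (use that in simp)
    define F where "F = {a \<in> carrier L. fc {p \<in> prime_filters L. a \<notin> p}}"
    define I where "I = {a \<in> carrier L. fc (hat L a)}"
    have F: "is_filter L F"
      unfolding is_filter_def
    proof (intro conjI ballI impI)
      show "F \<subseteq> carrier L"
        by (auto simp: F_def)
      have "{p \<in> prime_filters L. \<top> \<notin> p} = {}"
        by (auto simp: prime_filterD(2))
      with fc_empty have "fc {p \<in> prime_filters L. \<top> \<notin> p}"
        by (simp only:)
      then show "\<top> \<in> F"
        unfolding F_def by simp
    next
      fix a b assume "a \<in> F" "b \<in> carrier L" "a \<sqsubseteq> b"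
      moreover from this have "{p \<in> prime_filters L. b \<notin> p} \<subseteq> {p \<in> prime_filters L. a \<notin> p}"
        by (auto dest: prime_filterD(4))
      ultimately show "b \<in> F"
        unfolding F_def by (auto intro: fc_mono)
    next
      fix a b assume ab: "a \<in> F" "b \<in> F"
      then have "{p \<in> prime_filters L. a \<sqinter> b \<notin> p} = {p \<in> prime_filters L. a \<notin> p} \<union> {p \<in> prime_filters L. b \<notin> p}"
        by (auto simp: F_def prime_filterD(5))
      with ab show "a \<sqinter> b \<in> F"
        unfolding F_def by (simp add: fc_Un)
    qed
    have I: "is_ideal L I"
      unfolding is_ideal_def
    proof (intro conjI ballI impI)
      show "I \<subseteq> carrier L"
        by (auto simp: I_def)
      show "\<bottom> \<in> I"
        unfolding I_def using fc_empty by (simp add: hat_simps)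
    next
      fix a b assume "a \<in> I" "b \<in> carrier L" "b \<sqsubseteq> a"
      moreover from this have "hat L b \<subseteq> hat L a"
        by (auto dest: prime_filterD(4) simp: I_def)
      ultimately show "b \<in> I"
        unfolding I_def by (auto intro: fc_mono)
    next
      fix a b assume "a \<in> I" "b \<in> I"
      then show "a \<squnion> b \<in> I"
        unfolding I_def by (simp add: fc_Un hat_simps)
    qed
    have "F \<inter> I \<noteq> {}"
    proof
      assume "F \<inter> I = {}"
      then obtain p where p: "p \<in> prime_filters L" "F \<subseteq> p" "p \<inter> I = {}"
        using prime_filter_theorem [OF F I] by blast
      with cov obtain S where S: "S \<in> \<C>" "p \<in> S"
        by blast
      with sub obtain a where a: "a \<in> carrier L" "S = hat L a \<or> S = {p \<in> prime_filters L. a \<notin> p}"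
        by blast
      then have "a \<in> p \<and> a \<in> I \<or> a \<notin> p \<and> a \<in> F"
        using fc_in [OF S(1)] S(2) by (auto simp: F_def I_def)
      with p show False
        by blast
    qed
    \<comment> \<open>For an element of both sets, \<open>hat L a\<close> and its complement are
      finitely covered, and together they exhaust the space.\<close>
    then obtain a where "fc (hat L a)" "fc {p \<in> prime_filters L. a \<notin> p}"
      by (auto simp: F_def I_def)
    then have "fc (prime_filters L)"
      by (rule fc_mono [OF fc_Un]) auto
    then obtain \<F> where "finite \<F>" "\<F> \<subseteq> \<C>" "prime_filters L \<subseteq> \<Union>\<F>"
      unfolding fc_def by blast
    with cov show ?thesis
      by (intro exI [of _ \<F>]) blast
  qed
  then show ?thesis
    unfolding T by (intro compact_generated) (simp only: B)
qed

lemma PS_dual_space: "PS (dual_space L)"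
  unfolding PS_def
proof (intro conjI ballI impI)
  show "compact_space (Topo (dual_space L))"
    by (rule compact_dual_space)
  show "partial_order_on (points (dual_space L)) (Ord (dual_space L))"
    by (auto simp: partial_order_on_def preorder_on_def refl_on_def trans_def antisym_def Ord_dual_space)
  fix p q assume "p \<in> points (dual_space L)" "q \<in> points (dual_space L)" "(p, q) \<notin> Ord (dual_space L)"
  then obtain a where "p \<in> prime_filters L" "a \<in> p" "a \<notin> q"
    by (auto simp: Ord_dual_space)
  then show "\<exists>U\<in>clopen_upsets (dual_space L). p \<in> U \<and> q \<notin> U"
    using prime_filterD(1) by (intro bexI [of _ "hat L a"] hat_clopen_upset) auto
qed

text \<open>The generators of the dual topology are the sets \<open>hat L a\<close> and their
  complements, and the order is inclusion of prime filters; so continuity and monotonicity can both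
  be read off from the sets of points \<open>z\<close> with \<open>a \<in> f z\<close>.\<close>

lemma PS_hom_dual_spaceI:
  assumes Z: "Ord Z \<subseteq> points Z \<times> points Z" and f: "f \<in> points Z \<rightarrow>\<^sub>E prime_filters L"
    and pre: "\<And>a. a \<in> carrier L \<Longrightarrow> {z \<in> points Z. a \<in> f z} \<in> clopen_upsets Z"
  shows "f \<in> PS_hom Z (dual_space L)"
proof -
  let ?S = "{{p \<in> prime_filters L. a \<in> p} |a. a \<in> carrier L} \<union> {{p \<in> prime_filters L. a \<notin> p} |a. a \<in> carrier L}"
  have fz: "f z \<in> prime_filters L" if "z \<in> points Z" for z
    using f that by (rule PiE_mem)
  have T: "Topo (dual_space L) = topology_generated_by ?S"
    by (simp add: dual_space_def)
  have "\<Union>?S = prime_filters L"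
    using points_dual_space unfolding T by (simp only: topology_generated_by_topspace)
  then have "f ` points Z \<subseteq> \<Union>?S"
    using fz by auto
  moreover have "openin (Topo Z) (f -` S \<inter> points Z)" if S: "S \<in> ?S" for S
  proof -
    obtain a where a: "a \<in> carrier L" "S = {p \<in> prime_filters L. a \<in> p} \<or> S = {p \<in> prime_filters L. a \<notin> p}"
      using S by blast
    have "f -` {p \<in> prime_filters L. a \<in> p} \<inter> points Z = {z \<in> points Z. a \<in> f z}"
      "f -` {p \<in> prime_filters L. a \<notin> p} \<inter> points Z = points Z - {z \<in> points Z. a \<in> f z}"
      using fz by auto
    then show ?thesis
      using a(2) clopen_upsetsD(1,2) [OF pre [OF a(1)]] by (elim disjE) auto
  qed
  ultimately have "continuous_map (Topo Z) (Topo (dual_space L)) f"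
    unfolding T continuous_on_generated_topo_iff by blast
  moreover have "(f x, f y) \<in> Ord (dual_space L)" if xy: "(x, y) \<in> Ord Z" for x y
  proof -
    have p: "x \<in> points Z" "y \<in> points Z"
      using xy Z by auto
    have "a \<in> f y" if a: "a \<in> f x" for a
      using clopen_upsetsD(4) [OF pre _ xy] prime_filterD(1) [OF fz [OF p(1)] a] a p by blast
    then show ?thesis
      using fz p by (auto simp: Ord_dual_space)
  qed
  ultimately show ?thesis
    using f by (auto simp: PS_hom_def)
qed

text \<open>A clopen upset and its complement are compact, and no point of the first lies below a
  point of the second. Separating them with the lattice of sets \<open>hat L a\<close>, in place of
  all clopen upsets, produces a separating set that must equal \<open>U\<close>.\<close>

lemma clopen_upsets_dual_space: "clopen_upsets (dual_space L) = hat L ` carrier L"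
proof
  show "hat L ` carrier L \<subseteq> clopen_upsets (dual_space L)"
    using hat_clopen_upset by blast
  show "clopen_upsets (dual_space L) \<subseteq> hat L ` carrier L"
  proof
    let ?X = "dual_space L"
    fix U assume U: "U \<in> clopen_upsets ?X"
    have "closedin (Topo ?X) U" "closedin (Topo ?X) (points ?X - U)"
      using clopen_upsetsD(1,2) [OF U] by (auto simp del: points_dual_space)
    then have cpt: "compactin (Topo ?X) U" "compactin (Topo ?X) (points ?X - U)"
      using closedin_compact_space [OF compact_dual_space] by blast+
    have "\<exists>V\<in>hat L ` carrier L. U \<subseteq> V \<and> V \<inter> (points ?X - U) = {}"
    proof (rule compact_separation [OF _ _ _ _ _ _ cpt])
      show "hat L ` carrier L \<subseteq> clopen_upsets ?X"
        using hat_clopen_upset by blast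
      show "{} \<in> hat L ` carrier L" "points ?X \<in> hat L ` carrier L"
        using hat_simps(1,2) bottom_closed top_closed by (metis image_eqI points_dual_space)+
      show "V \<inter> W \<in> hat L ` carrier L" "V \<union> W \<in> hat L ` carrier L"
        if "V \<in> hat L ` carrier L" "W \<in> hat L ` carrier L" for V W
        using that hat_simps(3,4) by (auto simp flip: hat_simps(3,4))
      show "\<exists>V\<in>hat L ` carrier L. p \<in> V \<and> q \<notin> V"
        if pq: "p \<in> points ?X" "q \<in> points ?X" "(p, q) \<notin> Ord ?X" for p q
      proof -
        obtain a where "a \<in> p" "a \<notin> q"
          using pq by (auto simp: Ord_dual_space)
        then show ?thesis
          using pq prime_filterD(1) [of p a] by (intro bexI [of _ "hat L a"]) auto
      qed
      show "(p, q) \<notin> Ord ?X" if "p \<in> U" "q \<in> points ?X - U" for p q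
        using that clopen_upsetsD(4) [OF U] by blast
    qed
    then obtain V where V: "V \<in> hat L ` carrier L" "U \<subseteq> V" "V \<inter> (points ?X - U) = {}"
      by blast
    then have "V = U"
      by auto
    with V(1) show "U \<in> hat L ` carrier L"
      by simp
  qed
qed

end


section \<open>The dual of an algebra\<close>

lemma kalg_dual_simps [simp]: "fst (kalg_dual A) = dual_space (fst A)"
  by (simp add: kalg_dual_def)

context kalgebra
begin

text \<open>In positive modal logic this is the canonical accessibility relation, given as the set
  of successors of \<open>p\<close>.\<close>

definition succ :: "'a set \<Rightarrow> 'a set set" where
  "succ p = {p' \<in> prime_filters L. \<forall>a\<in>carrier L. (b a \<in> p \<longrightarrow> a \<in> p') \<and> (a \<in> p' \<longrightarrow> d a \<in> p)}"

lemma snd_kalg_dual: "snd (kalg_dual A) = (\<lambda>p\<in>prime_filters L. succ p)"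
  by (auto simp: kalg_dual_def succ_def b_def d_def)

text \<open>The operator \<open>b\<close> preserves finite meets, so its inverse image of a filter
  is a filter.\<close>

lemma filter_b:
  assumes "p \<in> prime_filters L"
  shows "is_filter L {a \<in> carrier L. b a \<in> p}"
proof -
  have "b y \<in> p" if "x \<in> carrier L" "b x \<in> p" "y \<in> carrier L" "x \<sqsubseteq>\<^bsub>L\<^esub> y" for x y
    using prime_filterD(4) [OF assms that(2) b_mono] that by simp
  then show ?thesis
    using prime_filterD(2,5) [OF assms] by (simp add: is_filter_def b_top b_meet) blast
qed

text \<open>The complement of a prime filter is an ideal, and \<open>d\<close> preserves finite
  joins.\<close>

lemma ideal_d:
  assumes "p \<in> prime_filters L"
  shows "is_ideal L {a \<in> carrier L. d a \<notin> p}"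
proof -
  have "d x \<in> p" if "x \<in> carrier L" "d y \<in> p" "y \<in> carrier L" "y \<sqsubseteq>\<^bsub>L\<^esub> x" for x y
    using prime_filterD(4) [OF assms that(2) d_mono] that by simp
  then show ?thesis
    using prime_filterD(3,6) [OF assms] by (auto simp: is_ideal_def d_bottom d_join)
qed

text \<open>A successor containing \<open>a\<close> must contain the filter of
  \<open>filter_b\<close> and avoid the ideal of \<open>ideal_d\<close>. An obstruction
  \<open>x \<sqinter> a \<sqsubseteq> z\<close> would give \<open>b x \<sqinter> d a \<sqsubseteq> d
  (x \<sqinter> a) \<sqsubseteq> d z\<close> and so put \<open>d z\<close> into \<open>p\<close>.
  The first inequality is the mixed relation for meets.\<close>

lemma succ_dia:
  assumes p: "p \<in> prime_filters L" and a: "a \<in> carrier L"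
  shows "succ p \<inter> hat L a \<noteq> {} \<longleftrightarrow> d a \<in> p"
proof
  assume da: "d a \<in> p"
  obtain p' where "p' \<in> prime_filters L" "{a \<in> carrier L. b a \<in> p} \<subseteq> p'" "{c \<in> carrier L. a \<sqsubseteq>\<^bsub>L\<^esub> c} \<subseteq> p'"
      "p' \<inter> {a \<in> carrier L. d a \<notin> p} = {}"
  \<comment> \<open>The ideal generated by the bottom fills the last slot and demands no more than
    properness.\<close>
  proof (rule prime_filter_between [OF filter_b [OF p] filter_principal [OF a] ideal_d [OF p]
        ideal_principal [OF bottom_closed]])
    fix x y z w
    assume "x \<in> {a \<in> carrier L. b a \<in> p}" "y \<in> {c \<in> carrier L. a \<sqsubseteq>\<^bsub>L\<^esub> c}" "z \<in> {a \<in> carrier L. d a \<notin> p}"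
      "w \<in> {c \<in> carrier L. c \<sqsubseteq>\<^bsub>L\<^esub> \<bottom>\<^bsub>L\<^esub>}" and le: "x \<sqinter>\<^bsub>L\<^esub> y \<sqsubseteq>\<^bsub>L\<^esub> z \<squnion>\<^bsub>L\<^esub> w"
    then have *: "x \<in> carrier L" "b x \<in> p" "y \<in> carrier L" "a \<sqsubseteq>\<^bsub>L\<^esub> y" "z \<in> carrier L" "d z \<notin> p" "w = \<bottom>\<^bsub>L\<^esub>"
      using antisymm [of w "\<bottom>\<^bsub>L\<^esub>"] by auto
    have "x \<sqinter>\<^bsub>L\<^esub> a \<sqsubseteq>\<^bsub>L\<^esub> x \<sqinter>\<^bsub>L\<^esub> y"
      using * a by (intro meet_mono) auto
    then have "x \<sqinter>\<^bsub>L\<^esub> a \<sqsubseteq>\<^bsub>L\<^esub> z"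
      using le * a le_trans [of "x \<sqinter>\<^bsub>L\<^esub> a" "x \<sqinter>\<^bsub>L\<^esub> y" z] by simp
    then have "d (x \<sqinter>\<^bsub>L\<^esub> a) \<sqsubseteq>\<^bsub>L\<^esub> d z"
      using * a by (intro d_mono) auto
    then have "b x \<sqinter>\<^bsub>L\<^esub> d a \<sqsubseteq>\<^bsub>L\<^esub> d z"
      using b_d_le [of x a] * a le_trans [of "b x \<sqinter>\<^bsub>L\<^esub> d a" "d (x \<sqinter>\<^bsub>L\<^esub> a)" "d z"] by simp
    moreover have "b x \<sqinter>\<^bsub>L\<^esub> d a \<in> p"
      using * a da prime_filterD(5) [OF p] by simp
    ultimately show False
      using prime_filterD(4) [OF p] * by fastforce
  qed blast
  then have "p' \<in> succ p" "p' \<in> hat L a"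
    using a by (auto simp: succ_def)
  then show "succ p \<inter> hat L a \<noteq> {}"
    by blast
qed (use a in \<open>auto simp: succ_def\<close>)

text \<open>If \<open>b a\<close> is not in \<open>p\<close>, there is a successor avoiding
  \<open>a\<close>: an obstruction \<open>x \<sqsubseteq> a \<squnion> z\<close> would give \<open>b
  x \<sqsubseteq> b (a \<squnion> z) \<sqsubseteq> b a \<squnion> d z\<close>, and primeness would
  put \<open>b a\<close> or \<open>d z\<close> into \<open>p\<close>. The second inequality is the
  mixed relation for joins.\<close>

lemma succ_box:
  assumes p: "p \<in> prime_filters L" and a: "a \<in> carrier L"
  shows "succ p \<subseteq> hat L a \<longleftrightarrow> b a \<in> p"
proof
  show "succ p \<subseteq> hat L a" if "b a \<in> p"
    using that a by (auto simp: succ_def)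
  show "b a \<in> p" if sub: "succ p \<subseteq> hat L a"
  proof (rule ccontr)
    assume ba: "b a \<notin> p"
    obtain p' where "p' \<in> prime_filters L" "{a \<in> carrier L. b a \<in> p} \<subseteq> p'"
        "p' \<inter> {a \<in> carrier L. d a \<notin> p} = {}" "p' \<inter> {c \<in> carrier L. c \<sqsubseteq>\<^bsub>L\<^esub> a} = {}"
    \<comment> \<open>Here \<open>a\<close> is prescribed on the side of the ideals, so the filter
      generated by the top fills the second slot.\<close>
    proof (rule prime_filter_between [OF filter_b [OF p] filter_principal [OF top_closed] ideal_d [OF p]
          ideal_principal [OF a]])
      fix x y z w
      assume "x \<in> {a \<in> carrier L. b a \<in> p}" "y \<in> {c \<in> carrier L. \<top>\<^bsub>L\<^esub> \<sqsubseteq>\<^bsub>L\<^esub> c}" "z \<in> {a \<in> carrier L. d a \<notin> p}"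
        "w \<in> {c \<in> carrier L. c \<sqsubseteq>\<^bsub>L\<^esub> a}" and le: "x \<sqinter>\<^bsub>L\<^esub> y \<sqsubseteq>\<^bsub>L\<^esub> z \<squnion>\<^bsub>L\<^esub> w"
      then have *: "x \<in> carrier L" "b x \<in> p" "y = \<top>\<^bsub>L\<^esub>" "z \<in> carrier L" "d z \<notin> p" "w \<in> carrier L" "w \<sqsubseteq>\<^bsub>L\<^esub> a"
        using antisymm [of y "\<top>\<^bsub>L\<^esub>"] by auto
      have "z \<squnion>\<^bsub>L\<^esub> w \<sqsubseteq>\<^bsub>L\<^esub> a \<squnion>\<^bsub>L\<^esub> z"
        using * a le_trans [of w a "a \<squnion>\<^bsub>L\<^esub> z"] by (intro join_le) (auto simp: join_left join_right)
      then have "x \<sqsubseteq>\<^bsub>L\<^esub> a \<squnion>\<^bsub>L\<^esub> z"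
        using le * a le_trans [of x "z \<squnion>\<^bsub>L\<^esub> w" "a \<squnion>\<^bsub>L\<^esub> z"] by simp
      then have "b x \<sqsubseteq>\<^bsub>L\<^esub> b (a \<squnion>\<^bsub>L\<^esub> z)"
        using * a by (intro b_mono) auto
      then have "b x \<sqsubseteq>\<^bsub>L\<^esub> b a \<squnion>\<^bsub>L\<^esub> d z"
        using b_join_le [of a z] * a le_trans [of "b x" "b (a \<squnion>\<^bsub>L\<^esub> z)" "b a \<squnion>\<^bsub>L\<^esub> d z"] by simp
      then have "b a \<squnion>\<^bsub>L\<^esub> d z \<in> p"
        using prime_filterD(4) [OF p *(2)] * a by simp
      then show False
        using prime_filterD(6) [OF p, of "b a" "d z"] * a ba by simp
    qed blast
    then have "p' \<in> succ p" "a \<notin> p'"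
      using a by (auto simp: succ_def)
    with sub show False
      by auto
  qed
qed

text \<open>Each condition on \<open>p'\<close> requires or forbids a single element, so the
  complement is a union of generators. A prime filter between two successors inherits the required
  elements from the lower one and the forbidden elements from the upper one.\<close>

lemma succ_convex_closed:
  "succ p \<in> convex_closed (dual_space L)"
proof -
  let ?\<U> = "{{p' \<in> prime_filters L. a \<notin> p'} |a. a \<in> carrier L \<and> b a \<in> p} \<union>
    {hat L a |a. a \<in> carrier L \<and> d a \<notin> p}"
  have "points (dual_space L) - succ p = \<Union>?\<U>"
    by (auto simp: succ_def)
  moreover have "openin (Topo (dual_space L)) (\<Union>?\<U>)"
    by (rule openin_Union) (auto simp: openin_hat openin_not_hat)
  ultimately have "closedin (Topo (dual_space L)) (succ p)"
    by (auto simp: closedin_def succ_def)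
  then show ?thesis
    by (auto simp: convex_closed_def Ord_dual_space succ_def)
qed

text \<open>By \<open>succ_dia\<close> and \<open>succ_box\<close> the two preimages belonging to
  \<open>hat L a\<close> are \<open>hat L (d a)\<close> and \<open>hat L (b a)\<close>, so the
  criterion for maps into \<C> applies.\<close>

lemma kalg_dual_ccoalg: "ccoalg (kalg_dual A)"
  unfolding ccoalg_def kalg_dual_simps PS_hom_C_iff [OF PS_dual_space Ord_dual_space_sub]
proof (intro conjI ballI PS_dual_space)
  show "snd (kalg_dual A) \<in> points (dual_space L) \<rightarrow>\<^sub>E convex_closed (dual_space L)"
    using succ_convex_closed by (simp add: snd_kalg_dual)
  fix U assume "U \<in> clopen_upsets (dual_space L)"
  then obtain a where a: "a \<in> carrier L" "U = hat L a"
    by (auto simp: clopen_upsets_dual_space)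
  have "{p \<in> points (dual_space L). snd (kalg_dual A) p \<inter> U \<noteq> {}} = hat L (d a)"
    using a succ_dia by (auto simp: snd_kalg_dual)
  then show "{p \<in> points (dual_space L). snd (kalg_dual A) p \<inter> U \<noteq> {}} \<in> clopen_upsets (dual_space L)"
    using a hat_clopen_upset by simp
  have "{p \<in> points (dual_space L). snd (kalg_dual A) p \<subseteq> U} = hat L (b a)"
    using a succ_box by (auto simp: snd_kalg_dual)
  then show "{p \<in> points (dual_space L). snd (kalg_dual A) p \<subseteq> U} \<in> clopen_upsets (dual_space L)"
    using a hat_clopen_upset by simp
qed

end

section \<open>Dual maps of algebra homomorphisms\<close>

lemma prime_filter_preimage:
  assumes "DL L" "DL M" and h: "h \<in> DL_hom L M" and p: "p \<in> prime_filters M"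
  shows "{a \<in> carrier L. h a \<in> p} \<in> prime_filters L"
proof -
  interpret L: dl L by standard fact
  interpret M: dl M by standard fact
  have "h b \<in> p" if "a \<in> carrier L" "h a \<in> p" "b \<in> carrier L" "a \<sqsubseteq>\<^bsub>L\<^esub> b" for a b
    using M.prime_filterD(4) [OF p that(2) DL_hom_le [OF h assms(1,2)]] that DL_homD(2) [OF h] by simp
  then have "\<forall>a. a \<in> carrier L \<and> h a \<in> p \<longrightarrow> (\<forall>b\<in>carrier L. a \<sqsubseteq>\<^bsub>L\<^esub> b \<longrightarrow> h b \<in> p)"
    by blast
  then show ?thesis
    using M.prime_filterD(2,3,5,6) [OF p] DL_homD(2-6) [OF h] by (simp add: prime_filters_def)
qed

lemma kalg_dual_map_PS_hom:
  assumes A: "kalg A" and B: "kalg B" and h: "h \<in> DL_hom (fst A) (fst B)"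
  shows "kalg_dual_map A B h \<in> PS_hom (dual_space (fst B)) (dual_space (fst A))"
proof -
  interpret A: kalgebra A by standard fact
  interpret B: kalgebra B by standard fact
  let ?f = "kalg_dual_map A B h"
  show ?thesis
  proof (rule A.PS_hom_dual_spaceI [OF B.Ord_dual_space_sub])
    show "?f \<in> points (dual_space (fst B)) \<rightarrow>\<^sub>E prime_filters (fst A)"
      using prime_filter_preimage [OF A.DL B.DL h] by (auto simp: kalg_dual_map_def)
    fix a assume a: "a \<in> carrier (fst A)"
    then have "{p \<in> points (dual_space (fst B)). a \<in> ?f p} = hat (fst B) (h a)"
      by (auto simp: kalg_dual_map_def)
    then show "{p \<in> points (dual_space (fst B)). a \<in> ?f p} \<in> clopen_upsets (dual_space (fst B))"
      using B.hat_clopen_upset [OF DL_homD(2) [OF h a]] by simp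
  qed
qed

text \<open>Tested on the clopen upset \<open>hat (fst A) a\<close>, both sides become membership in
  \<open>p\<close>: of \<open>B.d (h a)\<close> on one side and of \<open>h (A.d a)\<close> on the
  other, and likewise for \<open>b\<close>.\<close>

lemma kalg_dual_map_hom:
  assumes A: "kalg A" and B: "kalg B" and h: "h \<in> kalg_hom A B"
  shows "kalg_dual_map A B h \<in> ccoalg_hom (kalg_dual B) (kalg_dual A)"
proof -
  interpret A: kalgebra A by standard fact
  interpret B: kalgebra B by standard fact
  let ?f = "kalg_dual_map A B h"
  have h': "h \<in> DL_hom (fst A) (fst B)"
    using h by (simp add: kalg_hom_iff [OF A B])
  have hd: "h (A.d a) = B.d (h a)" and hb: "h (A.b a) = B.b (h a)" if "a \<in> carrier (fst A)" for a
    using h that by (auto simp: kalg_hom_iff [OF A B] A.d_def B.d_def A.b_def B.b_def)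
  note f = kalg_dual_map_PS_hom [OF A B h']
  have "(snd (kalg_dual B) p \<inter> {p \<in> prime_filters (fst B). ?f p \<in> U} \<noteq> {} \<longleftrightarrow> snd (kalg_dual A) (?f p) \<inter> U \<noteq> {}) \<and>
      (snd (kalg_dual B) p \<subseteq> {p \<in> prime_filters (fst B). ?f p \<in> U} \<longleftrightarrow> snd (kalg_dual A) (?f p) \<subseteq> U)"
    if p: "p \<in> prime_filters (fst B)" and U: "U \<in> clopen_upsets (dual_space (fst A))" for p U
  proof -
    obtain a where a: "a \<in> carrier (fst A)" "U = hat (fst A) a"
      using U by (auto simp: A.clopen_upsets_dual_space)
    have ha: "h a \<in> carrier (fst B)"
      using DL_homD(2) [OF h' a(1)] .
    have fp: "?f p \<in> prime_filters (fst A)" "?f p = {a \<in> carrier (fst A). h a \<in> p}"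
      if "p \<in> prime_filters (fst B)" for p
      using PS_homD(2) [OF f, of p] that by (simp_all add: kalg_dual_map_def)
    have pre: "{p \<in> prime_filters (fst B). ?f p \<in> U} = hat (fst B) (h a)"
      using fp a by auto
    show ?thesis
      unfolding pre using B.succ_dia [OF p ha] B.succ_box [OF p ha] A.succ_dia [OF fp(1) [OF p] a(1)]
        A.succ_box [OF fp(1) [OF p] a(1)] p fp [OF p] hd [OF a(1)] hb [OF a(1)] a
      by (simp add: A.snd_kalg_dual B.snd_kalg_dual)
  qed
  then show ?thesis
    using f by (simp add: ccoalg_hom_iff [OF B.kalg_dual_ccoalg A.kalg_dual_ccoalg])
qed

lemma kalg_dual_map_id: "kalg A \<Longrightarrow> kalg_dual_map A A (kalg_id A) = ccoalg_id (kalg_dual A)"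
proof -
  assume "kalg A"
  then interpret A: kalgebra A by unfold_locales
  show ?thesis
    unfolding kalg_dual_map_def ccoalg_id_def
    by (auto simp: kalg_id_def fun_eq_iff dest: A.prime_filterD(1) intro!: restrict_ext)
qed

lemma kalg_dual_map_comp:
  assumes A: "kalg A" and B: "kalg B" and D: "kalg D" and h: "h \<in> kalg_hom A B" and k: "k \<in> kalg_hom B D"
  shows "kalg_dual_map A D (kalg_comp A k h) =
    ccoalg_comp (kalg_dual D) (kalg_dual_map A B h) (kalg_dual_map B D k)"
proof -
  interpret B: kalgebra B by standard fact
  interpret D: kalgebra D by standard fact
  have h': "h \<in> DL_hom (fst A) (fst B)" and k': "k \<in> DL_hom (fst B) (fst D)"
    using h k by (auto simp: kalg_hom_def)
  have "{b \<in> carrier (fst B). k b \<in> p} \<in> prime_filters (fst B)" if "p \<in> prime_filters (fst D)" for p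
    by (rule prime_filter_preimage [OF B.DL D.DL k' that])
  then show ?thesis
    using DL_homD(2) [OF h']
    by (auto simp: kalg_dual_map_def ccoalg_comp_def kalg_comp_def compose_def fun_eq_iff)
qed


section \<open>The dual of a coalgebra\<close>

lemma ccoalg_dual_simps [simp]: "fst (ccoalg_dual X) = dual_lattice (fst X)"
  by (simp add: ccoalg_dual_def)

locale ccoalgebra =
  fixes X :: "'a ccoalg"
  assumes ccoalg: "ccoalg X"
begin

lemmas PS = ccoalgD(1) [OF ccoalg]
lemmas ops = dual_lattice_ops [OF PSD(2) [OF PS]]

abbreviation L where "L \<equiv> dual_lattice (fst X)"

lemma succ_points: "x \<in> points (fst X) \<Longrightarrow> snd X x \<subseteq> points (fst X)"
  using convex_closedD(2) [OF ccoalgD(3) [OF ccoalg]] .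

lemma kinterp_closed: "t \<in> kterms L \<Longrightarrow> kinterp (fst X) (snd X) t \<in> clopen_upsets (fst X)"
  by (induction rule: kterm_induct)
    (use ccoalgD(4,5) [OF ccoalg] clopen_upsets_points [OF PSD(2) [OF PS]]
      in \<open>simp_all add: clopen_upsets_Int clopen_upsets_Un\<close>)

text \<open>Soundness of the relations: meeting a set and being contained in a set obey the diamond
  and box laws by pure set theory. The two rules about the top also use that interpretations and
  successor sets stay inside the space.\<close>

lemma kinterp_mono: "kle L s t \<Longrightarrow> kinterp (fst X) (snd X) s \<subseteq> kinterp (fst X) (snd X) t"
proof (induction rule: kle.induct)
  case (kle_top t)
  then show ?case
    using clopen_upsetsD(3) [OF kinterp_closed] by simp
next
  case box_top
  then show ?case
    using succ_points by (auto simp: ops)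
qed (auto simp: ops)

text \<open>Equivalent terms have equal interpretations, so the image of a class under
  \<open>kinterp\<close> is a singleton, from which \<open>the_elem\<close> takes the
  element.\<close>

lemma snd_ccoalg_dual:
  assumes "t \<in> kterms L"
  shows "snd (ccoalg_dual X) (kclass L t) = kinterp (fst X) (snd X) t"
proof -
  have "kinterp (fst X) (snd X) s = kinterp (fst X) (snd X) t" if "s \<in> kclass L t" for s
    using that kinterp_mono by (auto simp: kclass_iff)
  then have "kinterp (fst X) (snd X) ` kclass L t = (\<lambda>_. kinterp (fst X) (snd X) t) ` kclass L t"
    by (rule image_cong [OF refl])
  also have "\<dots> = {kinterp (fst X) (snd X) t}"
    using kclass_self [OF assms] by (rule image_constant)
  finally have "kinterp (fst X) (snd X) ` kclass L t = {kinterp (fst X) (snd X) t}" .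
  then show ?thesis
    using kclass_closed [OF assms] by (simp add: ccoalg_dual_def)
qed

lemma ccoalg_dual_kalg: "kalg (ccoalg_dual X)"
  unfolding kalg_def ccoalg_dual_simps
proof
  show "DL L"
    by (rule ops)
  show "snd (ccoalg_dual X) \<in> DL_hom (K L) L"
    by (rule K_homI [where e = "kinterp (fst X) (snd X)"])
      (simp_all add: snd_ccoalg_dual kinterp_closed ops, simp add: ccoalg_dual_def)
qed

sublocale dual: kalgebra "ccoalg_dual X"
  by unfold_locales (rule ccoalg_dual_kalg)

lemma dual_d: "U \<in> clopen_upsets (fst X) \<Longrightarrow> dual.d U = {x \<in> points (fst X). snd X x \<inter> U \<noteq> {}}"
  and dual_b: "U \<in> clopen_upsets (fst X) \<Longrightarrow> dual.b U = {x \<in> points (fst X). snd X x \<subseteq> U}"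
  by (simp_all add: dual.d_def dual.b_def dia_eq_kclass box_eq_kclass snd_ccoalg_dual)

end

lemma ccoalg_dual_map_hom:
  assumes X: "ccoalg X" and Y: "ccoalg Y" and h: "h \<in> ccoalg_hom X Y"
  shows "ccoalg_dual_map X Y h \<in> kalg_hom (ccoalg_dual Y) (ccoalg_dual X)"
proof -
  interpret X: ccoalgebra X by standard fact
  interpret Y: ccoalgebra Y by standard fact
  have h': "h \<in> PS_hom (fst X) (fst Y)"
    using h by (simp add: ccoalg_hom_def)
  let ?f = "ccoalg_dual_map X Y h"
  have f: "?f U = {x \<in> points (fst X). h x \<in> U}" "?f U \<in> clopen_upsets (fst X)"
    if "U \<in> clopen_upsets (fst Y)" for U
    using that clopen_upsets_preimage [OF h' that PSD(2) [OF X.PS]] by (simp_all add: ccoalg_dual_map_def)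
  have hom: "?f \<in> DL_hom (dual_lattice (fst Y)) (dual_lattice (fst X))"
    unfolding DL_hom_def mem_Collect_eq carrier_dual_lattice
  proof (intro conjI ballI)
    show "?f \<in> clopen_upsets (fst Y) \<rightarrow>\<^sub>E clopen_upsets (fst X)"
      using f(2) by (auto simp: ccoalg_dual_map_def)
    show "?f \<bottom>\<^bsub>dual_lattice (fst Y)\<^esub> = \<bottom>\<^bsub>dual_lattice (fst X)\<^esub>"
      using f(1) [of "{}"] by (simp add: X.ops Y.ops)
    show "?f \<top>\<^bsub>dual_lattice (fst Y)\<^esub> = \<top>\<^bsub>dual_lattice (fst X)\<^esub>"
      using f(1) [OF clopen_upsets_points [OF PSD(2) [OF Y.PS]]] PS_homD(2) [OF h'] by (auto simp: X.ops Y.ops)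
    fix U V assume UV: "U \<in> clopen_upsets (fst Y)" "V \<in> clopen_upsets (fst Y)"
    show "?f (U \<squnion>\<^bsub>dual_lattice (fst Y)\<^esub> V) = ?f U \<squnion>\<^bsub>dual_lattice (fst X)\<^esub> ?f V"
      using UV f clopen_upsets_Un [OF UV] by (auto simp: X.ops Y.ops)
    show "?f (U \<sqinter>\<^bsub>dual_lattice (fst Y)\<^esub> V) = ?f U \<sqinter>\<^bsub>dual_lattice (fst X)\<^esub> ?f V"
      using UV f clopen_upsets_Int [OF UV] by (auto simp: X.ops Y.ops)
  qed
  have "?f (Y.dual.d U) = X.dual.d (?f U) \<and> ?f (Y.dual.b U) = X.dual.b (?f U)"
    if U: "U \<in> clopen_upsets (fst Y)" for U
  proof -
    let ?V = "{x \<in> points (fst X). h x \<in> U}"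
    \<comment> \<open>The coalgebra condition for \<open>U\<close>, read at each \<open>x\<close>,
      says that taking preimages under \<open>h\<close> commutes with both operators.\<close>
    have e: "h x \<in> {y \<in> points (fst Y). snd Y y \<inter> U \<noteq> {}} \<longleftrightarrow> snd X x \<inter> ?V \<noteq> {}"
      "h x \<in> {y \<in> points (fst Y). snd Y y \<subseteq> U} \<longleftrightarrow> snd X x \<subseteq> ?V" if x: "x \<in> points (fst X)" for x
      using ccoalg_homD [OF X Y h x U] PS_homD(2) [OF h' x] by simp_all
    have "{x \<in> points (fst X). h x \<in> {y \<in> points (fst Y). snd Y y \<inter> U \<noteq> {}}} = {x \<in> points (fst X). snd X x \<inter> ?V \<noteq> {}}"
      by (intro Collect_cong conj_cong refl e(1))
    moreover have "{x \<in> points (fst X). h x \<in> {y \<in> points (fst Y). snd Y y \<subseteq> U}} = {x \<in> points (fst X). snd X x \<subseteq> ?V}"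
      by (intro Collect_cong conj_cong refl e(2))
    ultimately show ?thesis
      using f [OF U] f(1) [OF ccoalgD(4) [OF Y U]] f(1) [OF ccoalgD(5) [OF Y U]]
      by (simp only: X.dual_d X.dual_b Y.dual_d Y.dual_b U)
  qed
  then show ?thesis
    using hom by (simp add: kalg_hom_iff [OF Y.ccoalg_dual_kalg X.ccoalg_dual_kalg]
        X.dual.d_def X.dual.b_def Y.dual.d_def Y.dual.b_def)
qed

lemma ccoalg_dual_map_id: "ccoalg_dual_map X X (ccoalg_id X) = kalg_id (ccoalg_dual X)"
  using clopen_upsetsD(3) by (auto simp: ccoalg_dual_map_def kalg_id_def ccoalg_id_def fun_eq_iff)

lemma ccoalg_dual_map_comp:
  assumes X: "ccoalg X" and Y: "ccoalg Y" and Z: "ccoalg Z" and h: "h \<in> ccoalg_hom X Y" and k: "k \<in> ccoalg_hom Y Z"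
  shows "ccoalg_dual_map X Z (ccoalg_comp X k h) =
    kalg_comp (ccoalg_dual Z) (ccoalg_dual_map X Y h) (ccoalg_dual_map Y Z k)"
proof -
  have h': "h \<in> PS_hom (fst X) (fst Y)" and k': "k \<in> PS_hom (fst Y) (fst Z)"
    using h k by (auto simp: ccoalg_hom_def)
  show ?thesis
    using clopen_upsets_preimage [OF k' _ PSD(2) [OF ccoalgD(1) [OF Y]]] PS_homD(2) [OF h']
    by (auto simp: ccoalg_dual_map_def kalg_comp_def ccoalg_comp_def compose_def fun_eq_iff)
qed


section \<open>The units\<close>

text \<open>Injective because prime filters separate elements, surjective because every clopen upset
  of the dual space is some \<open>hat\<close>.\<close>

lemma kalg_unit_bij:
  assumes "kalg A"
  shows "bij_betw (kalg_unit A) (carrier (fst A)) (clopen_upsets (dual_space (fst A)))"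
proof -
  interpret kalgebra A by standard fact
  have u: "kalg_unit A a = hat (fst A) a" if "a \<in> carrier (fst A)" for a
    using that by (simp add: kalg_unit_def hat_def)
  have "a \<sqsubseteq>\<^bsub>fst A\<^esub> b" if ab: "a \<in> carrier (fst A)" "b \<in> carrier (fst A)" "hat (fst A) a = hat (fst A) b" for a b
  proof (rule ccontr)
    assume "\<not> a \<sqsubseteq>\<^bsub>fst A\<^esub> b"
    then obtain p where "p \<in> prime_filters (fst A)" "a \<in> p" "b \<notin> p"
      using prime_filter_separates ab(1,2) by blast
    with ab(3) show False
      by (metis in_hat)
  qed
  then have "inj_on (kalg_unit A) (carrier (fst A))"
    by (intro inj_onI) (simp add: u antisymm)
  moreover have "kalg_unit A ` carrier (fst A) = clopen_upsets (dual_space (fst A))"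
    unfolding clopen_upsets_dual_space using u by (rule image_cong [OF refl])
  ultimately show ?thesis
    by (simp add: bij_betw_def)
qed

text \<open>Compatibility with the operators is \<open>succ_dia\<close> and \<open>succ_box\<close>
  once more: \<open>hat\<close> of \<open>d a\<close> consists of the \<open>p\<close> whose
  successor set meets \<open>hat\<close> of \<open>a\<close>.\<close>

lemma kalg_unit_iso:
  assumes A: "kalg A"
  shows "kalg_unit A \<in> kalg_iso A (ccoalg_dual (kalg_dual A))"
proof -
  interpret kalgebra A by standard fact
  interpret D: ccoalgebra "kalg_dual A" by standard (rule kalg_dual_ccoalg)
  have u: "kalg_unit A a = hat (fst A) a" if "a \<in> carrier (fst A)" for a
    using that by (simp add: kalg_unit_def hat_def)
  note ops = dual_lattice_ops [OF Ord_dual_space_sub]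
  have cl: "hat (fst A) a \<in> clopen_upsets (dual_space (fst A))" if "a \<in> carrier (fst A)" for a
    using that by (rule hat_clopen_upset)
  have hom: "kalg_unit A \<in> DL_hom (fst A) (dual_lattice (dual_space (fst A)))"
    unfolding DL_hom_def mem_Collect_eq carrier_dual_lattice
    using cl by (auto simp: u ops hat_simps kalg_unit_def simp flip: hat_def)
  have dia: "kalg_unit A (d a) = D.dual.d (kalg_unit A a)"
    and box: "kalg_unit A (b a) = D.dual.b (kalg_unit A a)" if a: "a \<in> carrier (fst A)" for a
    using succ_dia [OF _ a] succ_box [OF _ a] a cl [OF a]
    by (auto simp: u D.dual_d D.dual_b snd_kalg_dual)
  have "kalg_unit A \<in> kalg_hom A (ccoalg_dual (kalg_dual A))"
    using hom dia box unfolding kalg_hom_iff [OF A D.ccoalg_dual_kalg]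
    by (simp add: d_def b_def D.dual.d_def D.dual.b_def)
  then show ?thesis
    using kalg_unit_bij [OF A] by (intro kalg_isoI [OF A D.ccoalg_dual_kalg]) simp_all
qed

text \<open>Both sides send \<open>a\<close> to the set of prime filters of \<open>B\<close> that
  contain \<open>h a\<close>.\<close>

lemma kalg_unit_natural:
  assumes A: "kalg A" and B: "kalg B" and h: "h \<in> kalg_hom A B"
  shows "kalg_comp A (kalg_unit B) h =
    kalg_comp A (ccoalg_dual_map (kalg_dual B) (kalg_dual A) (kalg_dual_map A B h)) (kalg_unit A)"
proof -
  interpret A: kalgebra A by standard fact
  interpret B: kalgebra B by standard fact
  have h': "h \<in> DL_hom (fst A) (fst B)"
    using h by (simp add: kalg_hom_def)
  have "kalg_dual_map A B h p \<in> prime_filters (fst A)" if "p \<in> prime_filters (fst B)" for p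
    using PS_homD(2) [OF kalg_dual_map_PS_hom [OF A B h']] that by simp
  then have "kalg_unit B (h a) = ccoalg_dual_map (kalg_dual B) (kalg_dual A) (kalg_dual_map A B h) (kalg_unit A a)"
    if a: "a \<in> carrier (fst A)" for a
    using a DL_homD(2) [OF h' a] A.hat_clopen_upset [OF a]
    by (auto simp: kalg_unit_def ccoalg_dual_map_def kalg_dual_map_def hat_def)
  then show ?thesis
    unfolding kalg_comp_def compose_def by (rule restrict_ext)
qed

context ccoalgebra
begin

lemma unit_prime_filter:
  assumes x: "x \<in> points (fst X)"
  shows "ccoalg_unit X x \<in> prime_filters L"
  using x clopen_upsets_points [OF PSD(2) [OF PS]]
  by (auto simp: ccoalg_unit_def prime_filters_def ops clopen_upsets_Int)

text \<open>If \<open>p\<close> came from no point, each point would lie outside a member of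
  \<open>p\<close> or inside a clopen upset not in \<open>p\<close>. Compactness condenses this
  cover into \<open>U \<in> p\<close> and a clopen upset \<open>V \<notin> p\<close> with
  \<open>U \<subseteq> V\<close>, which is impossible.\<close>

lemma unit_surj:
  assumes p: "p \<in> prime_filters L"
  obtains (point) x where "x \<in> points (fst X)" "ccoalg_unit X x = p"
proof (rule ccontr)
  assume "\<not> thesis"
  then have no: "ccoalg_unit X x \<noteq> p" if "x \<in> points (fst X)" for x
    using point that by blast
  have p': "p \<in> prime_filters (fst (ccoalg_dual X))"
    using p by simp
  note D = dual.prime_filterD [OF p', unfolded ccoalg_dual_simps carrier_dual_lattice le_dual_lattice]
  have pc: "p \<subseteq> clopen_upsets (fst X)"
    using D(1) by blast
  have top: "points (fst X) \<in> p" and bot: "{} \<notin> p"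
    using D(2,3) by (simp_all add: ops)
  have Int: "U \<inter> V \<in> p" if "U \<in> p" "V \<in> p" for U V
    using D(5) [OF D(1) D(1), OF that] that pc by (simp add: ops subset_iff)
  have Un: "U \<in> p \<or> V \<in> p"
    if "U \<in> clopen_upsets (fst X)" "V \<in> clopen_upsets (fst X)" "U \<union> V \<in> p" for U V
    using D(6) [OF that(1,2)] that by (simp add: ops)
  have upw: "V \<in> p" if "U \<in> p" "V \<in> clopen_upsets (fst X)" "U \<subseteq> V" for U V
    using D(4) [OF that(1,3,2)] .
  let ?\<U> = "{points (fst X) - U |U. U \<in> p} \<union> (clopen_upsets (fst X) - p)"
  have "\<And>S. S \<in> ?\<U> \<Longrightarrow> openin (Topo (fst X)) S"
    using pc clopen_upsetsD(1,2) by blast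
  moreover have "points (fst X) \<subseteq> \<Union>?\<U>"
  proof
    fix x assume x: "x \<in> points (fst X)"
    then have "ccoalg_unit X x = {U \<in> clopen_upsets (fst X). x \<in> U}"
      by (simp add: ccoalg_unit_def)
    then obtain U where "U \<in> clopen_upsets (fst X)" "x \<in> U \<and> U \<notin> p \<or> x \<notin> U \<and> U \<in> p"
      using no [OF x] pc by blast
    with x show "x \<in> \<Union>?\<U>"
      by blast
  qed
  ultimately have "\<exists>\<F>. finite \<F> \<and> \<F> \<subseteq> ?\<U> \<and> points (fst X) \<subseteq> \<Union>\<F>"
    using PSD(1) [OF PS] unfolding compact_space_def by (intro compactinD)
  then obtain \<F> where F: "finite \<F>" "\<F> \<subseteq> ?\<U>" "points (fst X) \<subseteq> \<Union>\<F>"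
    by (elim exE conjE)
  \<comment> \<open>Members of \<open>p\<close> are collected by intersection and the other clopen
    upsets by union, starting from the whole space and the empty set; primeness keeps
    \<open>V\<close> outside \<open>p\<close>.\<close>
  from F(1,2) have "\<exists>U V. U \<in> p \<and> V \<in> clopen_upsets (fst X) \<and> V \<notin> p \<and> U \<inter> \<Union>\<F> \<subseteq> V"
  proof (induction rule: finite_induct)
    case empty
    then show ?case
      using top bot by (intro exI [of _ "points (fst X)"] exI [of _ "{}"]) simp
  next
    case (insert S \<F>)
    then obtain U V where UV: "U \<in> p" "V \<in> clopen_upsets (fst X)" "V \<notin> p" "U \<inter> \<Union>\<F> \<subseteq> V"
      by auto
    consider W where "S = points (fst X) - W" "W \<in> p" | "S \<in> clopen_upsets (fst X)" "S \<notin> p"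
      using insert.prems by blast
    then show ?case
    proof cases
      case 1
      then show ?thesis
        using UV Int [of U W] by (intro exI [of _ "U \<inter> W"] exI [of _ V]) auto
    next
      case 2
      then show ?thesis
        using UV Un [of V S] clopen_upsets_Un [of V _ S] by (intro exI [of _ U] exI [of _ "V \<union> S"]) auto
    qed
  qed
  then obtain U V where UV: "U \<in> p" "V \<in> clopen_upsets (fst X)" "V \<notin> p" "U \<inter> \<Union>\<F> \<subseteq> V"
    by (elim exE conjE)
  moreover have "U \<subseteq> points (fst X)"
    using UV(1) pc clopen_upsetsD(3) by blast
  ultimately have "U \<subseteq> V"
    using F(3) by blast
  then show False
    using upw [OF UV(1,2)] UV(3) by blast
qed

text \<open>Priestley separation gives the direction from left to right. Injectivity of the unit and
  reflection of the order both come from here.\<close>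

lemma unit_le_iff:
  assumes "x \<in> points (fst X)" "y \<in> points (fst X)"
  shows "ccoalg_unit X x \<subseteq> ccoalg_unit X y \<longleftrightarrow> (x, y) \<in> Ord (fst X)"
proof
  assume "ccoalg_unit X x \<subseteq> ccoalg_unit X y"
  then show "(x, y) \<in> Ord (fst X)"
    using assms PSD(6) [OF PS assms] by (auto simp: ccoalg_unit_def)
next
  assume "(x, y) \<in> Ord (fst X)"
  then show "ccoalg_unit X x \<subseteq> ccoalg_unit X y"
    using assms clopen_upsetsD(4) by (auto simp: ccoalg_unit_def)
qed

lemma unit_bij: "bij_betw (ccoalg_unit X) (points (fst X)) (prime_filters L)"
proof -
  have "inj_on (ccoalg_unit X) (points (fst X))"
    using unit_le_iff PSD(5) [OF PS] by (intro inj_onI) (metis order_refl)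
  moreover have "ccoalg_unit X ` points (fst X) = prime_filters L"
    using unit_prime_filter unit_surj by blast
  ultimately show ?thesis
    by (simp add: bij_betw_def)
qed

text \<open>A clopen upset of the dual space of \<open>L\<close> is some \<open>hat L U\<close>, and
  its preimage under the unit is \<open>U\<close>. By \<open>succ_dia\<close> and
  \<open>succ_box\<close> for the dual algebra, the successors of the unit at \<open>x\<close> meet
  or lie in \<open>hat L U\<close> exactly when \<open>snd X x\<close> meets or lies in
  \<open>U\<close>.\<close>

lemma unit_iso: "ccoalg_unit X \<in> ccoalg_iso X (kalg_dual (ccoalg_dual X))"
proof -
  let ?u = "ccoalg_unit X"
  have hom: "?u \<in> PS_hom (fst X) (dual_space L)"
  proof (rule dl.PS_hom_dual_spaceI [OF dl.intro [OF ops(1)] PSD(2) [OF PS]])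
    show "?u \<in> points (fst X) \<rightarrow>\<^sub>E prime_filters L"
      using unit_prime_filter by (auto simp: ccoalg_unit_def)
    show "{x \<in> points (fst X). U \<in> ?u x} \<in> clopen_upsets (fst X)" if "U \<in> carrier L" for U
    proof -
      have "{x \<in> points (fst X). U \<in> ?u x} = U"
        using that clopen_upsetsD(3) by (auto simp: ccoalg_unit_def)
      then show ?thesis
        using that by simp
    qed
  qed
  have "(snd X x \<inter> {x \<in> points (fst X). ?u x \<in> W} \<noteq> {} \<longleftrightarrow> snd (kalg_dual (ccoalg_dual X)) (?u x) \<inter> W \<noteq> {}) \<and>
      (snd X x \<subseteq> {x \<in> points (fst X). ?u x \<in> W} \<longleftrightarrow> snd (kalg_dual (ccoalg_dual X)) (?u x) \<subseteq> W)"
    if x: "x \<in> points (fst X)" and W: "W \<in> clopen_upsets (dual_space L)" for x W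
  proof -
    obtain U where U: "U \<in> clopen_upsets (fst X)" "W = hat L U"
      using W dual.clopen_upsets_dual_space by auto
    have pre: "{x \<in> points (fst X). ?u x \<in> W} = U"
      using U unit_prime_filter clopen_upsetsD(3) [OF U(1)] by (auto simp: ccoalg_unit_def)
    have ux: "?u x \<in> prime_filters (fst (ccoalg_dual X))"
      using unit_prime_filter [OF x] by simp
    have "dual.d U \<in> ?u x \<longleftrightarrow> snd X x \<inter> U \<noteq> {}" "dual.b U \<in> ?u x \<longleftrightarrow> snd X x \<subseteq> U"
      using x ccoalgD(4,5) [OF ccoalg U(1)] by (simp_all add: dual_d [OF U(1)] dual_b [OF U(1)] ccoalg_unit_def)
    then show ?thesis
      unfolding pre using dual.succ_dia [OF ux, of U] dual.succ_box [OF ux, of U] U ux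
      by (simp add: dual.snd_kalg_dual)
  qed
  then have "?u \<in> ccoalg_hom X (kalg_dual (ccoalg_dual X))"
    using hom by (simp add: ccoalg_hom_iff [OF ccoalg dual.kalg_dual_ccoalg])
  moreover have "(x, y) \<in> Ord (fst X)"
    if "x \<in> points (fst X)" "y \<in> points (fst X)" "(?u x, ?u y) \<in> Ord (dual_space L)" for x y
    using that unit_le_iff by (simp add: Ord_dual_space)
  ultimately show ?thesis
    using unit_bij dual.points_dual_space
    by (intro ccoalg_isoI [OF ccoalg dual.kalg_dual_ccoalg]) simp_all
qed

end

text \<open>Both sides send \<open>x\<close> to the set of clopen upsets of \<open>Y\<close> that
  contain \<open>h x\<close>.\<close>

lemma ccoalg_unit_natural:
  assumes X: "ccoalg X" and Y: "ccoalg Y" and h: "h \<in> ccoalg_hom X Y"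
  shows "ccoalg_comp X (ccoalg_unit Y) h =
    ccoalg_comp X (kalg_dual_map (ccoalg_dual Y) (ccoalg_dual X) (ccoalg_dual_map X Y h)) (ccoalg_unit X)"
proof -
  interpret X: ccoalgebra X by standard fact
  interpret Y: ccoalgebra Y by standard fact
  have h': "h \<in> PS_hom (fst X) (fst Y)"
    using h by (simp add: ccoalg_hom_def)
  have "ccoalg_unit Y (h x) = kalg_dual_map (ccoalg_dual Y) (ccoalg_dual X) (ccoalg_dual_map X Y h) (ccoalg_unit X x)"
    if x: "x \<in> points (fst X)" for x
    using x PS_homD(2) [OF h' x] X.unit_prime_filter [OF x] clopen_upsets_preimage [OF h' _ PSD(2) [OF X.PS]]
    by (auto simp: ccoalg_unit_def ccoalg_dual_map_def kalg_dual_map_def)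
  then show ?thesis
    unfolding ccoalg_comp_def compose_def by (rule restrict_ext)
qed


section \<open>Isomorphic copies over another type\<close>

text \<open>Unlike \<open>kalg_iso\<close> it names the inverse and compares pointwise on carriers,
  which suits functors whose arrow maps mention both directions of a copying isomorphism.\<close>

definition kalg_inverse :: "'a kalg \<Rightarrow> 'b kalg \<Rightarrow> ('a \<Rightarrow> 'b) \<Rightarrow> ('b \<Rightarrow> 'a) \<Rightarrow> bool" where
  "kalg_inverse A B h k \<longleftrightarrow> h \<in> kalg_hom A B \<and> k \<in> kalg_hom B A \<and>
     (\<forall>a\<in>carrier (fst A). k (h a) = a) \<and> (\<forall>b\<in>carrier (fst B). h (k b) = b)"

definition ccoalg_inverse :: "'a ccoalg \<Rightarrow> 'b ccoalg \<Rightarrow> ('a \<Rightarrow> 'b) \<Rightarrow> ('b \<Rightarrow> 'a) \<Rightarrow> bool" where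
  "ccoalg_inverse X Y h k \<longleftrightarrow> h \<in> ccoalg_hom X Y \<and> k \<in> ccoalg_hom Y X \<and>
     (\<forall>x\<in>points (fst X). k (h x) = x) \<and> (\<forall>y\<in>points (fst Y). h (k y) = y)"

lemma kalg_hom_closed: "h \<in> kalg_hom A B \<Longrightarrow> a \<in> carrier (fst A) \<Longrightarrow> h a \<in> carrier (fst B)"
  by (auto simp: kalg_hom_def dest: DL_homD(2))

lemma ccoalg_hom_closed: "h \<in> ccoalg_hom X Y \<Longrightarrow> x \<in> points (fst X) \<Longrightarrow> h x \<in> points (fst Y)"
  by (auto simp: ccoalg_hom_def dest: PS_homD(2))

lemma kalg_hom_ext:
  assumes "h \<in> kalg_hom A B" "k \<in> kalg_hom A B" "\<And>a. a \<in> carrier (fst A) \<Longrightarrow> h a = k a"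
  shows "h = k"
  using PiE_ext [of h "carrier (fst A)" "\<lambda>_. carrier (fst B)" k] assms
  by (auto simp: kalg_hom_def DL_hom_def)

lemma ccoalg_hom_ext:
  assumes "h \<in> ccoalg_hom X Y" "k \<in> ccoalg_hom X Y" "\<And>x. x \<in> points (fst X) \<Longrightarrow> h x = k x"
  shows "h = k"
  using PiE_ext [of h "points (fst X)" "\<lambda>_. points (fst Y)" k] assms
  by (auto simp: ccoalg_hom_def PS_hom_def)

lemma kalg_comp_apply: "a \<in> carrier (fst A) \<Longrightarrow> kalg_comp A k h a = k (h a)"
  by (simp add: kalg_comp_def compose_eq)

lemma ccoalg_comp_apply: "x \<in> points (fst X) \<Longrightarrow> ccoalg_comp X k h x = k (h x)"
  by (simp add: ccoalg_comp_def compose_eq)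

lemma kalg_isoE:
  assumes "h \<in> kalg_iso A B"
  obtains k where "kalg_inverse A B h k"
proof -
  obtain k where k: "k \<in> kalg_hom B A" "kalg_comp A k h = kalg_id A" "kalg_comp B h k = kalg_id B"
    and h: "h \<in> kalg_hom A B"
    using assms by (auto simp: kalg_iso_def)
  have "k (h a) = a" if "a \<in> carrier (fst A)" for a
    using fun_cong [OF k(2), of a] that by (simp add: kalg_comp_apply kalg_id_def)
  moreover have "h (k b) = b" if "b \<in> carrier (fst B)" for b
    using fun_cong [OF k(3), of b] that by (simp add: kalg_comp_apply kalg_id_def)
  ultimately show thesis
    using h k(1) by (intro that) (auto simp: kalg_inverse_def)
qed

lemma ccoalg_isoE:
  assumes "h \<in> ccoalg_iso X Y"
  obtains k where "ccoalg_inverse X Y h k"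
proof -
  obtain k where k: "k \<in> ccoalg_hom Y X" "ccoalg_comp X k h = ccoalg_id X" "ccoalg_comp Y h k = ccoalg_id Y"
    and h: "h \<in> ccoalg_hom X Y"
    using assms by (auto simp: ccoalg_iso_def)
  have "k (h x) = x" if "x \<in> points (fst X)" for x
    using fun_cong [OF k(2), of x] that by (simp add: ccoalg_comp_apply ccoalg_id_def)
  moreover have "h (k y) = y" if "y \<in> points (fst Y)" for y
    using fun_cong [OF k(3), of y] that by (simp add: ccoalg_comp_apply ccoalg_id_def)
  ultimately show thesis
    using h k(1) by (intro that) (auto simp: ccoalg_inverse_def)
qed

lemma kalg_inverse_sym: "kalg_inverse A B h k \<Longrightarrow> kalg_inverse B A k h"
  and ccoalg_inverse_sym: "ccoalg_inverse X Y h' k' \<Longrightarrow> ccoalg_inverse Y X k' h'"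
  by (auto simp: kalg_inverse_def ccoalg_inverse_def)

lemma kalg_inverse_comp:
  assumes "kalg A" "kalg B" "kalg D" and h: "kalg_inverse A B h k" and h': "kalg_inverse B D h' k'"
  shows "kalg_inverse A D (kalg_comp A h' h) (kalg_comp D k k')"
  using assms kalg_comp_hom [of A B D h h'] kalg_comp_hom [of D B A k' k]
  by (auto simp: kalg_inverse_def kalg_comp_apply kalg_hom_closed)

lemma ccoalg_inverse_comp:
  assumes "ccoalg X" "ccoalg Y" "ccoalg Z" and h: "ccoalg_inverse X Y h k" and h': "ccoalg_inverse Y Z h' k'"
  shows "ccoalg_inverse X Z (ccoalg_comp X h' h) (ccoalg_comp Z k k')"
  using assms ccoalg_comp_hom [of X Y Z h h'] ccoalg_comp_hom [of Z Y X k' k]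
  by (auto simp: ccoalg_inverse_def ccoalg_comp_apply ccoalg_hom_closed)

lemma kalg_inverse_comp_eq_id:
  assumes "kalg_inverse A B h k"
  shows "kalg_comp A k h = kalg_id A"
  using assms by (auto simp: kalg_inverse_def kalg_comp_def kalg_id_def compose_def intro: restrict_ext)

lemma ccoalg_inverse_comp_eq_id:
  assumes "ccoalg_inverse X Y h k"
  shows "ccoalg_comp X k h = ccoalg_id X"
  using assms by (auto simp: ccoalg_inverse_def ccoalg_comp_def ccoalg_id_def compose_def intro: restrict_ext)

lemma kalg_inverseI:
  assumes "h \<in> kalg_hom A B" "k \<in> kalg_hom B A" "kalg_comp A k h = kalg_id A" "kalg_comp B h k = kalg_id B"
  shows "kalg_inverse A B h k"
  using assms fun_cong [OF assms(3)] fun_cong [OF assms(4)]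
  unfolding kalg_inverse_def by (metis kalg_comp_apply kalg_id_def restrict_apply')

lemma ccoalg_inverseI:
  assumes "h \<in> ccoalg_hom X Y" "k \<in> ccoalg_hom Y X" "ccoalg_comp X k h = ccoalg_id X" "ccoalg_comp Y h k = ccoalg_id Y"
  shows "ccoalg_inverse X Y h k"
  using assms fun_cong [OF assms(3)] fun_cong [OF assms(4)]
  unfolding ccoalg_inverse_def by (metis ccoalg_comp_apply ccoalg_id_def restrict_apply')

lemma kalg_dual_inverse:
  assumes A: "kalg A" and B: "kalg B" and inv: "kalg_inverse A B h k"
  shows "ccoalg_inverse (kalg_dual B) (kalg_dual A) (kalg_dual_map A B h) (kalg_dual_map B A k)"
proof (rule ccoalg_inverseI)
  have h: "h \<in> kalg_hom A B" and k: "k \<in> kalg_hom B A"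
    using inv by (auto simp: kalg_inverse_def)
  show "kalg_dual_map A B h \<in> ccoalg_hom (kalg_dual B) (kalg_dual A)"
    "kalg_dual_map B A k \<in> ccoalg_hom (kalg_dual A) (kalg_dual B)"
    using A B h k by (simp_all add: kalg_dual_map_hom)
  show "ccoalg_comp (kalg_dual B) (kalg_dual_map B A k) (kalg_dual_map A B h) = ccoalg_id (kalg_dual B)"
    using kalg_dual_map_comp [OF B A B k h] kalg_inverse_comp_eq_id [OF kalg_inverse_sym [OF inv]] kalg_dual_map_id [OF B]
    by simp
  show "ccoalg_comp (kalg_dual A) (kalg_dual_map A B h) (kalg_dual_map B A k) = ccoalg_id (kalg_dual A)"
    using kalg_dual_map_comp [OF A B A h k] kalg_inverse_comp_eq_id [OF inv] kalg_dual_map_id [OF A]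
    by simp
qed

lemma ccoalg_dual_inverse:
  assumes X: "ccoalg X" and Y: "ccoalg Y" and inv: "ccoalg_inverse X Y h k"
  shows "kalg_inverse (ccoalg_dual Y) (ccoalg_dual X) (ccoalg_dual_map X Y h) (ccoalg_dual_map Y X k)"
proof (rule kalg_inverseI)
  have h: "h \<in> ccoalg_hom X Y" and k: "k \<in> ccoalg_hom Y X"
    using inv by (auto simp: ccoalg_inverse_def)
  show "ccoalg_dual_map X Y h \<in> kalg_hom (ccoalg_dual Y) (ccoalg_dual X)"
    "ccoalg_dual_map Y X k \<in> kalg_hom (ccoalg_dual X) (ccoalg_dual Y)"
    using X Y h k by (simp_all add: ccoalg_dual_map_hom)
  show "kalg_comp (ccoalg_dual Y) (ccoalg_dual_map Y X k) (ccoalg_dual_map X Y h) = kalg_id (ccoalg_dual Y)"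
    using ccoalg_dual_map_comp [OF Y X Y k h] ccoalg_inverse_comp_eq_id [OF ccoalg_inverse_sym [OF inv]]
      ccoalg_dual_map_id [of Y] by simp
  show "kalg_comp (ccoalg_dual X) (ccoalg_dual_map X Y h) (ccoalg_dual_map Y X k) = kalg_id (ccoalg_dual X)"
    using ccoalg_dual_map_comp [OF X Y X h k] ccoalg_inverse_comp_eq_id [OF inv] ccoalg_dual_map_id [of X] by simp
qed

text \<open>The order of the copy is that of \<open>L\<close> read through the inverse of \<phi>;
  its operations go back to \<open>L\<close>, combine there and return.\<close>

lemma DL_transport:
  fixes \<phi> :: "'a \<Rightarrow> 'b"
  assumes L: "DL L" and inj: "inj_on \<phi> (carrier L)"
  obtains M where "DL M" "carrier M = \<phi> ` carrier L" "(\<lambda>x\<in>carrier L. \<phi> x) \<in> DL_hom L M"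
proof -
  interpret dl L by standard fact
  let ?\<psi> = "the_inv_into (carrier L) \<phi>"
  define M :: "'b gorder" where "M = \<lparr>carrier = \<phi> ` carrier L, eq = (=), le = (\<lambda>x y. ?\<psi> x \<sqsubseteq>\<^bsub>L\<^esub> ?\<psi> y)\<rparr>"
  have \<psi>: "?\<psi> (\<phi> a) = a" if "a \<in> carrier L" for a
    using the_inv_into_f_f [OF inj that] .
  have le: "\<phi> a \<sqsubseteq>\<^bsub>M\<^esub> \<phi> b \<longleftrightarrow> a \<sqsubseteq>\<^bsub>L\<^esub> b" if "a \<in> carrier L" "b \<in> carrier L" for a b
    using that by (simp add: M_def \<psi>)
  have car: "carrier M = \<phi> ` carrier L" and eq: "eq M = (=)"
    by (simp_all add: M_def)
  let ?j = "\<lambda>x y. \<phi> (?\<psi> x \<squnion>\<^bsub>L\<^esub> ?\<psi> y)" and ?m = "\<lambda>x y. \<phi> (?\<psi> x \<sqinter>\<^bsub>L\<^esub> ?\<psi> y)"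
  interpret M: dl_structure M ?j ?m "\<phi> \<bottom>\<^bsub>L\<^esub>" "\<phi> \<top>\<^bsub>L\<^esub>"
  proof unfold_locales
    fix x y z assume "x \<in> carrier M" "y \<in> carrier M" "z \<in> carrier M"
    then obtain a b c where abc: "a \<in> carrier L" "b \<in> carrier L" "c \<in> carrier L"
      "x = \<phi> a" "y = \<phi> b" "z = \<phi> c"
      by (auto simp: car)
    show "x \<sqsubseteq>\<^bsub>M\<^esub> y \<Longrightarrow> y \<sqsubseteq>\<^bsub>M\<^esub> z \<Longrightarrow> x \<sqsubseteq>\<^bsub>M\<^esub> z"
      using abc le_trans [of a b c] by (simp add: le)
    show "x \<sqsubseteq>\<^bsub>M\<^esub> z \<Longrightarrow> y \<sqsubseteq>\<^bsub>M\<^esub> z \<Longrightarrow> ?j x y \<sqsubseteq>\<^bsub>M\<^esub> z"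
      "z \<sqsubseteq>\<^bsub>M\<^esub> x \<Longrightarrow> z \<sqsubseteq>\<^bsub>M\<^esub> y \<Longrightarrow> z \<sqsubseteq>\<^bsub>M\<^esub> ?m x y"
      using abc by (simp_all add: le \<psi> join_le meet_le)
    show "?m x (?j y z) \<sqsubseteq>\<^bsub>M\<^esub> ?j (?m x y) (?m x z)"
      using abc by (simp add: le \<psi> distrib)
  next
    fix x y assume "x \<in> carrier M" "y \<in> carrier M"
    then obtain a b where ab: "a \<in> carrier L" "b \<in> carrier L" "x = \<phi> a" "y = \<phi> b"
      by (auto simp: car)
    show "x \<sqsubseteq>\<^bsub>M\<^esub> y \<Longrightarrow> y \<sqsubseteq>\<^bsub>M\<^esub> x \<Longrightarrow> x = y"
      using ab antisymm [of a b] by (simp add: le)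
    show "?j x y \<in> carrier M" "?m x y \<in> carrier M" "x \<sqsubseteq>\<^bsub>M\<^esub> ?j x y" "y \<sqsubseteq>\<^bsub>M\<^esub> ?j x y"
      "?m x y \<sqsubseteq>\<^bsub>M\<^esub> x" "?m x y \<sqsubseteq>\<^bsub>M\<^esub> y"
      using ab by (simp_all add: le \<psi> car join_left join_right meet_left meet_right)
  qed (auto simp: car eq le)
  have "(\<lambda>x\<in>carrier L. \<phi> x) \<in> DL_hom L M"
    by (auto simp: DL_hom_def M.bottom_eq M.top_eq M.join_eq M.meet_eq car \<psi>)
  with M.DL car that show thesis
    by blast
qed

lemma kalg_transport:
  fixes \<phi> :: "'a \<Rightarrow> 'b"
  assumes A: "kalg A" and inj: "inj_on \<phi> (carrier (fst A))"
  obtains B h k where "kalg B" "carrier (fst B) = \<phi> ` carrier (fst A)" "kalg_inverse A B h k"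
proof -
  have L: "DL (fst A)" and f: "snd A \<in> DL_hom (K (fst A)) (fst A)"
    using A by (auto simp: kalg_def)
  obtain M where M: "DL M" "carrier M = \<phi> ` carrier (fst A)" "(\<lambda>x\<in>carrier (fst A). \<phi> x) \<in> DL_hom (fst A) M"
    using DL_transport [OF L inj] .
  define h where "h = (\<lambda>x\<in>carrier (fst A). \<phi> x)"
  have h: "h \<in> DL_hom (fst A) M"
    using M(3) by (simp add: h_def)
  have bij: "bij_betw h (carrier (fst A)) (carrier M)"
    using inj by (auto simp: bij_betw_def h_def M(2) inj_on_def)
  define k where "k = (\<lambda>y\<in>carrier M. the_inv_into (carrier (fst A)) h y)"
  have k: "k \<in> DL_hom M (fst A)"
    unfolding k_def by (rule DL_hom_inverse [OF L M(1) h bij])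
  have kh: "k (h a) = a" if "a \<in> carrier (fst A)" for a
    using that bij DL_homD(2) [OF h] by (simp add: k_def bij_betw_def the_inv_into_f_f)
  \<comment> \<open>The structure map of \<open>A\<close> conjugated by the isomorphism: \<K> of
    \<open>k\<close>, then the old structure map, then \<open>h\<close>. The square for
    \<open>h\<close> commutes because \<open>k\<close> undoes \<open>h\<close>.\<close>
  let ?g = "compose (carrier (K M)) h (compose (carrier (K M)) (snd A) (Kmap M (fst A) k))"
  have g: "?g \<in> DL_hom (K M) M"
    by (rule DL_hom_compose [OF DL_K DL_hom_compose [OF DL_K Kmap_hom [OF k M(1) L] f] h])
  have B: "kalg (M, ?g)"
    using M(1) g by (simp add: kalg_def)
  have "h \<in> kalg_hom A (M, ?g)"
    unfolding kalg_hom_iff [OF A B]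
    using h DL_homD(2) [OF h] Kmap_dia [OF k M(1) L] Kmap_box [OF k M(1) L]
    by (simp add: compose_eq dia_closed box_closed kh)
  then have "h \<in> kalg_iso A (M, ?g)"
    using bij by (intro kalg_isoI [OF A B]) simp_all
  then obtain k where "kalg_inverse A (M, ?g) h k"
    by (rule kalg_isoE)
  then show thesis
    using that [of "(M, ?g)"] B M(2) by simp
qed

lemma PS_transport:
  fixes \<phi> :: "'a \<Rightarrow> 'b"
  assumes X: "PS X" and inj: "inj_on \<phi> (points X)"
  obtains Y h k where "PS Y" "points Y = \<phi> ` points X" "h \<in> PS_hom X Y" "k \<in> PS_hom Y X"
    "\<And>x. x \<in> points X \<Longrightarrow> k (h x) = x" "\<And>y. y \<in> points Y \<Longrightarrow> h (k y) = y"
proof -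
  define k where "k = (\<lambda>y\<in>\<phi> ` points X. the_inv_into (points X) \<phi> y)"
  define h where "h = (\<lambda>x\<in>points X. \<phi> x)"
  \<comment> \<open>Pulling the topology back along the inverse \<open>k\<close> makes
    \<open>k\<close> continuous at once, and makes \<open>h\<close> continuous because
    \<open>k \<circ> h\<close> is the identity on the points of \<open>X\<close>.\<close>
  define Y where "Y = \<lparr>Topo = pullback_topology (\<phi> ` points X) k (Topo X),
    Ord = (\<lambda>(x, y). (\<phi> x, \<phi> y)) ` Ord X\<rparr>"
  have kh: "k (h x) = x" "k (\<phi> x) = x" "h x = \<phi> x" if "x \<in> points X" for x
    using that the_inv_into_f_f [OF inj that] by (simp_all add: k_def h_def)
  have pts: "points Y = \<phi> ` points X"
    using kh by (auto simp: Y_def topspace_pullback_topology)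
  have ord: "(\<phi> x, \<phi> y) \<in> Ord Y \<longleftrightarrow> (x, y) \<in> Ord X" if "x \<in> points X" "y \<in> points X" for x y
  proof
    assume "(\<phi> x, \<phi> y) \<in> Ord Y"
    then obtain a b where ab: "(a, b) \<in> Ord X" "\<phi> x = \<phi> a" "\<phi> y = \<phi> b"
      by (auto simp: Y_def)
    then have "a \<in> points X" "b \<in> points X"
      using PSD(2) [OF X] by auto
    with ab that show "(x, y) \<in> Ord X"
      using inj_onD [OF inj ab(2)] inj_onD [OF inj ab(3)] by simp
  next
    assume "(x, y) \<in> Ord X"
    then show "(\<phi> x, \<phi> y) \<in> Ord Y"
      by (force simp: Y_def)
  qed
  have ordsub: "Ord Y \<subseteq> points Y \<times> points Y"
    using PSD(2) [OF X] unfolding pts by (auto simp: Y_def)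
  have TY: "Topo Y = pullback_topology (\<phi> ` points X) k (Topo X)"
    by (simp add: Y_def)
  have hcont: "continuous_map (Topo X) (Topo Y) h"
    unfolding TY
  proof (rule continuous_map_pullback')
    show "continuous_map (Topo X) (Topo X) (k \<circ> h)"
      by (rule continuous_map_eq [where f = "\<lambda>x. x"]) (simp_all add: kh)
    show "points X \<subseteq> h -` \<phi> ` points X"
      by (auto simp: h_def)
  qed
  have kcont: "continuous_map (Topo Y) (Topo X) k"
    unfolding TY using continuous_map_pullback [OF continuous_map_id, of "\<phi> ` points X" k "Topo X"]
    by (simp add: id_def comp_def)
  have h: "h \<in> PS_hom X Y"
    using hcont pts ord PSD(2) [OF X] by (auto simp: PS_hom_def h_def)
  have k: "k \<in> PS_hom Y X"
  proof -
    have "(k x, k y) \<in> Ord X" if xy: "(x, y) \<in> Ord Y" for x y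
    proof -
      obtain a b where "(a, b) \<in> Ord X" "x = \<phi> a" "y = \<phi> b"
        using xy by (auto simp: Y_def)
      then show ?thesis
        using PSD(2) [OF X] by (auto simp: kh)
    qed
    moreover have "k \<in> points Y \<rightarrow>\<^sub>E points X"
      unfolding pts using kh by (auto simp: PiE_iff) (simp add: k_def)
    ultimately show ?thesis
      using kcont by (auto simp: PS_hom_def)
  qed
  have "PS Y"
    unfolding PS_def
  proof (intro conjI ballI impI)
    have "h ` points X = points Y"
      by (auto simp: pts h_def)
    then show "compact_space (Topo Y)"
      using image_compactin [OF _ hcont, of "points X"] PSD(1) [OF X] by (simp add: compact_space_def)
    have ord': "(x, y) \<in> Ord Y \<longleftrightarrow> x \<in> points Y \<and> y \<in> points Y \<and> (k x, k y) \<in> Ord X" for x y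
      using ordsub kh ord by (auto simp: pts)
    have "x = y" if "x \<in> points Y" "y \<in> points Y" "k x = k y" for x y
      using that by (auto simp: pts kh)
    then show "partial_order_on (points Y) (Ord Y)"
      unfolding partial_order_on_def preorder_on_def refl_on_def trans_def antisym_def
      using PSD(3-5) [OF X] PS_homD(2) [OF k] ordsub by (auto simp: ord')
    fix x y assume "x \<in> points Y" "y \<in> points Y" "(x, y) \<notin> Ord Y"
    then obtain a b where ab: "a \<in> points X" "b \<in> points X" "x = \<phi> a" "y = \<phi> b" "(a, b) \<notin> Ord X"
      by (auto simp: pts ord)
    then obtain U where U: "U \<in> clopen_upsets X" "a \<in> U" "b \<notin> U"
      using PSD(6) [OF X] by blast
    then show "\<exists>U\<in>clopen_upsets Y. x \<in> U \<and> y \<notin> U"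
      using ab clopen_upsets_preimage [OF k U(1) ordsub]
      by (intro bexI [of _ "{y \<in> points Y. k y \<in> U}"]) (auto simp: kh pts)
  qed
  moreover have "h (k y) = y" if "y \<in> points Y" for y
    using that by (auto simp: pts kh)
  ultimately show thesis
    using that pts h k kh(1) by blast
qed

lemma ccoalg_transport:
  fixes \<phi> :: "'a \<Rightarrow> 'b"
  assumes X: "ccoalg X" and inj: "inj_on \<phi> (points (fst X))"
  obtains Y h k where "ccoalg Y" "points (fst Y) = \<phi> ` points (fst X)" "ccoalg_inverse X Y h k"
proof -
  note XP = ccoalgD(1) [OF X] and g = ccoalgD(2) [OF X]
  obtain P h k where P: "PS P" "points P = \<phi> ` points (fst X)"
    and h: "h \<in> PS_hom (fst X) P" and k: "k \<in> PS_hom P (fst X)"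
    and kh: "\<And>x. x \<in> points (fst X) \<Longrightarrow> k (h x) = x" and hk: "\<And>y. y \<in> points P \<Longrightarrow> h (k y) = y"
    by (rule PS_transport [OF XP inj]) blast
  \<comment> \<open>The old structure map conjugated by the copying isomorphism, with
    \<open>k\<close> before it and \<C> of \<open>h\<close> after it.\<close>
  let ?g = "compose (points P) (Cmap (fst X) P h) (compose (points P) (snd X) k)"
  have "?g \<in> PS_hom P (C P)"
    using PSD(2) [OF P(1)] by (intro PS_hom_compose [OF PS_hom_compose [OF k g] Cmap_hom [OF XP P(1) h]])
  then have Y: "ccoalg (P, ?g)"
    using P(1) by (simp add: ccoalg_def)
  have "compose (points (fst X)) (Cmap (fst X) P h) (snd X) = compose (points (fst X)) ?g h"
    using PS_homD(2) [OF h] kh by (auto simp: compose_def fun_eq_iff)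
  then have "h \<in> ccoalg_hom X (P, ?g)"
    using h by (simp add: ccoalg_hom_def)
  moreover have "bij_betw h (points (fst X)) (points P)"
    using kh hk PS_homD(2) [OF h] PS_homD(2) [OF k] by (intro bij_betw_byWitness [where f' = k]) auto
  moreover have "(x, y) \<in> Ord (fst X)" if "x \<in> points (fst X)" "y \<in> points (fst X)" "(h x, h y) \<in> Ord P" for x y
    using PS_homD(4) [OF k that(3)] that kh by simp
  ultimately have "h \<in> ccoalg_iso X (P, ?g)"
    by (intro ccoalg_isoI [OF X Y]) simp_all
  then obtain k' where "ccoalg_inverse X (P, ?g) h k'"
    by (rule ccoalg_isoE)
  then show thesis
    using that [of "(P, ?g)"] Y P(2) by simp
qed


section \<open>The equivalence of categories\<close>

lemma is_category_op: "is_category c \<Longrightarrow> is_category (op_cat c)"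
  by (simp add: is_category_def op_cat_def)

lemma Alg_K_simps [simp]:
  "A \<in> Obj (Alg_K small) \<longleftrightarrow> kalg A \<and> small (carrier (fst A))"
  "Hom (Alg_K small) = kalg_hom" "Ident (Alg_K small) = kalg_id" "Comp (Alg_K small) A B D = kalg_comp A"
  by (simp_all add: Alg_K_def)

lemma Coalg_C_simps [simp]:
  "X \<in> Obj (Coalg_C small) \<longleftrightarrow> ccoalg X \<and> small (points (fst X))"
  "Hom (Coalg_C small) = ccoalg_hom" "Ident (Coalg_C small) = ccoalg_id" "Comp (Coalg_C small) X Y Z = ccoalg_comp X"
  by (simp_all add: Coalg_C_def)

lemma op_cat_simps [simp]:
  "Obj (op_cat c) = Obj c" "Hom (op_cat c) x y = Hom c y x" "Ident (op_cat c) = Ident c"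
  "Comp (op_cat c) x y z g f = Comp c z y x f g"
  by (simp_all add: op_cat_def)

lemma kalg_comp_assoc:
  "h \<in> kalg_hom A B \<Longrightarrow> kalg_comp A l (kalg_comp A k h) = kalg_comp A (kalg_comp B l k) h"
  unfolding kalg_comp_def by (rule compose_assoc) (auto intro: kalg_hom_closed)

lemma ccoalg_comp_assoc:
  "h \<in> ccoalg_hom X Y \<Longrightarrow> ccoalg_comp X l (ccoalg_comp X k h) = ccoalg_comp X (ccoalg_comp Y l k) h"
  unfolding ccoalg_comp_def by (rule compose_assoc) (auto intro: ccoalg_hom_closed)

lemma kalg_comp_id:
  assumes "kalg A" "kalg B" "h \<in> kalg_hom A B"
  shows "kalg_comp A h (kalg_id A) = h" "kalg_comp A (kalg_id B) h = h"
proof -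
  show "kalg_comp A h (kalg_id A) = h"
    by (rule kalg_hom_ext [OF kalg_comp_hom [OF assms(1,1,2) kalg_id_hom [OF assms(1)] assms(3)] assms(3)])
      (simp add: kalg_comp_apply kalg_id_def)
  show "kalg_comp A (kalg_id B) h = h"
    by (rule kalg_hom_ext [OF kalg_comp_hom [OF assms(1,2,2,3) kalg_id_hom [OF assms(2)]] assms(3)])
      (simp add: kalg_comp_apply kalg_id_def kalg_hom_closed [OF assms(3)])
qed

lemma ccoalg_comp_id:
  assumes "ccoalg X" "ccoalg Y" "h \<in> ccoalg_hom X Y"
  shows "ccoalg_comp X h (ccoalg_id X) = h" "ccoalg_comp X (ccoalg_id Y) h = h"
proof -
  show "ccoalg_comp X h (ccoalg_id X) = h"
    by (rule ccoalg_hom_ext [OF ccoalg_comp_hom [OF assms(1,1,2) ccoalg_id_hom [OF assms(1)] assms(3)] assms(3)])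
      (simp add: ccoalg_comp_apply ccoalg_id_def)
  show "ccoalg_comp X (ccoalg_id Y) h = h"
    by (rule ccoalg_hom_ext [OF ccoalg_comp_hom [OF assms(1,2,2,3) ccoalg_id_hom [OF assms(2)]] assms(3)])
      (simp add: ccoalg_comp_apply ccoalg_id_def ccoalg_hom_closed [OF assms(3)])
qed

lemma is_category_Alg_K: "is_category (Alg_K small)"
  unfolding is_category_def Alg_K_simps
  by (auto intro: kalg_id_hom kalg_comp_hom kalg_comp_id kalg_comp_assoc)

lemma is_category_Coalg_C: "is_category (Coalg_C small)"
  unfolding is_category_def Coalg_C_simps
  by (auto intro: ccoalg_id_hom ccoalg_comp_hom ccoalg_comp_id ccoalg_comp_assoc)

lemma iso_arrow_Alg_K:
  assumes "kalg_inverse A B h k"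
  shows "iso_arrow (op_cat (Alg_K small)) B A h"
  using assms kalg_inverse_comp_eq_id [OF assms] kalg_inverse_comp_eq_id [OF kalg_inverse_sym [OF assms]]
  by (auto simp: iso_arrow_def kalg_inverse_def)

lemma iso_arrow_Coalg_C:
  assumes "ccoalg_inverse X Y h k"
  shows "iso_arrow (Coalg_C small) X Y h"
  using assms ccoalg_inverse_comp_eq_id [OF assms] ccoalg_inverse_comp_eq_id [OF ccoalg_inverse_sym [OF assms]]
  by (auto simp: iso_arrow_def ccoalg_inverse_def)

text \<open>Prime filters are subsets of the carrier, so the universe provides a small set into
  which they inject; the dual coalgebra is relabelled along this injection and is small because its
  points lie in that set.\<close>

lemma kalg_small_dual:
  fixes A :: "'u kalg"
  assumes U: "universe small" and A: "kalg A" "small (carrier (fst A))"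
  obtains X :: "'u ccoalg" and h k
  where "ccoalg X" "small (points (fst X))" "ccoalg_inverse (kalg_dual A) X h k"
proof -
  interpret kalgebra A by standard fact
  obtain B where B: "small B" "Pow (carrier (fst A)) \<lesssim> B"
    using U A(2) unfolding universe_def by blast
  then obtain \<phi> where \<phi>: "inj_on \<phi> (Pow (carrier (fst A)))" "\<phi> ` Pow (carrier (fst A)) \<subseteq> B"
    by (auto simp: lepoll_def)
  have sub: "points (fst (kalg_dual A)) \<subseteq> Pow (carrier (fst A))"
    using prime_filterD(1) by auto
  obtain X h k where X: "ccoalg X" "points (fst X) = \<phi> ` points (fst (kalg_dual A))" "ccoalg_inverse (kalg_dual A) X h k"
    by (rule ccoalg_transport [OF kalg_dual_ccoalg inj_on_subset [OF \<phi>(1) sub]])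
  have "points (fst X) \<lesssim> B"
    unfolding X(2) using \<phi>(2) sub by (intro subset_imp_lepoll) blast
  then have "small (points (fst X))"
    using U B(1) unfolding universe_def by blast
  with X that show thesis
    by blast
qed

lemma ccoalg_small_dual:
  fixes X :: "'u ccoalg"
  assumes U: "universe small" and X: "ccoalg X" "small (points (fst X))"
  obtains A :: "'u kalg" and h k
  where "kalg A" "small (carrier (fst A))" "kalg_inverse (ccoalg_dual X) A h k"
proof -
  interpret ccoalgebra X by standard fact
  obtain B where B: "small B" "Pow (points (fst X)) \<lesssim> B"
    using U X(2) unfolding universe_def by blast
  then obtain \<phi> where \<phi>: "inj_on \<phi> (Pow (points (fst X)))" "\<phi> ` Pow (points (fst X)) \<subseteq> B"
    by (auto simp: lepoll_def)
  have sub: "carrier (fst (ccoalg_dual X)) \<subseteq> Pow (points (fst X))"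
    using clopen_upsetsD(3) by auto
  obtain A h k where A: "kalg A" "carrier (fst A) = \<phi> ` carrier (fst (ccoalg_dual X))" "kalg_inverse (ccoalg_dual X) A h k"
    by (rule kalg_transport [OF ccoalg_dual_kalg inj_on_subset [OF \<phi>(1) sub]])
  have "carrier (fst A) \<lesssim> B"
    unfolding A(2) using \<phi>(2) sub by (intro subset_imp_lepoll) blast
  then have "small (carrier (fst A))"
    using U B(1) unfolding universe_def by blast
  with A that show thesis
    by blast
qed

lemma ccoalg_kalg_dual: "kalg A \<Longrightarrow> ccoalg (kalg_dual A)"
  by (rule kalgebra.kalg_dual_ccoalg [OF kalgebra.intro])

lemma kalg_ccoalg_dual: "ccoalg X \<Longrightarrow> kalg (ccoalg_dual X)"
  by (rule ccoalgebra.ccoalg_dual_kalg [OF ccoalgebra.intro])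

text \<open>\<open>FO A\<close> and \<open>GO X\<close> are copies of \<^term>\<open>kalg_dual A\<close> and \<^term>\<open>ccoalg_dual X\<close> inside the
  universe, along the isomorphisms \<open>FI A\<close> and \<open>GI X\<close> with inverses \<open>FJ A\<close> and \<open>GJ X\<close>.\<close>

locale small_duals =
  fixes small :: "'u set \<Rightarrow> bool"
    and FO :: "'u kalg \<Rightarrow> 'u ccoalg" and FI :: "'u kalg \<Rightarrow> 'u set \<Rightarrow> 'u" and FJ :: "'u kalg \<Rightarrow> 'u \<Rightarrow> 'u set"
    and GO :: "'u ccoalg \<Rightarrow> 'u kalg" and GI :: "'u ccoalg \<Rightarrow> 'u set \<Rightarrow> 'u" and GJ :: "'u ccoalg \<Rightarrow> 'u \<Rightarrow> 'u set"
  assumes FO: "\<lbrakk>kalg A; small (carrier (fst A))\<rbrakk> \<Longrightarrow> ccoalg (FO A)"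
    and FO_small: "\<lbrakk>kalg A; small (carrier (fst A))\<rbrakk> \<Longrightarrow> small (points (fst (FO A)))"
    and FI_FJ: "\<lbrakk>kalg A; small (carrier (fst A))\<rbrakk> \<Longrightarrow> ccoalg_inverse (kalg_dual A) (FO A) (FI A) (FJ A)"
    and GO: "\<lbrakk>ccoalg X; small (points (fst X))\<rbrakk> \<Longrightarrow> kalg (GO X)"
    and GO_small: "\<lbrakk>ccoalg X; small (points (fst X))\<rbrakk> \<Longrightarrow> small (carrier (fst (GO X)))"
    and GI_GJ: "\<lbrakk>ccoalg X; small (points (fst X))\<rbrakk> \<Longrightarrow> kalg_inverse (ccoalg_dual X) (GO X) (GI X) (GJ X)"
begin

text \<open>An arrow from \<open>B\<close> to \<open>A\<close> in the opposite category is a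
  homomorphism \<open>h\<close> from \<open>A\<close> to \<open>B\<close>. Its image leaves the copy
  of the dual of \<open>B\<close> by \<open>FJ B\<close>, crosses the dual map of \<open>h\<close>,
  and enters the copy for \<open>A\<close> by \<open>FI A\<close>.\<close>

definition F :: "('u kalg, 'u \<Rightarrow> 'u, 'u ccoalg, 'u \<Rightarrow> 'u) functor_data" where
  "F = (FO, \<lambda>B A h. ccoalg_comp (FO B) (FI A) (ccoalg_comp (FO B) (kalg_dual_map A B h) (FJ B)))"

definition G :: "('u ccoalg, 'u \<Rightarrow> 'u, 'u kalg, 'u \<Rightarrow> 'u) functor_data" where
  "G = (GO, \<lambda>X Y h. kalg_comp (GO Y) (GI X) (kalg_comp (GO Y) (ccoalg_dual_map X Y h) (GJ Y)))"

lemma FI: "FI A \<in> ccoalg_hom (kalg_dual A) (FO A)" and FJ: "FJ A \<in> ccoalg_hom (FO A) (kalg_dual A)"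
  and FJ_FI: "x \<in> points (fst (kalg_dual A)) \<Longrightarrow> FJ A (FI A x) = x"
  and FI_FJ': "y \<in> points (fst (FO A)) \<Longrightarrow> FI A (FJ A y) = y"
  if "kalg A" "small (carrier (fst A))"
  using FI_FJ [OF that] by (auto simp: ccoalg_inverse_def)

lemma GI: "GI X \<in> kalg_hom (ccoalg_dual X) (GO X)" and GJ: "GJ X \<in> kalg_hom (GO X) (ccoalg_dual X)"
  and GJ_GI: "x \<in> carrier (fst (ccoalg_dual X)) \<Longrightarrow> GJ X (GI X x) = x"
  and GI_GJ': "y \<in> carrier (fst (GO X)) \<Longrightarrow> GI X (GJ X y) = y"
  if "ccoalg X" "small (points (fst X))"
  using GI_GJ [OF that] by (auto simp: kalg_inverse_def)

lemma F_hom: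
  assumes A: "kalg A" "small (carrier (fst A))" and B: "kalg B" "small (carrier (fst B))" and h: "h \<in> kalg_hom A B"
  shows "snd F B A h \<in> ccoalg_hom (FO B) (FO A)"
  unfolding F_def snd_conv
  by (rule ccoalg_comp_hom [OF FO [OF B] ccoalg_kalg_dual [OF A(1)] FO [OF A] _ FI [OF A]],
      rule ccoalg_comp_hom [OF FO [OF B] ccoalg_kalg_dual [OF B(1)] ccoalg_kalg_dual [OF A(1)] FJ [OF B] kalg_dual_map_hom [OF A(1) B(1) h]])

lemma G_hom:
  assumes X: "ccoalg X" "small (points (fst X))" and Y: "ccoalg Y" "small (points (fst Y))" and h: "h \<in> ccoalg_hom X Y"
  shows "snd G X Y h \<in> kalg_hom (GO Y) (GO X)"
  unfolding G_def snd_conv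
  by (rule kalg_comp_hom [OF GO [OF Y] kalg_ccoalg_dual [OF X(1)] GO [OF X] _ GI [OF X]],
      rule kalg_comp_hom [OF GO [OF Y] kalg_ccoalg_dual [OF Y(1)] kalg_ccoalg_dual [OF X(1)] GJ [OF Y] ccoalg_dual_map_hom [OF X(1) Y(1) h]])

lemma fst_F [simp]: "fst F A = FO A" and fst_G [simp]: "fst G X = GO X"
  by (simp_all add: F_def G_def)

lemma F_apply: "x \<in> points (fst (FO B)) \<Longrightarrow> snd F B A h x = FI A (kalg_dual_map A B h (FJ B x))"
  by (simp add: F_def ccoalg_comp_apply)

lemma G_apply: "a \<in> carrier (fst (GO Y)) \<Longrightarrow> snd G X Y h a = GI X (ccoalg_dual_map X Y h (GJ Y a))"
  by (simp add: G_def kalg_comp_apply)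

text \<open>Between two consecutive arrows the copying isomorphism of the middle object meets its
  inverse and cancels, which leaves functoriality of the uncopied dual.\<close>

lemma F_functor: "is_functor (op_cat (Alg_K small)) (Coalg_C small) F"
  unfolding is_functor_def
proof (intro conjI ballI, unfold op_cat_simps Alg_K_simps Coalg_C_simps)
  fix A assume "kalg A \<and> small (carrier (fst A))"
  then have A: "kalg A" "small (carrier (fst A))"
    by auto
  show "ccoalg (fst F A) \<and> small (points (fst (fst F A)))"
    using FO [OF A] FO_small [OF A] by simp
  show "snd F A A (kalg_id A) = ccoalg_id (fst F A)"
  proof (rule ccoalg_hom_ext)
    show "snd F A A (kalg_id A) \<in> ccoalg_hom (FO A) (FO A)"
      by (rule F_hom [OF A A kalg_id_hom [OF A(1)]])
    show "ccoalg_id (fst F A) \<in> ccoalg_hom (FO A) (FO A)"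
      using ccoalg_id_hom [OF FO [OF A]] by simp
    fix x assume x: "x \<in> points (fst (FO A))"
    show "snd F A A (kalg_id A) x = ccoalg_id (fst F A) x"
      using x FI_FJ' [OF A x] ccoalg_hom_closed [OF FJ [OF A] x] kalg_dual_map_id [OF A(1)]
      by (simp add: F_apply ccoalg_id_def)
  qed
  fix B h assume "kalg B \<and> small (carrier (fst B))" and h: "h \<in> kalg_hom B A"
  then have B: "kalg B" "small (carrier (fst B))"
    by auto
  show "snd F A B h \<in> ccoalg_hom (fst F A) (fst F B)"
    using F_hom [OF B A h] by simp
  fix D k assume "kalg D \<and> small (carrier (fst D))" and k: "k \<in> kalg_hom D B"
  then have D: "kalg D" "small (carrier (fst D))"
    by auto
  show "snd F A D (kalg_comp D h k) = ccoalg_comp (fst F A) (snd F B D k) (snd F A B h)"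
  proof (rule ccoalg_hom_ext)
    show "snd F A D (kalg_comp D h k) \<in> ccoalg_hom (FO A) (FO D)"
      by (rule F_hom [OF D A kalg_comp_hom [OF D(1) B(1) A(1) k h]])
    show "ccoalg_comp (fst F A) (snd F B D k) (snd F A B h) \<in> ccoalg_hom (FO A) (FO D)"
      using ccoalg_comp_hom [OF FO [OF A] FO [OF B] FO [OF D] F_hom [OF B A h] F_hom [OF D B k]]
      by simp
    fix x assume x: "x \<in> points (fst (FO A))"
    have x': "FJ A x \<in> points (fst (kalg_dual A))"
      by (rule ccoalg_hom_closed [OF FJ [OF A] x])
    have y: "kalg_dual_map B A h (FJ A x) \<in> points (fst (kalg_dual B))"
      by (rule ccoalg_hom_closed [OF kalg_dual_map_hom [OF B(1) A(1) h] x'])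
    show "snd F A D (kalg_comp D h k) x = ccoalg_comp (fst F A) (snd F B D k) (snd F A B h) x"
      using x ccoalg_hom_closed [OF F_hom [OF B A h] x] FJ_FI [OF B y] x'
      by (simp add: F_apply kalg_dual_map_comp [OF D(1) B(1) A(1) k h] ccoalg_comp_apply)
  qed
qed

lemma G_functor: "is_functor (Coalg_C small) (op_cat (Alg_K small)) G"
  unfolding is_functor_def
proof (intro conjI ballI, unfold op_cat_simps Alg_K_simps Coalg_C_simps)
  fix X assume "ccoalg X \<and> small (points (fst X))"
  then have X: "ccoalg X" "small (points (fst X))"
    by auto
  show "kalg (fst G X) \<and> small (carrier (fst (fst G X)))"
    using GO [OF X] GO_small [OF X] by simp
  show "snd G X X (ccoalg_id X) = kalg_id (fst G X)"
  proof (rule kalg_hom_ext)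
    show "snd G X X (ccoalg_id X) \<in> kalg_hom (GO X) (GO X)"
      by (rule G_hom [OF X X ccoalg_id_hom [OF X(1)]])
    show "kalg_id (fst G X) \<in> kalg_hom (GO X) (GO X)"
      using kalg_id_hom [OF GO [OF X]] by simp
    fix a assume a: "a \<in> carrier (fst (GO X))"
    show "snd G X X (ccoalg_id X) a = kalg_id (fst G X) a"
      using a GI_GJ' [OF X a] kalg_hom_closed [OF GJ [OF X] a] ccoalg_dual_map_id [of X]
      by (simp add: G_apply kalg_id_def)
  qed
  fix Y h assume "ccoalg Y \<and> small (points (fst Y))" and h: "h \<in> ccoalg_hom X Y"
  then have Y: "ccoalg Y" "small (points (fst Y))"
    by auto
  show "snd G X Y h \<in> kalg_hom (fst G Y) (fst G X)"
    using G_hom [OF X Y h] by simp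
  fix Z k assume "ccoalg Z \<and> small (points (fst Z))" and k: "k \<in> ccoalg_hom Y Z"
  then have Z: "ccoalg Z" "small (points (fst Z))"
    by auto
  show "snd G X Z (ccoalg_comp X k h) = kalg_comp (fst G Z) (snd G X Y h) (snd G Y Z k)"
  proof (rule kalg_hom_ext)
    show "snd G X Z (ccoalg_comp X k h) \<in> kalg_hom (GO Z) (GO X)"
      by (rule G_hom [OF X Z ccoalg_comp_hom [OF X(1) Y(1) Z(1) h k]])
    show "kalg_comp (fst G Z) (snd G X Y h) (snd G Y Z k) \<in> kalg_hom (GO Z) (GO X)"
      using kalg_comp_hom [OF GO [OF Z] GO [OF Y] GO [OF X] G_hom [OF Y Z k] G_hom [OF X Y h]]
      by simp
    fix a assume a: "a \<in> carrier (fst (GO Z))"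
    have a': "GJ Z a \<in> carrier (fst (ccoalg_dual Z))"
      by (rule kalg_hom_closed [OF GJ [OF Z] a])
    have b: "ccoalg_dual_map Y Z k (GJ Z a) \<in> carrier (fst (ccoalg_dual Y))"
      by (rule kalg_hom_closed [OF ccoalg_dual_map_hom [OF Y(1) Z(1) k] a'])
    show "snd G X Z (ccoalg_comp X k h) a = kalg_comp (fst G Z) (snd G X Y h) (snd G Y Z k) a"
      using a kalg_hom_closed [OF G_hom [OF Y Z k] a] GJ_GI [OF Y b] a'
      by (simp add: G_apply ccoalg_dual_map_comp [OF X(1) Y(1) Z(1) h k] kalg_comp_apply)
  qed
qed

text \<open>As algebra morphisms the components of \<open>\<eta>\<close> go from \<open>G (F A)\<close> to \<open>A\<close>, since \<open>\<eta>\<close> lives in the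
  opposite category; the choice operator picks the inverse of the unit.\<close>

definition \<eta> :: "'u kalg \<Rightarrow> 'u \<Rightarrow> 'u" where
  "\<eta> A = (let X = FO A; v = (SOME v. kalg_inverse A (ccoalg_dual (kalg_dual A)) (kalg_unit A) v) in
     kalg_comp (GO X) (kalg_comp (ccoalg_dual X) v (ccoalg_dual_map (kalg_dual A) X (FI A))) (GJ X))"

text \<open>The component leaves the copy by \<open>FJ\<close>, reaches the double dual of
  \<open>X\<close> through the dual map of \<open>GI X\<close>, and ends with a chosen inverse of
  the unit.\<close>

definition \<epsilon> :: "'u ccoalg \<Rightarrow> 'u \<Rightarrow> 'u" where
  "\<epsilon> X = (let A = GO X; v = (SOME v. ccoalg_inverse X (kalg_dual (ccoalg_dual X)) (ccoalg_unit X) v) in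
     ccoalg_comp (FO A) (ccoalg_comp (kalg_dual A) v (kalg_dual_map (ccoalg_dual X) A (GI X))) (FJ A))"

text \<open>The second fact describes \<open>\<eta> A\<close> after the unit is applied, where the
  chosen inverse has cancelled; naturality is derived from this description.\<close>

lemma \<eta>:
  assumes A: "kalg A" "small (carrier (fst A))"
  shows "\<exists>k. kalg_inverse (GO (FO A)) A (\<eta> A) k"
    and "a \<in> carrier (fst (GO (FO A))) \<Longrightarrow>
      kalg_unit A (\<eta> A a) = ccoalg_dual_map (kalg_dual A) (FO A) (FI A) (GJ (FO A) a)"
proof -
  let ?X = "FO A" and ?E = "ccoalg_dual (kalg_dual A)"
  note X = FO [OF A] FO_small [OF A]
  define v where "v = (SOME v. kalg_inverse A ?E (kalg_unit A) v)"
  have v: "kalg_inverse A ?E (kalg_unit A) v"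
    unfolding v_def using kalg_unit_iso [OF A(1)] by (metis kalg_isoE someI_ex)
  have \<eta>: "\<eta> A = kalg_comp (GO ?X) (kalg_comp (ccoalg_dual ?X) v (ccoalg_dual_map (kalg_dual A) ?X (FI A))) (GJ ?X)"
    by (simp add: \<eta>_def v_def Let_def)
  have E: "kalg ?E"
    by (rule kalg_ccoalg_dual [OF ccoalg_kalg_dual [OF A(1)]])
  note inv = ccoalg_dual_inverse [OF ccoalg_kalg_dual [OF A(1)] X(1) FI_FJ [OF A]]
  show "\<exists>k. kalg_inverse (GO ?X) A (\<eta> A) k"
    unfolding \<eta> using kalg_inverse_comp [OF GO [OF X] kalg_ccoalg_dual [OF X(1)] A(1) kalg_inverse_sym [OF GI_GJ [OF X]]
        kalg_inverse_comp [OF kalg_ccoalg_dual [OF X(1)] E A(1) inv kalg_inverse_sym [OF v]]] by blast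
  assume a: "a \<in> carrier (fst (GO ?X))"
  have b: "GJ ?X a \<in> carrier (fst (ccoalg_dual ?X))"
    by (rule kalg_hom_closed [OF GJ [OF X] a])
  have "ccoalg_dual_map (kalg_dual A) ?X (FI A) (GJ ?X a) \<in> carrier (fst ?E)"
    by (rule kalg_hom_closed [OF _ b]) (use inv in \<open>simp add: kalg_inverse_def\<close>)
  then show "kalg_unit A (\<eta> A a) = ccoalg_dual_map (kalg_dual A) ?X (FI A) (GJ ?X a)"
    using v a b unfolding \<eta> by (simp add: kalg_comp_apply kalg_inverse_def)
qed

lemma \<epsilon>:
  assumes X: "ccoalg X" "small (points (fst X))"
  shows "\<exists>k. ccoalg_inverse (FO (GO X)) X (\<epsilon> X) k"
    and "x \<in> points (fst (FO (GO X))) \<Longrightarrow>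
      ccoalg_unit X (\<epsilon> X x) = kalg_dual_map (ccoalg_dual X) (GO X) (GI X) (FJ (GO X) x)"
proof -
  let ?A = "GO X" and ?E = "kalg_dual (ccoalg_dual X)"
  note A = GO [OF X] GO_small [OF X]
  define v where "v = (SOME v. ccoalg_inverse X ?E (ccoalg_unit X) v)"
  have v: "ccoalg_inverse X ?E (ccoalg_unit X) v"
    unfolding v_def using ccoalgebra.unit_iso [OF ccoalgebra.intro [OF X(1)]] by (metis ccoalg_isoE someI_ex)
  have \<epsilon>: "\<epsilon> X = ccoalg_comp (FO ?A) (ccoalg_comp (kalg_dual ?A) v (kalg_dual_map (ccoalg_dual X) ?A (GI X))) (FJ ?A)"
    by (simp add: \<epsilon>_def v_def Let_def)
  have E: "ccoalg ?E"
    by (rule ccoalg_kalg_dual [OF kalg_ccoalg_dual [OF X(1)]])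
  note inv = kalg_dual_inverse [OF kalg_ccoalg_dual [OF X(1)] A(1) GI_GJ [OF X]]
  show "\<exists>k. ccoalg_inverse (FO ?A) X (\<epsilon> X) k"
    unfolding \<epsilon> using ccoalg_inverse_comp [OF FO [OF A] ccoalg_kalg_dual [OF A(1)] X(1) ccoalg_inverse_sym [OF FI_FJ [OF A]]
        ccoalg_inverse_comp [OF ccoalg_kalg_dual [OF A(1)] E X(1) inv ccoalg_inverse_sym [OF v]]] by blast
  assume x: "x \<in> points (fst (FO ?A))"
  have y: "FJ ?A x \<in> points (fst (kalg_dual ?A))"
    by (rule ccoalg_hom_closed [OF FJ [OF A] x])
  have "kalg_dual_map (ccoalg_dual X) ?A (GI X) (FJ ?A x) \<in> points (fst ?E)"
    by (rule ccoalg_hom_closed [OF _ y]) (use inv in \<open>simp add: ccoalg_inverse_def\<close>)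
  then show "ccoalg_unit X (\<epsilon> X x) = kalg_dual_map (ccoalg_dual X) ?A (GI X) (FJ ?A x)"
    using v x y unfolding \<epsilon> by (simp add: ccoalg_comp_apply ccoalg_inverse_def)
qed

text \<open>After applying the injective unit of \<open>A\<close>, the square splits into naturality
  of the copying maps \<open>FI\<close>, contravariant functoriality of the coalgebra dual and
  naturality of the unit.\<close>

lemma \<eta>_natural_iso: "natural_iso (op_cat (Alg_K small)) (op_cat (Alg_K small)) id_functor (comp_functor G F) \<eta>"
  unfolding natural_iso_def
proof (intro conjI ballI, unfold op_cat_simps Alg_K_simps id_functor_def comp_functor_def fst_conv snd_conv fst_F fst_G)
  fix A assume "kalg A \<and> small (carrier (fst A))"
  then have A: "kalg A" "small (carrier (fst A))"
    by auto
  show "iso_arrow (op_cat (Alg_K small)) A (GO (FO A)) (\<eta> A)"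
    using \<eta>(1) [OF A] iso_arrow_Alg_K by blast
  fix B h assume "kalg B \<and> small (carrier (fst B))" and h: "h \<in> kalg_hom B A"
  then have B: "kalg B" "small (carrier (fst B))"
    by auto
  note XA = FO [OF A] FO_small [OF A] and XB = FO [OF B] FO_small [OF B]
  have \<eta>A: "\<eta> A \<in> kalg_hom (GO (FO A)) A" and \<eta>B: "\<eta> B \<in> kalg_hom (GO (FO B)) B"
    using \<eta>(1) [OF A] \<eta>(1) [OF B] by (auto simp: kalg_inverse_def)
  note Fh = F_hom [OF B A h]
  note GFh = G_hom [OF XA XB Fh]
  show "kalg_comp (GO (FO B)) h (\<eta> B) = kalg_comp (GO (FO B)) (\<eta> A) (snd G (FO A) (FO B) (snd F A B h))"
  proof (rule kalg_hom_ext)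
    show "kalg_comp (GO (FO B)) h (\<eta> B) \<in> kalg_hom (GO (FO B)) A"
      by (rule kalg_comp_hom [OF GO [OF XB] B(1) A(1) \<eta>B h])
    show "kalg_comp (GO (FO B)) (\<eta> A) (snd G (FO A) (FO B) (snd F A B h)) \<in> kalg_hom (GO (FO B)) A"
      by (rule kalg_comp_hom [OF GO [OF XB] GO [OF XA] A(1) GFh \<eta>A])
    fix a assume a: "a \<in> carrier (fst (GO (FO B)))"
    let ?U = "GJ (FO B) a" and ?b = "snd G (FO A) (FO B) (snd F A B h) a"
    have U: "?U \<in> carrier (fst (ccoalg_dual (FO B)))"
      by (rule kalg_hom_closed [OF GJ [OF XB] a])
    have b: "?b \<in> carrier (fst (GO (FO A)))"
      by (rule kalg_hom_closed [OF GFh a])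
    have \<eta>a: "\<eta> B a \<in> carrier (fst B)"
      by (rule kalg_hom_closed [OF \<eta>B a])
    have V: "ccoalg_dual_map (FO A) (FO B) (snd F A B h) ?U \<in> carrier (fst (ccoalg_dual (FO A)))"
      by (rule kalg_hom_closed [OF ccoalg_dual_map_hom [OF XA(1) XB(1) Fh] U])
    \<comment> \<open>The copying maps are natural by construction: the \<open>FJ A\<close> inside
      the image of \<open>h\<close> cancels against \<open>FI A\<close>.\<close>
    have sq: "ccoalg_comp (kalg_dual A) (snd F A B h) (FI A) = ccoalg_comp (kalg_dual A) (FI B) (kalg_dual_map B A h)"
    proof (rule ccoalg_hom_ext)
      show "ccoalg_comp (kalg_dual A) (snd F A B h) (FI A) \<in> ccoalg_hom (kalg_dual A) (FO B)"
        by (rule ccoalg_comp_hom [OF ccoalg_kalg_dual [OF A(1)] XA(1) XB(1) FI [OF A] Fh])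
      show "ccoalg_comp (kalg_dual A) (FI B) (kalg_dual_map B A h) \<in> ccoalg_hom (kalg_dual A) (FO B)"
        by (rule ccoalg_comp_hom [OF ccoalg_kalg_dual [OF A(1)] ccoalg_kalg_dual [OF B(1)] XB(1) kalg_dual_map_hom [OF B(1) A(1) h] FI [OF B]])
      fix p assume p: "p \<in> points (fst (kalg_dual A))"
      show "ccoalg_comp (kalg_dual A) (snd F A B h) (FI A) p = ccoalg_comp (kalg_dual A) (FI B) (kalg_dual_map B A h) p"
        using p ccoalg_hom_closed [OF FI [OF A] p] FJ_FI [OF A p] by (simp add: ccoalg_comp_apply F_apply)
    qed
    have "kalg_unit A (\<eta> A ?b) = ccoalg_dual_map (kalg_dual A) (FO A) (FI A) (ccoalg_dual_map (FO A) (FO B) (snd F A B h) ?U)"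
      using \<eta>(2) [OF A b] a GJ_GI [OF XA V] by (simp add: G_apply)
    also have "\<dots> = ccoalg_dual_map (kalg_dual A) (FO B) (ccoalg_comp (kalg_dual A) (snd F A B h) (FI A)) ?U"
      using ccoalg_dual_map_comp [OF ccoalg_kalg_dual [OF A(1)] XA(1) XB(1) FI [OF A] Fh] U by (simp add: kalg_comp_apply)
    also have "\<dots> = ccoalg_dual_map (kalg_dual A) (kalg_dual B) (kalg_dual_map B A h) (ccoalg_dual_map (kalg_dual B) (FO B) (FI B) ?U)"
      unfolding sq
      using ccoalg_dual_map_comp [OF ccoalg_kalg_dual [OF A(1)] ccoalg_kalg_dual [OF B(1)] XB(1) kalg_dual_map_hom [OF B(1) A(1) h] FI [OF B]] U
      by (simp add: kalg_comp_apply)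
    also have "\<dots> = ccoalg_dual_map (kalg_dual A) (kalg_dual B) (kalg_dual_map B A h) (kalg_unit B (\<eta> B a))"
      using \<eta>(2) [OF B a] by simp
    also have "\<dots> = kalg_unit A (h (\<eta> B a))"
      using fun_cong [OF kalg_unit_natural [OF B(1) A(1) h], of "\<eta> B a"] \<eta>a by (simp add: kalg_comp_apply)
    finally have "kalg_unit A (\<eta> A ?b) = kalg_unit A (h (\<eta> B a))" .
    then have "\<eta> A ?b = h (\<eta> B a)"
      using kalg_unit_bij [OF A(1)] kalg_hom_closed [OF \<eta>A b] kalg_hom_closed [OF h \<eta>a]
      by (auto simp: bij_betw_def dest: inj_onD)
    then show "kalg_comp (GO (FO B)) h (\<eta> B) a = kalg_comp (GO (FO B)) (\<eta> A) (snd G (FO A) (FO B) (snd F A B h)) a"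
      using a by (simp add: kalg_comp_apply)
  qed
qed

text \<open>The mirror image of the argument for \<eta>: the square is compared after applying the
  injective unit of \<open>Y\<close>, and the copying maps involved are the
  \<open>GI\<close>.\<close>

lemma \<epsilon>_natural_iso: "natural_iso (Coalg_C small) (Coalg_C small) (comp_functor F G) id_functor \<epsilon>"
  unfolding natural_iso_def
proof (intro conjI ballI, unfold Coalg_C_simps id_functor_def comp_functor_def fst_conv snd_conv fst_F fst_G)
  fix X assume "ccoalg X \<and> small (points (fst X))"
  then have X: "ccoalg X" "small (points (fst X))"
    by auto
  show "iso_arrow (Coalg_C small) (FO (GO X)) X (\<epsilon> X)"
    using \<epsilon>(1) [OF X] iso_arrow_Coalg_C by blast
  fix Y h assume "ccoalg Y \<and> small (points (fst Y))" and h: "h \<in> ccoalg_hom X Y"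
  then have Y: "ccoalg Y" "small (points (fst Y))"
    by auto
  note AX = GO [OF X] GO_small [OF X] and AY = GO [OF Y] GO_small [OF Y]
  have \<epsilon>X: "\<epsilon> X \<in> ccoalg_hom (FO (GO X)) X" and \<epsilon>Y: "\<epsilon> Y \<in> ccoalg_hom (FO (GO Y)) Y"
    using \<epsilon>(1) [OF X] \<epsilon>(1) [OF Y] by (auto simp: ccoalg_inverse_def)
  note Gh = G_hom [OF X Y h]
  note FGh = F_hom [OF AY AX Gh]
  show "ccoalg_comp (FO (GO X)) (\<epsilon> Y) (snd F (GO X) (GO Y) (snd G X Y h)) = ccoalg_comp (FO (GO X)) h (\<epsilon> X)"
  proof (rule ccoalg_hom_ext)
    show "ccoalg_comp (FO (GO X)) h (\<epsilon> X) \<in> ccoalg_hom (FO (GO X)) Y"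
      by (rule ccoalg_comp_hom [OF FO [OF AX] X(1) Y(1) \<epsilon>X h])
    show "ccoalg_comp (FO (GO X)) (\<epsilon> Y) (snd F (GO X) (GO Y) (snd G X Y h)) \<in> ccoalg_hom (FO (GO X)) Y"
      by (rule ccoalg_comp_hom [OF FO [OF AX] FO [OF AY] Y(1) FGh \<epsilon>Y])
    fix x assume x: "x \<in> points (fst (FO (GO X)))"
    let ?p = "FJ (GO X) x" and ?y = "snd F (GO X) (GO Y) (snd G X Y h) x"
    have p: "?p \<in> points (fst (kalg_dual (GO X)))"
      by (rule ccoalg_hom_closed [OF FJ [OF AX] x])
    have y: "?y \<in> points (fst (FO (GO Y)))"
      by (rule ccoalg_hom_closed [OF FGh x])
    have \<epsilon>x: "\<epsilon> X x \<in> points (fst X)"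
      by (rule ccoalg_hom_closed [OF \<epsilon>X x])
    have q: "kalg_dual_map (GO Y) (GO X) (snd G X Y h) ?p \<in> points (fst (kalg_dual (GO Y)))"
      by (rule ccoalg_hom_closed [OF kalg_dual_map_hom [OF AY(1) AX(1) Gh] p])
    \<comment> \<open>Naturality of the copying maps on the algebra side: the \<open>GJ Y\<close>
      inside the image of \<open>h\<close> cancels against \<open>GI Y\<close>.\<close>
    have sq: "kalg_comp (ccoalg_dual Y) (snd G X Y h) (GI Y) = kalg_comp (ccoalg_dual Y) (GI X) (ccoalg_dual_map X Y h)"
    proof (rule kalg_hom_ext)
      show "kalg_comp (ccoalg_dual Y) (snd G X Y h) (GI Y) \<in> kalg_hom (ccoalg_dual Y) (GO X)"
        by (rule kalg_comp_hom [OF kalg_ccoalg_dual [OF Y(1)] AY(1) AX(1) GI [OF Y] Gh])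
      show "kalg_comp (ccoalg_dual Y) (GI X) (ccoalg_dual_map X Y h) \<in> kalg_hom (ccoalg_dual Y) (GO X)"
        by (rule kalg_comp_hom [OF kalg_ccoalg_dual [OF Y(1)] kalg_ccoalg_dual [OF X(1)] AX(1) ccoalg_dual_map_hom [OF X(1) Y(1) h] GI [OF X]])
      fix U assume U: "U \<in> carrier (fst (ccoalg_dual Y))"
      show "kalg_comp (ccoalg_dual Y) (snd G X Y h) (GI Y) U = kalg_comp (ccoalg_dual Y) (GI X) (ccoalg_dual_map X Y h) U"
        using U kalg_hom_closed [OF GI [OF Y] U] GJ_GI [OF Y U] by (simp add: kalg_comp_apply G_apply)
    qed
    have "ccoalg_unit Y (\<epsilon> Y ?y) = kalg_dual_map (ccoalg_dual Y) (GO Y) (GI Y) (kalg_dual_map (GO Y) (GO X) (snd G X Y h) ?p)"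
      using \<epsilon>(2) [OF Y y] x FJ_FI [OF AY q] by (simp add: F_apply)
    also have "\<dots> = kalg_dual_map (ccoalg_dual Y) (GO X) (kalg_comp (ccoalg_dual Y) (snd G X Y h) (GI Y)) ?p"
      using kalg_dual_map_comp [OF kalg_ccoalg_dual [OF Y(1)] AY(1) AX(1) GI [OF Y] Gh] p by (simp only: ccoalg_comp_apply)
    also have "\<dots> = kalg_dual_map (ccoalg_dual Y) (ccoalg_dual X) (ccoalg_dual_map X Y h) (kalg_dual_map (ccoalg_dual X) (GO X) (GI X) ?p)"
      unfolding sq
      using kalg_dual_map_comp [OF kalg_ccoalg_dual [OF Y(1)] kalg_ccoalg_dual [OF X(1)] AX(1) ccoalg_dual_map_hom [OF X(1) Y(1) h] GI [OF X]] p
      by (simp only: ccoalg_comp_apply)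
    also have "\<dots> = kalg_dual_map (ccoalg_dual Y) (ccoalg_dual X) (ccoalg_dual_map X Y h) (ccoalg_unit X (\<epsilon> X x))"
      using \<epsilon>(2) [OF X x] by simp
    also have "\<dots> = ccoalg_unit Y (h (\<epsilon> X x))"
      using fun_cong [OF ccoalg_unit_natural [OF X(1) Y(1) h], of "\<epsilon> X x"] \<epsilon>x by (simp add: ccoalg_comp_apply)
    finally have "ccoalg_unit Y (\<epsilon> Y ?y) = ccoalg_unit Y (h (\<epsilon> X x))" .
    then have "\<epsilon> Y ?y = h (\<epsilon> X x)"
      using ccoalgebra.unit_bij [OF ccoalgebra.intro [OF Y(1)]] ccoalg_hom_closed [OF \<epsilon>Y y] ccoalg_hom_closed [OF h \<epsilon>x]
      by (auto simp: bij_betw_def dest: inj_onD)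
    then show "ccoalg_comp (FO (GO X)) (\<epsilon> Y) (snd F (GO X) (GO Y) (snd G X Y h)) x = ccoalg_comp (FO (GO X)) h (\<epsilon> X) x"
      using x by (simp add: ccoalg_comp_apply)
  qed
qed

lemma dual_equivalence: "dually_equivalent (Alg_K small) (Coalg_C small)"
  unfolding dually_equivalent_def equivalent_categories_def
  using is_category_op [OF is_category_Alg_K] is_category_Coalg_C F_functor G_functor \<eta>_natural_iso \<epsilon>_natural_iso
  by blast

end

lemma universe_dual_equivalence:
  fixes small :: "'u set \<Rightarrow> bool"
  assumes U: "universe small"
  shows "dually_equivalent (Alg_K small) (Coalg_C small)"
proof -
  \<comment> \<open>A copy and its two isomorphisms are chosen together as one triple, since
    separate choices need not fit each other.\<close>
  define P where "P A t \<longleftrightarrow> ccoalg (fst t) \<and> small (points (fst (fst t))) \<and>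
      ccoalg_inverse (kalg_dual A) (fst t) (fst (snd t)) (snd (snd t))"
    for A :: "'u kalg" and t :: "'u ccoalg \<times> ('u set \<Rightarrow> 'u) \<times> ('u \<Rightarrow> 'u set)"
  define Q where "Q X t \<longleftrightarrow> kalg (fst t) \<and> small (carrier (fst (fst t))) \<and>
      kalg_inverse (ccoalg_dual X) (fst t) (fst (snd t)) (snd (snd t))"
    for X :: "'u ccoalg" and t :: "'u kalg \<times> ('u set \<Rightarrow> 'u) \<times> ('u \<Rightarrow> 'u set)"
  have exP: "\<exists>t. P A t" if A: "kalg A" "small (carrier (fst A))" for A
  proof -
    obtain X h k where "ccoalg X" "small (points (fst X))" "ccoalg_inverse (kalg_dual A) X h k"
      by (rule kalg_small_dual [OF U A])
    then show ?thesis
      by (intro exI [of _ "(X, h, k)"]) (simp add: P_def)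
  qed
  have f: "P A (SOME t. P A t)" if "kalg A" "small (carrier (fst A))" for A
    using exP [OF that] by (rule someI_ex)
  have exQ: "\<exists>t. Q X t" if X: "ccoalg X" "small (points (fst X))" for X
  proof -
    obtain A h k where "kalg A" "small (carrier (fst A))" "kalg_inverse (ccoalg_dual X) A h k"
      by (rule ccoalg_small_dual [OF U X])
    then show ?thesis
      by (intro exI [of _ "(A, h, k)"]) (simp add: Q_def)
  qed
  have g: "Q X (SOME t. Q X t)" if "ccoalg X" "small (points (fst X))" for X
    using exQ [OF that] by (rule someI_ex)
  let ?f = "\<lambda>A. SOME t. P A t" and ?g = "\<lambda>X. SOME t. Q X t"
  interpret small_duals small "\<lambda>A. fst (?f A)" "\<lambda>A. fst (snd (?f A))" "\<lambda>A. snd (snd (?f A))"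
    "\<lambda>X. fst (?g X)" "\<lambda>X. fst (snd (?g X))" "\<lambda>X. snd (snd (?g X))"
    by unfold_locales (use f g in \<open>simp_all only: P_def Q_def\<close>)
  show ?thesis
    by (rule dual_equivalence)
qed

theorem theorem5p10:
  fixes small :: "'u set \<Rightarrow> bool"
    and A :: "'a kalg" and B :: "'b kalg" and D :: "'c kalg"
    and X :: "'d ccoalg" and Y :: "'e ccoalg" and Z :: "'f ccoalg"
  shows
   "(universe small \<longrightarrow> dually_equivalent (Alg_K small) (Coalg_C small)) \<and>

    (kalg A \<longrightarrow> kalg_id A \<in> kalg_hom A A) \<and>
    (kalg A \<and> kalg B \<and> kalg D \<longrightarrow>
       (\<forall>h\<in>kalg_hom A B. \<forall>k\<in>kalg_hom B D. kalg_comp A k h \<in> kalg_hom A D)) \<and>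
    (ccoalg X \<longrightarrow> ccoalg_id X \<in> ccoalg_hom X X) \<and>
    (ccoalg X \<and> ccoalg Y \<and> ccoalg Z \<longrightarrow>
       (\<forall>h\<in>ccoalg_hom X Y. \<forall>k\<in>ccoalg_hom Y Z. ccoalg_comp X k h \<in> ccoalg_hom X Z)) \<and>

    (kalg A \<longrightarrow> ccoalg (kalg_dual A)) \<and>
    (kalg A \<and> kalg B \<longrightarrow>
       (\<forall>h\<in>kalg_hom A B. kalg_dual_map A B h \<in> ccoalg_hom (kalg_dual B) (kalg_dual A))) \<and>
    (kalg A \<longrightarrow> kalg_dual_map A A (kalg_id A) = ccoalg_id (kalg_dual A)) \<and>
    (kalg A \<and> kalg B \<and> kalg D \<longrightarrow>
       (\<forall>h\<in>kalg_hom A B. \<forall>k\<in>kalg_hom B D.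
          kalg_dual_map A D (kalg_comp A k h) =
          ccoalg_comp (kalg_dual D) (kalg_dual_map A B h) (kalg_dual_map B D k))) \<and>

    (ccoalg X \<longrightarrow> kalg (ccoalg_dual X)) \<and>
    (ccoalg X \<and> ccoalg Y \<longrightarrow>
       (\<forall>h\<in>ccoalg_hom X Y. ccoalg_dual_map X Y h \<in> kalg_hom (ccoalg_dual Y) (ccoalg_dual X))) \<and>
    (ccoalg X \<longrightarrow> ccoalg_dual_map X X (ccoalg_id X) = kalg_id (ccoalg_dual X)) \<and>
    (ccoalg X \<and> ccoalg Y \<and> ccoalg Z \<longrightarrow>
       (\<forall>h\<in>ccoalg_hom X Y. \<forall>k\<in>ccoalg_hom Y Z.
          ccoalg_dual_map X Z (ccoalg_comp X k h) =
          kalg_comp (ccoalg_dual Z) (ccoalg_dual_map X Y h) (ccoalg_dual_map Y Z k))) \<and>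

    (kalg A \<longrightarrow> kalg_unit A \<in> kalg_iso A (ccoalg_dual (kalg_dual A))) \<and>
    (kalg A \<and> kalg B \<longrightarrow>
       (\<forall>h\<in>kalg_hom A B.
          kalg_comp A (kalg_unit B) h =
          kalg_comp A (ccoalg_dual_map (kalg_dual B) (kalg_dual A) (kalg_dual_map A B h))
            (kalg_unit A))) \<and>
    (ccoalg X \<longrightarrow> ccoalg_unit X \<in> ccoalg_iso X (kalg_dual (ccoalg_dual X))) \<and>
    (ccoalg X \<and> ccoalg Y \<longrightarrow>
       (\<forall>h\<in>ccoalg_hom X Y.
          ccoalg_comp X (ccoalg_unit Y) h =
          ccoalg_comp X (kalg_dual_map (ccoalg_dual Y) (ccoalg_dual X) (ccoalg_dual_map X Y h))
            (ccoalg_unit X)))"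
  using universe_dual_equivalence [of small] kalg_id_hom [of A] kalg_comp_hom [of A B D]
    ccoalg_id_hom [of X] ccoalg_comp_hom [of X Y Z] ccoalg_kalg_dual [of A] kalg_dual_map_hom [of A B]
    kalg_dual_map_id [of A] kalg_dual_map_comp [of A B D] kalg_ccoalg_dual [of X]
    ccoalg_dual_map_hom [of X Y] ccoalg_dual_map_id [of X] ccoalg_dual_map_comp [of X Y Z]
    kalg_unit_iso [of A] kalg_unit_natural [of A B]
    ccoalgebra.unit_iso [OF ccoalgebra.intro, of X] ccoalg_unit_natural [of X Y]
  by (intro conjI impI ballI; (elim conjE)?; simp only:)

end
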